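(* Let $E$ be a finite set, let $V\subseteq\mathbb{C}^E$ be a linear subspace not contained in any coordinate hyperplane of $\mathbb{C}^E$, and let $Y_V$ be the closure of $V$ in $(\mathbb{P}^1)^E$. Then every line bundle on $Y_V$ is (isomorphic to) the restriction to $Y_V$ of a line bundle on $(\mathbb{P}^1)^E$.
   Context: The embedding $\mathbb{C}\subset\mathbb{P}^1$ given by adding a point at infinity induces an embedding $\mathbb{C}^E\subset(\mathbb{P}^1)^E$. The closure $Y_V$ of $V$ in $(\mathbb{P}^1)^E$ is taken as a (reduced, irreducible) closed subvariety; it is called the matroid Schubert variety of $V$. For $V=\mathbb{C}^E$ one has $Y_{\mathbb{C}^E}=(\mathbb{P}^1)^E$. *)

theory Defs
  imports "HOL-Analysis.Analysis"
begin

section \<open>The variety $(\mathbb{P}^1)^E$\<close>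

datatype P1 = Fin complex | Infty

text \<open>Homogeneous coordinates: \<open>Fin z\<close> is \<open>[z : 1]\<close> and \<open>Infty\<close> is \<open>[1 : 0]\<close>.\<close>

fun hcoord0 :: "P1 \<Rightarrow> complex" where
  "hcoord0 (Fin z) = z"
| "hcoord0 Infty = 1"

fun hcoord1 :: "P1 \<Rightarrow> complex" where
  "hcoord1 (Fin z) = 1"
| "hcoord1 Infty = 0"

definition P1_power :: "'e set \<Rightarrow> ('e \<Rightarrow> P1) set" where
  "P1_power E = (E \<rightarrow>\<^sub>E UNIV)"

text \<open>The multihomogeneous polynomial of multidegree \<open>d\<close> with coefficients \<open>c\<close>, evaluated at the
  normalised homogeneous coordinates above.  Another choice of coordinates multiplies the values of
  all polynomials of multidegree \<open>d\<close> at a given point by one and the same nonzero scalar, so neither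
  the vanishing of a value nor the quotient of two values of equal multidegree depends on the
  choice.\<close>

definition multiform ::
    "'e set \<Rightarrow> ('e \<Rightarrow> nat) \<Rightarrow> (('e \<Rightarrow> nat) \<Rightarrow> complex) \<Rightarrow> ('e \<Rightarrow> P1) \<Rightarrow> complex" where
  "multiform E d c x =
     (\<Sum>i\<in>(\<Pi>\<^sub>E e\<in>E. {..d e}). c i * (\<Prod>e\<in>E. hcoord0 (x e) ^ i e * hcoord1 (x e) ^ (d e - i e)))"

definition zariski :: "'e set \<Rightarrow> ('e \<Rightarrow> P1) topology" where
  "zariski E = topology_generated_by {{x \<in> P1_power E. multiform E d c x \<noteq> 0} | d c. True}"

text \<open>Regular functions on a locally closed \<open>W\<close>, with its reduced structure: locally on \<open>W\<close>,
  quotients of multihomogeneous polynomials of equal multidegree.  The values of \<open>f\<close> outside \<open>W\<close>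
  are irrelevant.\<close>

definition regular_on :: "'e set \<Rightarrow> ('e \<Rightarrow> P1) set \<Rightarrow> (('e \<Rightarrow> P1) \<Rightarrow> complex) \<Rightarrow> bool" where
  "regular_on E W f \<longleftrightarrow>
     (\<forall>p\<in>W. \<exists>U d a b. openin (zariski E) U \<and> p \<in> U \<and>
        (\<forall>x\<in>U \<inter> W. multiform E d b x \<noteq> 0 \<and> f x = multiform E d a x / multiform E d b x))"


section \<open>Matroid Schubert varieties\<close>

definition linear_subspace :: "'e set \<Rightarrow> ('e \<Rightarrow> complex) set \<Rightarrow> bool" where
  "linear_subspace E V \<longleftrightarrow>
     V \<subseteq> (E \<rightarrow>\<^sub>E UNIV) \<and> (\<lambda>e\<in>E. 0) \<in> V \<and>
     (\<forall>v\<in>V. \<forall>w\<in>V. (\<lambda>e\<in>E. v e + w e) \<in> V) \<and>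
     (\<forall>a. \<forall>v\<in>V. (\<lambda>e\<in>E. a * v e) \<in> V)"

definition coord_hyperplane :: "'e set \<Rightarrow> 'e \<Rightarrow> ('e \<Rightarrow> complex) set" where
  "coord_hyperplane E e = {v \<in> E \<rightarrow>\<^sub>E UNIV. v e = 0}"

definition affine_embed :: "'e set \<Rightarrow> ('e \<Rightarrow> complex) \<Rightarrow> ('e \<Rightarrow> P1)" where
  "affine_embed E v = (\<lambda>e\<in>E. Fin (v e))"

definition matroid_schubert_variety :: "'e set \<Rightarrow> ('e \<Rightarrow> complex) set \<Rightarrow> ('e \<Rightarrow> P1) set" where
  "matroid_schubert_variety E V = zariski E closure_of (affine_embed E ` V)"


section \<open>Line bundles\<close>

text \<open>A line bundle is given by its total space, the projection to the base, addition and scalar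
  multiplication on the fibres, and an atlas of local trivialisations.  An element \<open>(W, \<phi>)\<close> of the
  atlas stands for the trivialisation \<open>l \<mapsto> (proj l, \<phi> l)\<close> from the part of the bundle over \<open>W\<close> to
  the product of \<open>W\<close> and the affine line; the algebraic structure of the total space is the one glued
  from these.\<close>

record ('e, 'l) line_bundle_data =
  total :: "'l set"
  proj :: "'l \<Rightarrow> ('e \<Rightarrow> P1)"
  fadd :: "'l \<Rightarrow> 'l \<Rightarrow> 'l"
  fscale :: "complex \<Rightarrow> 'l \<Rightarrow> 'l"
  atlas :: "(('e \<Rightarrow> P1) set \<times> ('l \<Rightarrow> complex)) set"

definition fibre :: "('e, 'l) line_bundle_data \<Rightarrow> ('e \<Rightarrow> P1) \<Rightarrow> 'l set" where
  "fibre L x = {l \<in> total L. proj L l = x}"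

definition local_trivialisation ::
    "'e set \<Rightarrow> ('e \<Rightarrow> P1) set \<Rightarrow> ('e, 'l) line_bundle_data \<Rightarrow>
     ('e \<Rightarrow> P1) set \<Rightarrow> ('l \<Rightarrow> complex) \<Rightarrow> bool" where
  "local_trivialisation E X L W \<phi> \<longleftrightarrow>
     openin (subtopology (zariski E) X) W \<and>
     (\<forall>x\<in>W. bij_betw \<phi> (fibre L x) UNIV \<and>
        (\<forall>l\<in>fibre L x. \<forall>m\<in>fibre L x. \<phi> (fadd L l m) = \<phi> l + \<phi> m) \<and>
        (\<forall>a. \<forall>l\<in>fibre L x. \<phi> (fscale L a l) = a * \<phi> l))"

text \<open>The vector space axioms on the fibres need not be listed: they follow from closure and the
  linear bijections with the complex numbers.  The transition functions \<open>g\<close> vanish nowhere because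
  both trivialisations are bijective on fibres.\<close>

definition line_bundle ::
    "'e set \<Rightarrow> ('e \<Rightarrow> P1) set \<Rightarrow> ('e, 'l) line_bundle_data \<Rightarrow> bool" where
  "line_bundle E X L \<longleftrightarrow>
     proj L ` total L \<subseteq> X \<and>
     (\<forall>x\<in>X. \<forall>l\<in>fibre L x. \<forall>m\<in>fibre L x. fadd L l m \<in> fibre L x) \<and>
     (\<forall>x\<in>X. \<forall>a. \<forall>l\<in>fibre L x. fscale L a l \<in> fibre L x) \<and>
     (\<forall>(W, \<phi>)\<in>atlas L. local_trivialisation E X L W \<phi>) \<and>
     (\<Union>(W, \<phi>)\<in>atlas L. W) = X \<and>
     (\<forall>(W, \<phi>)\<in>atlas L. \<forall>(W', \<phi>')\<in>atlas L.
        \<exists>g. regular_on E (W \<inter> W') g \<and>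
            (\<forall>x\<in>W \<inter> W'. \<forall>l\<in>fibre L x. \<phi>' l = g x * \<phi> l))"

text \<open>Morphisms of line bundles over the identity of \<open>X\<close>: fibrewise linear, and regular when read in
  the local trivialisations.\<close>

definition line_bundle_hom ::
    "'e set \<Rightarrow> ('e \<Rightarrow> P1) set \<Rightarrow> ('e, 'l) line_bundle_data \<Rightarrow> ('e, 'm) line_bundle_data \<Rightarrow>
     ('l \<Rightarrow> 'm) \<Rightarrow> bool" where
  "line_bundle_hom E X L M h \<longleftrightarrow>
     (\<forall>x\<in>X. h ` fibre L x \<subseteq> fibre M x \<and>
        (\<forall>k\<in>fibre L x. \<forall>l\<in>fibre L x. h (fadd L k l) = fadd M (h k) (h l)) \<and>
        (\<forall>a. \<forall>l\<in>fibre L x. h (fscale L a l) = fscale M a (h l))) \<and>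
     (\<forall>(W, \<phi>)\<in>atlas L. \<forall>(W', \<psi>)\<in>atlas M.
        \<exists>g. regular_on E (W \<inter> W') g \<and>
            (\<forall>x\<in>W \<inter> W'. \<forall>l\<in>fibre L x. \<psi> (h l) = g x * \<phi> l))"

definition line_bundle_isomorphic ::
    "'e set \<Rightarrow> ('e \<Rightarrow> P1) set \<Rightarrow> ('e, 'l) line_bundle_data \<Rightarrow> ('e, 'm) line_bundle_data \<Rightarrow> bool" where
  "line_bundle_isomorphic E X L M \<longleftrightarrow>
     (\<exists>h k. line_bundle_hom E X L M h \<and> line_bundle_hom E X M L k \<and>
        (\<forall>l\<in>total L. k (h l) = l) \<and> (\<forall>m\<in>total M. h (k m) = m))"

definition restrict_bundle ::
    "('e, 'l) line_bundle_data \<Rightarrow> ('e \<Rightarrow> P1) set \<Rightarrow> ('e, 'l) line_bundle_data" where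
  "restrict_bundle L Y =
     \<lparr>total = {l \<in> total L. proj L l \<in> Y}, proj = proj L, fadd = fadd L, fscale = fscale L,
      atlas = (\<lambda>(W, \<phi>). (W \<inter> Y, \<phi>)) ` atlas L\<rparr>"

text \<open>A type for the total spaces of line bundles on $(\mathbb{P}^1)^E$ when their existence is
  asserted, since one cannot quantify existentially over types.  This loses nothing: choosing a nonzero
  vector in every fibre identifies the total space of any line bundle with a set of pairs of a point
  and a complex number.\<close>

type_synonym 'e P1_power_bundle = "('e, ('e \<Rightarrow> P1) \<times> complex) line_bundle_data"

end

theory Submission
  imports Defs "HOL-Computational_Algebra.Polynomial" "HOL-Computational_Algebra.Factorial_Ring"
    "HOL-Computational_Algebra.Fundamental_Theorem_Algebra"
begin

text \<open>
  A linear retraction \<open>\<rho>\<close> onto \<open>V\<close> pulls everything back to polynomial functions in finitely many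
  variables, which form a factorial ring.  A frame \<open>t p\<close> of \<open>L\<close> near a point \<open>p\<close> of \<open>Y\<close> is a rational
  function times a frame near the point \<open>\<infinity>\<close> all of whose coordinates are infinite; comparing orders
  along prime divisors of \<open>V\<close> gives a rational section of \<open>L\<close> without zeros and poles on \<open>V\<close>, and
  this turns \<open>t p\<close> into a rational function \<open>\<phi> p\<close> on \<open>V\<close> whose zeros and poles lie where a form
  \<open>q p\<close>, nonzero at \<open>p\<close>, vanishes.  A form that is nonzero at \<open>\<infinity>\<close> has a product of coordinates as
  top homogeneous component, hence so do its divisors; this yields \<open>m \<in> \<int>\<^sup>E\<close> such that, for every
  \<open>w \<in> V\<close>, the order of growth of \<open>\<phi> p\<close> in the direction \<open>w\<close> is the sum of the \<open>m e\<close> with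
  \<open>w e \<noteq> 0\<close> whenever \<open>q p\<close> does not vanish on the corresponding boundary stratum.  A polynomial on
  \<open>V\<close> whose growth in all directions is bounded by a multidegree is a form of that multidegree, so
  \<open>q p ^ M * \<phi> p\<close> and its counterpart for the inverse of \<open>\<phi> p\<close> are forms for large \<open>M\<close>.  Therefore
  \<open>\<phi> p\<close> is a nowhere vanishing section of the line bundle of multidegree \<open>m\<close> near \<open>p\<close>, and
  \<open>t p \<mapsto> \<phi> p\<close> is the required isomorphism.
\<close>

text \<open>The obstacle is the boundary. A direction \<open>w\<close> in \<open>V\<close> leads to
  the stratum given by the set of \<open>e\<close> with \<open>w e \<noteq> 0\<close>. In general
  there are more such sets than elements of \<open>E\<close>, a line bundle yields an integer for
  each of them, and it is not evident that these integers are the sums of one vector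
  \<open>m\<close>. Unique factorisation forces it: numerator and denominator of the function that
  corrects the orders along the divisors of \<open>V\<close> divide a power of a single form that is
  nonzero at \<infinity>. The reference frame sits at \<infinity> because this point lies in the
  closure of every stratum, so a form that is nonzero there vanishes identically on none of them.
  Orders along boundary divisors never occur; growth along lines in \<open>V\<close> replaces them,
  and all identities are checked on \<open>V\<close> and carried over to its closure. The retraction
  spares a choice of basis: functions on \<open>V\<close> become polynomials in the given
  coordinates, and divisors of such polynomials are again functions on \<open>V\<close>.\<close>

section \<open>Polynomial functions in finitely many variables\<close>

text \<open>Polynomials are encoded by their values. Nothing is lost over an infinite field, and
  substitution and restriction to a line become statements about functions.\<close>

inductive polyfun :: "(('e \<Rightarrow> complex) \<Rightarrow> complex) \<Rightarrow> bool" where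
  polyfun_const: "polyfun (\<lambda>x. c)"
| polyfun_var: "polyfun (\<lambda>x. x e)"
| polyfun_add: "polyfun f \<Longrightarrow> polyfun g \<Longrightarrow> polyfun (\<lambda>x. f x + g x)"
| polyfun_mult: "polyfun f \<Longrightarrow> polyfun g \<Longrightarrow> polyfun (\<lambda>x. f x * g x)"

typedef 'e mpol = "{f :: ('e \<Rightarrow> complex) \<Rightarrow> complex. polyfun f}"
  morphisms ev Abs_mpol
  by (auto intro: polyfun_const)

setup_lifting type_definition_mpol

lemma mpol_eqI: "(\<And>x. ev f x = ev g x) \<Longrightarrow> f = g"
  by (metis ev_inject ext)

lift_definition Cst :: "complex \<Rightarrow> 'e mpol" is "\<lambda>c x. c"
  by (rule polyfun_const)

lift_definition Var :: "'e \<Rightarrow> 'e mpol" is "\<lambda>e x. x e"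
  by (rule polyfun_var)

lemma polyfun_line:
  assumes "polyfun f"
  shows "\<exists>P. \<forall>t. f (\<lambda>e. x e + t * y e) = poly P t"
  using assms
proof induction
  case (polyfun_const c)
  show ?case by (rule exI[of _ "[:c:]"]) simp
next
  case (polyfun_var e)
  show ?case by (rule exI[of _ "[:x e, y e:]"]) simp
next
  case (polyfun_add f g)
  then show ?case by (metis poly_add)
next
  case (polyfun_mult f g)
  then show ?case by (metis poly_mult)
qed

text \<open>On the line through \<open>x\<close> and \<open>y\<close> both functions are polynomials
  in one variable, where a product of nonzero factors is nonzero. The parameter is 0 at
  \<open>x\<close> and 1 at \<open>y\<close>.\<close>

lemma polyfun_no_zero_divisors:
  assumes "polyfun f" "polyfun g" "\<And>x. f x * g x = 0" "f x \<noteq> 0"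
  shows "g y = 0"
proof -
  let ?l = "\<lambda>t e. x e + t * (y e - x e)"
  obtain P Q where P: "\<And>t. f (?l t) = poly P t" and Q: "\<And>t. g (?l t) = poly Q t"
    using polyfun_line[OF assms(1), of x "\<lambda>e. y e - x e"]
      polyfun_line[OF assms(2), of x "\<lambda>e. y e - x e"] by blast
  have "poly (P * Q) = poly 0"
    using assms(3) by (auto simp: P[symmetric] Q[symmetric] fun_eq_iff)
  then have "P * Q = 0"
    using poly_eq_poly_eq_iff by blast
  moreover have "poly P 0 \<noteq> 0"
    using assms(4) by (simp add: P[symmetric])
  ultimately have "Q = 0" by auto
  then show ?thesis
    using Q[of 1] by simp
qed

instantiation mpol :: (type) idom
begin

lift_definition zero_mpol :: "'a mpol" is "\<lambda>x. 0"
  by (rule polyfun_const)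
lift_definition one_mpol :: "'a mpol" is "\<lambda>x. 1"
  by (rule polyfun_const)
lift_definition plus_mpol :: "'a mpol \<Rightarrow> 'a mpol \<Rightarrow> 'a mpol" is "\<lambda>f g x. f x + g x"
  by (rule polyfun_add)
lift_definition times_mpol :: "'a mpol \<Rightarrow> 'a mpol \<Rightarrow> 'a mpol" is "\<lambda>f g x. f x * g x"
  by (rule polyfun_mult)
lift_definition uminus_mpol :: "'a mpol \<Rightarrow> 'a mpol" is "\<lambda>f x. - f x"
proof -
  fix f :: "('a \<Rightarrow> complex) \<Rightarrow> complex"
  assume "polyfun f"
  from polyfun_mult[OF polyfun_const[of "-1"] this] show "polyfun (\<lambda>x. - f x)" by simp
qed
definition minus_mpol :: "'a mpol \<Rightarrow> 'a mpol \<Rightarrow> 'a mpol" where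
  "minus_mpol f g = f + - g"

instance
proof
  fix f g h :: "'a mpol"
  show "(f + g) + h = f + (g + h)" "f + g = g + f" "0 + f = f" "- f + f = 0" "(f * g) * h = f * (g * h)"
    "f * g = g * f" "1 * f = f" "(f + g) * h = f * h + g * h" "f * (g + h) = f * g + f * h" "0 * f = 0" "f * 0 = 0"
    by (transfer; simp add: algebra_simps fun_eq_iff)+
  show "f - g = f + - g" by (simp add: minus_mpol_def)
  show "(0 :: 'a mpol) \<noteq> 1"
    by transfer (auto dest: fun_cong)
  show "f \<noteq> 0 \<Longrightarrow> g \<noteq> 0 \<Longrightarrow> f * g \<noteq> 0"
  proof (transfer, rule notI)
    fix f g :: "('a \<Rightarrow> complex) \<Rightarrow> complex"
    assume *: "polyfun f" "polyfun g" "f \<noteq> (\<lambda>x. 0)" "g \<noteq> (\<lambda>x. 0)" "(\<lambda>x. f x * g x) = (\<lambda>x. 0)"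
    from *(3) obtain x where "f x \<noteq> 0" by auto
    then have "g y = 0" for y
      using polyfun_no_zero_divisors[OF *(1,2)] fun_cong[OF *(5)] by blast
    then show False using *(4) by auto
  qed
qed

end

lemma ev_simps [simp]:
  "ev (Cst c) x = c" "ev (Var e) x = x e" "ev 0 x = 0" "ev 1 x = 1" "ev (f + g) x = ev f x + ev g x"
  "ev (f * g) x = ev f x * ev g x" "ev (- f) x = - ev f x" "ev (f - g) x = ev f x - ev g x"
  by (simp_all add: Cst.rep_eq Var.rep_eq zero_mpol.rep_eq one_mpol.rep_eq plus_mpol.rep_eq
      times_mpol.rep_eq uminus_mpol.rep_eq
      minus_mpol_def del: add_uminus_conv_diff)

lemma ev_power [simp]: "ev (f ^ n) x = ev f x ^ n"
  by (induction n) auto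

lemma ev_sum [simp]: "ev (\<Sum>i\<in>A. f i) x = (\<Sum>i\<in>A. ev (f i) x)"
  by (induction A rule: infinite_finite_induct) auto

lemma ev_prod [simp]: "ev (\<Prod>i\<in>A. f i) x = (\<Prod>i\<in>A. ev (f i) x)"
  by (induction A rule: infinite_finite_induct) auto

lemma Cst_hom: "Cst (a + b) = Cst a + Cst b" "Cst (a * b) = Cst a * Cst b" "Cst 0 = 0" "Cst 1 = 1"
  "Cst (- a) = - Cst a" "Cst (a - b) = Cst a - Cst b"
  by (rule mpol_eqI; simp)+

lemma Cst_inject [simp]: "Cst a = Cst b \<longleftrightarrow> a = b"
  by (metis ev_simps(1))

lemma Cst_eq_0 [simp]: "Cst a = 0 \<longleftrightarrow> a = 0"
  by (metis Cst_hom(3) Cst_inject)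

lemma mpol_nonzero_point:
  assumes "f \<noteq> 0"
  obtains x where "ev f x \<noteq> 0"
  using assms mpol_eqI[of f 0] by auto

lemma mpol_induct [case_names Cst Var add mult]:
  assumes "\<And>c. P (Cst c)" "\<And>e. P (Var e)" "\<And>f g. P f \<Longrightarrow> P g \<Longrightarrow> P (f + g)"
    "\<And>f g. P f \<Longrightarrow> P g \<Longrightarrow> P (f * g)"
  shows "P f"
proof -
  have "polyfun g \<Longrightarrow> P (Abs_mpol g)" for g
  proof (induction rule: polyfun.induct)
    case (polyfun_const c)
    show ?case using assms(1)[of c] by (simp add: Cst_def)
  next
    case (polyfun_var e)
    show ?case using assms(2)[of e] by (simp add: Var_def)
  next
    case (polyfun_add f g)
    then show ?case using assms(3)[of "Abs_mpol f" "Abs_mpol g"]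
      by (simp add: plus_mpol_def Abs_mpol_inverse)
  next
    case (polyfun_mult f g)
    then show ?case using assms(4)[of "Abs_mpol f" "Abs_mpol g"]
      by (simp add: times_mpol_def Abs_mpol_inverse)
  qed
  from this[of "ev f"] show ?thesis
    using ev[of f] by (simp add: ev_inverse)
qed


section \<open>Substituting polynomials in an extra variable\<close>

lemma complex_poly_eqI:
  fixes p q :: "complex poly"
  assumes "\<And>t. poly p t = poly q t"
  shows "p = q"
  using assms poly_eq_poly_eq_iff by blast

definition pev :: "'e mpol poly \<Rightarrow> ('e \<Rightarrow> complex) \<Rightarrow> complex poly" where
  "pev p x = map_poly (\<lambda>c. ev c x) p"

lemma coeff_pev [simp]: "coeff (pev p x) i = ev (coeff p i) x"
  by (simp add: pev_def coeff_map_poly)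

lemma pev_hom [simp]:
  "pev 0 x = 0" "pev 1 x = 1" "pev (p + q) x = pev p x + pev q x" "pev (p * q) x = pev p x * pev q x"
  "pev (pCons c p) x = pCons (ev c x) (pev p x)"
  by (rule poly_eqI; simp add: coeff_mult coeff_1 coeff_pCons split: nat.splits)+

lemma poly_pev: "poly (pev p x) (ev g x) = ev (poly p g) x"
  by (induction p) auto

lemma pev_eqI:
  assumes "\<And>x. pev p x = pev q x"
  shows "p = q"
  by (rule poly_eqI, rule mpol_eqI) (metis assms coeff_pev)

lemma degree_pev_le: "degree (pev p x) \<le> degree p"
  by (rule degree_le) (simp add: coeff_eq_0)

text \<open>There is no syntax to recurse over, so the result of a substitution is characterised by
  its values; existence is an induction over the closure rules of \<open>polyfun\<close>.\<close>

definition psub :: "('e \<Rightarrow> 'e mpol poly) \<Rightarrow> 'e mpol \<Rightarrow> 'e mpol poly" where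
  "psub \<sigma> f = (THE p. \<forall>x t. poly (pev p x) t = ev f (\<lambda>e. poly (pev (\<sigma> e) x) t))"

lemma poly_psub: "poly (pev (psub \<sigma> f) x) t = ev f (\<lambda>e. poly (pev (\<sigma> e) x) t)"
proof -
  have "\<exists>p. \<forall>x t. poly (pev p x) t = ev f (\<lambda>e. poly (pev (\<sigma> e) x) t)"
  proof (induction f rule: mpol_induct)
    case (Cst c)
    show ?case by (rule exI[of _ "[:Cst c:]"]) simp
  next
    case (Var e)
    show ?case by (rule exI[of _ "\<sigma> e"]) simp
  next
    case (add f g)
    then obtain p q where "\<forall>x t. poly (pev p x) t = ev f (\<lambda>e. poly (pev (\<sigma> e) x) t)"
      "\<forall>x t. poly (pev q x) t = ev g (\<lambda>e. poly (pev (\<sigma> e) x) t)" by blast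
    then show ?case by (intro exI[of _ "p + q"]) simp
  next
    case (mult f g)
    then obtain p q where "\<forall>x t. poly (pev p x) t = ev f (\<lambda>e. poly (pev (\<sigma> e) x) t)"
      "\<forall>x t. poly (pev q x) t = ev g (\<lambda>e. poly (pev (\<sigma> e) x) t)" by blast
    then show ?case by (intro exI[of _ "p * q"]) simp
  qed
  moreover have "p = q" if "\<forall>x t. poly (pev p x) t = ev f (\<lambda>e. poly (pev (\<sigma> e) x) t)"
      "\<forall>x t. poly (pev q x) t = ev f (\<lambda>e. poly (pev (\<sigma> e) x) t)" for p q
    using that by (intro pev_eqI) (metis poly_eq_poly_eq_iff ext)
  ultimately have "\<exists>!p. \<forall>x t. poly (pev p x) t = ev f (\<lambda>e. poly (pev (\<sigma> e) x) t)"
    by blast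
  from theI'[OF this] show ?thesis
    unfolding psub_def by blast
qed

lemma psub_unique:
  assumes "\<And>x t. poly (pev p x) t = ev f (\<lambda>e. poly (pev (\<sigma> e) x) t)"
  shows "psub \<sigma> f = p"
  by (rule pev_eqI) (metis assms poly_psub poly_eq_poly_eq_iff ext)

lemma psub_simps [simp]:
  "psub \<sigma> (Cst c) = [:Cst c:]" "psub \<sigma> (Var e) = \<sigma> e" "psub \<sigma> (f + g) = psub \<sigma> f + psub \<sigma> g"
  "psub \<sigma> (f * g) = psub \<sigma> f * psub \<sigma> g" "psub \<sigma> 0 = 0" "psub \<sigma> 1 = 1"
  by (rule psub_unique; simp add: poly_psub)+

lemma psub_power [simp]: "psub \<sigma> (f ^ n) = psub \<sigma> f ^ n"
  by (induction n) auto

lemma psub_sum [simp]: "psub \<sigma> (\<Sum>i\<in>A. f i) = (\<Sum>i\<in>A. psub \<sigma> (f i))"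
  by (induction A rule: infinite_finite_induct) auto

lemma psub_prod [simp]: "psub \<sigma> (\<Prod>i\<in>A. f i) = (\<Prod>i\<in>A. psub \<sigma> (f i))"
  by (induction A rule: infinite_finite_induct) auto

text \<open>With \<open>T\<close> the extra variable: \<open>f(T x)\<close>, \<open>f(x + T w)\<close>, and \<open>f\<close> with \<open>T\<close> in place of the
  variable \<open>s\<close>.\<close>

definition scl :: "'e mpol \<Rightarrow> 'e mpol poly" where
  "scl = psub (\<lambda>e. [:0, Var e:])"

definition shf :: "('e \<Rightarrow> complex) \<Rightarrow> 'e mpol \<Rightarrow> 'e mpol poly" where
  "shf w = psub (\<lambda>e. [:Var e, Cst (w e):])"

definition xpn :: "'e \<Rightarrow> 'e mpol \<Rightarrow> 'e mpol poly" where
  "xpn s = psub (\<lambda>e. if e = s then [:0, 1:] else [:Var e:])"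

lemmas scl_simps [simp] = psub_simps[of "\<lambda>e. [:0, Var e:]", folded scl_def]
  psub_power[of "\<lambda>e. [:0, Var e:]", folded scl_def]
  psub_sum[of "\<lambda>e. [:0, Var e:]", folded scl_def]
  psub_prod[of "\<lambda>e. [:0, Var e:]", folded scl_def]

lemmas shf_simps [simp] = psub_simps[of "\<lambda>e. [:Var e, Cst (w e):]", folded shf_def]
  psub_power[of "\<lambda>e. [:Var e, Cst (w e):]", folded shf_def]
  psub_sum[of "\<lambda>e. [:Var e, Cst (w e):]", folded shf_def]
  psub_prod[of "\<lambda>e. [:Var e, Cst (w e):]", folded shf_def]
  for w

lemmas xpn_simps [simp] = psub_simps[of "\<lambda>e. if e = s then [:0, 1:] else [:Var e:]", folded xpn_def]
  for s

lemma poly_scl: "poly (pev (scl f) x) t = ev f (\<lambda>e. t * x e)"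
  by (simp add: scl_def poly_psub)

lemma poly_shf: "poly (pev (shf w f) x) t = ev f (\<lambda>e. x e + t * w e)"
  by (simp add: shf_def poly_psub)

lemma poly_xpn: "poly (pev (xpn s f) x) t = ev f (x(s := t))"
  by (simp add: xpn_def poly_psub fun_upd_def if_distrib[of "\<lambda>p. poly (pev p x) t"] cong: if_cong)

lemma poly_xpn_Var: "poly (xpn s f) (Var s) = f"
  by (rule mpol_eqI) (simp add: poly_pev[symmetric] poly_xpn)

lemma scl_eq_0_iff [simp]: "scl f = 0 \<longleftrightarrow> f = 0"
proof
  assume "scl f = 0"
  then have "ev f x = 0" for x
    using poly_scl[of f x 1] by simp
  then show "f = 0" by (intro mpol_eqI) simp
qed simp

lemma shf_eq_0_iff [simp]: "shf w f = 0 \<longleftrightarrow> f = 0"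
proof
  assume "shf w f = 0"
  then have "ev f x = 0" for x
    using poly_shf[of w f x 0] by simp
  then show "f = 0" by (intro mpol_eqI) simp
qed simp

lemma xpn_inject [simp]: "xpn s f = xpn s g \<longleftrightarrow> f = g"
  by (metis poly_xpn_Var)

lemma xpn_eq_0_iff [simp]: "xpn s f = 0 \<longleftrightarrow> f = 0"
  using xpn_inject[of s f 0] by simp


section \<open>Unique factorisation\<close>

text \<open>The polynomial ring in the variables from \<open>S\<close>, again described through
  values.\<close>

definition Pol :: "'e set \<Rightarrow> 'e mpol set" where
  "Pol S = {f. \<forall>x y. (\<forall>e\<in>S. x e = y e) \<longrightarrow> ev f x = ev f y}"

lemma PolD: "f \<in> Pol S \<Longrightarrow> (\<And>e. e \<in> S \<Longrightarrow> x e = y e) \<Longrightarrow> ev f x = ev f y"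
  by (auto simp: Pol_def)

lemma Pol_closed:
  "Cst c \<in> Pol S" "0 \<in> Pol S" "1 \<in> Pol S" "e \<in> S \<Longrightarrow> Var e \<in> Pol S"
  "f \<in> Pol S \<Longrightarrow> g \<in> Pol S \<Longrightarrow> f + g \<in> Pol S" "f \<in> Pol S \<Longrightarrow> g \<in> Pol S \<Longrightarrow> f - g \<in> Pol S"
  "f \<in> Pol S \<Longrightarrow> g \<in> Pol S \<Longrightarrow> f * g \<in> Pol S" "f \<in> Pol S \<Longrightarrow> f ^ n \<in> Pol S"
proof -
  show "f \<in> Pol S \<Longrightarrow> g \<in> Pol S \<Longrightarrow> f + g \<in> Pol S" "f \<in> Pol S \<Longrightarrow> g \<in> Pol S \<Longrightarrow> f - g \<in> Pol S"
    "f \<in> Pol S \<Longrightarrow> g \<in> Pol S \<Longrightarrow> f * g \<in> Pol S" "f \<in> Pol S \<Longrightarrow> f ^ n \<in> Pol S"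
    unfolding Pol_def by (simp_all, metis+)
qed (auto simp: Pol_def)

lemma Pol_mono: "f \<in> Pol S \<Longrightarrow> S \<subseteq> T \<Longrightarrow> f \<in> Pol T"
  unfolding Pol_def by blast

lemma Pol_finite: "\<exists>S. finite S \<and> f \<in> Pol S"
proof (induction f rule: mpol_induct)
  case (Cst c)
  show ?case using Pol_closed(1) by blast
next
  case (Var e)
  show ?case using Pol_closed(4)[of e "{e}"] by blast
next
  case (add f g)
  then show ?case by (meson Pol_closed(5) Pol_mono finite_UnI inf_sup_ord(3,4))
next
  case (mult f g)
  then show ?case by (meson Pol_closed(7) Pol_mono finite_UnI inf_sup_ord(3,4))
qed

text \<open>\<open>degree (scl f)\<close> is the total degree of \<open>f\<close>, for nonzero
  \<open>f\<close>. Being additive, and zero only on constants, it is the measure for the inductions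
  over factorisations.\<close>

lemma degree_mult_scl: "f \<noteq> 0 \<Longrightarrow> g \<noteq> 0 \<Longrightarrow> degree (scl (f * g)) = degree (scl f) + degree (scl g)"
  by (simp add: degree_mult_eq)

lemma degree_scl_eq_0:
  assumes "degree (scl f) = 0"
  obtains c where "f = Cst c"
proof -
  obtain a where a: "scl f = [:a:]"
    using assms degree_eq_zeroE by blast
  have "ev f x = ev f (\<lambda>_. 0)" for x
    using poly_scl[of f x 0] poly_scl[of f x 1] a by simp
  then have "f = Cst (ev f (\<lambda>_. 0))"
    by (intro mpol_eqI) simp
  then show ?thesis using that by blast
qed

lemma unit_iff: "(f :: 'e mpol) dvd 1 \<longleftrightarrow> (\<exists>c. c \<noteq> 0 \<and> f = Cst c)"
proof
  assume "f dvd 1"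
  then obtain g where g: "1 = f * g" by (auto simp: dvd_def)
  then have "f \<noteq> 0" "g \<noteq> 0" by auto
  with g degree_mult_scl[of f g] have "degree (scl f) = 0" by simp
  then show "\<exists>c. c \<noteq> 0 \<and> f = Cst c"
    using degree_scl_eq_0[of f] \<open>f \<noteq> 0\<close> by (metis Cst_eq_0)
next
  assume "\<exists>c. c \<noteq> 0 \<and> f = Cst c"
  then obtain c where "c \<noteq> 0" "f = Cst c" by blast
  then have "f * Cst (inverse c) = 1"
    by (simp flip: Cst_hom)
  then show "f dvd 1" by (metis dvdI)
qed

lemma degree_scl_unit: "f \<noteq> 0 \<Longrightarrow> degree (scl f) = 0 \<longleftrightarrow> f dvd 1"
  by (metis Cst_eq_0 degree_scl_eq_0 unit_iff degree_pCons_0 scl_simps(1))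

text \<open>A non-unit divisor of least total degree cannot be a product of two non-units: one
  factor would be a non-unit divisor of smaller degree.\<close>

lemma irreducible_divisor:
  fixes f :: "'e mpol"
  assumes "f \<noteq> 0" "\<not> f dvd 1"
  obtains p where "irreducible p" "p dvd f"
proof -
  define D where "D p \<longleftrightarrow> p dvd f \<and> \<not> p dvd 1" for p
  obtain p where p: "D p" "\<And>q. D q \<Longrightarrow> degree (scl p) \<le> degree (scl q)"
    using arg_min_nat_lemma[of D f "\<lambda>p. degree (scl p)"] D_def[of f] assms(2) by auto
  have p0: "p \<noteq> 0" using p(1) assms(1) unfolding D_def by auto
  have "irreducible p"
  proof (rule irreducibleI)
    show "p \<noteq> 0" by fact
    show "\<not> p dvd 1" using p(1) unfolding D_def by blast
    fix a b assume ab: "p = a * b"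
    show "a dvd 1 \<or> b dvd 1"
    proof (rule ccontr)
      assume n: "\<not> (a dvd 1 \<or> b dvd 1)"
      have nz: "a \<noteq> 0" "b \<noteq> 0" using ab p0 by auto
      have "D a" using p(1) n ab unfolding D_def by (meson dvd_triv_left dvd_trans)
      then have "degree (scl b) = 0"
        using p(2)[of a] degree_mult_scl[OF nz] ab by simp
      then show False using n degree_scl_unit nz by blast
    qed
  qed
  with p(1) show ?thesis using that unfolding D_def by blast
qed

lemma irreducible_factor_induct [consumes 1, case_names unit mult]:
  fixes f :: "'e mpol"
  assumes "f \<noteq> 0"
    and unit: "\<And>u. u dvd 1 \<Longrightarrow> Q u"
    and mult: "\<And>p g. irreducible p \<Longrightarrow> g \<noteq> 0 \<Longrightarrow> Q g \<Longrightarrow> Q (p * g)"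
  shows "Q f"
  using assms(1)
proof (induction "degree (scl f)" arbitrary: f rule: less_induct)
  case less
  show ?case
  proof (cases "f dvd 1")
    case False
    then obtain p g where p: "irreducible p" "f = p * g"
      using irreducible_divisor[of f] less.prems by (metis dvdE)
    have nz: "p \<noteq> 0" "g \<noteq> 0" using p less.prems by auto
    have "degree (scl p) \<noteq> 0"
      using p(1) degree_scl_unit[of p] nz irreducible_not_unit by blast
    then have "Q g"
      using less.hyps[of g] degree_mult_scl[OF nz] p nz by simp
    then show ?thesis using mult p nz by blast
  qed (rule unit)
qed

section \<open>Adjoining one variable: Gauss's lemma\<close>

lemma xpn_indep:
  assumes "f \<in> Pol S" "s \<notin> S"
  shows "xpn s f = [:f:]"
proof (rule pev_eqI)
  fix x
  have "poly (pev (xpn s f) x) t = poly (pev [:f:] x) t" for t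
  proof -
    have "ev f (x(s := t)) = ev f x"
      by (rule PolD[OF assms(1)]) (use assms(2) in auto)
    then show ?thesis by (simp add: poly_xpn)
  qed
  then show "pev (xpn s f) x = pev [:f:] x"
    by (rule complex_poly_eqI)
qed

lemma degree_mult_xpn: "f \<noteq> 0 \<Longrightarrow> g \<noteq> 0 \<Longrightarrow> degree (xpn s (f * g)) = degree (xpn s f) + degree (xpn s g)"
  by (simp add: degree_mult_eq)

text \<open>Degrees in a variable \<open>s\<close> add up, so a divisor of a polynomial free of
  \<open>s\<close> is free of \<open>s\<close>. To pass from single variables to all of them at
  once, only the finitely many variables that occur in \<open>d\<close> have to be changed, one
  after the other.\<close>

lemma Pol_divisor:
  assumes c: "c \<in> Pol S" "c \<noteq> 0" and "d dvd c"
  shows "d \<in> Pol S"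
proof -
  obtain e where e: "c = d * e" using \<open>d dvd c\<close> by auto
  then have nz: "d \<noteq> 0" "e \<noteq> 0" using c by auto
  have indep: "ev d (x(s := t)) = ev d x" if "s \<notin> S" for s x t
  proof -
    have "degree (xpn s d) = 0"
      using degree_mult_xpn[OF nz, of s] xpn_indep[OF c(1) that] e by simp
    then obtain a where "xpn s d = [:a:]" using degree_eq_zeroE by blast
    then show ?thesis using poly_xpn[of s d x t] poly_xpn[of s d x "x s"] by simp
  qed
  have override: "ev d (override_on x y F) = ev d x" if "finite F" "F \<inter> S = {}" for F x y
    using that
  proof (induction F rule: finite_induct)
    case (insert s F)
    have "override_on x y (insert s F) = (override_on x y F)(s := y s)"
      by (auto simp: override_on_def)
    moreover have "s \<notin> S" using insert.prems by auto
    ultimately show ?case using insert.IH insert.prems indep[of s] by (auto simp del: fun_upd_apply)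
  qed simp
  obtain T where T: "finite T" "d \<in> Pol T" using Pol_finite by blast
  show ?thesis
    unfolding Pol_def
  proof (intro CollectI allI impI)
    fix x y :: "'a \<Rightarrow> complex" assume xy: "\<forall>e\<in>S. x e = y e"
    have "ev d x = ev d (override_on x y (T - S))"
      using override[of "T - S" x y] T(1) by (simp add: Diff_disjoint Int_commute)
    also have "\<dots> = ev d y"
      by (rule PolD[OF T(2)]) (use xy in \<open>auto simp: override_on_def\<close>)
    finally show "ev d x = ev d y" .
  qed
qed

lemma coeff_xpn_Pol:
  assumes "f \<in> Pol (insert s S)"
  shows "coeff (xpn s f) i \<in> Pol S"
  unfolding Pol_def
proof (intro CollectI allI impI)
  fix x y :: "'a \<Rightarrow> complex" assume xy: "\<forall>e\<in>S. x e = y e"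
  have "poly (pev (xpn s f) x) t = poly (pev (xpn s f) y) t" for t
    unfolding poly_xpn by (rule PolD[OF assms]) (use xy in auto)
  then have "pev (xpn s f) x = pev (xpn s f) y"
    by (rule complex_poly_eqI)
  then show "ev (coeff (xpn s f) i) x = ev (coeff (xpn s f) i) y"
    by (metis coeff_pev)
qed

lemma Pol_degree_xpn: "f \<in> Pol (insert s S) \<Longrightarrow> degree (xpn s f) = 0 \<Longrightarrow> f \<in> Pol S"
proof -
  assume f: "f \<in> Pol (insert s S)" "degree (xpn s f) = 0"
  then have "f = coeff (xpn s f) 0"
    using poly_xpn_Var[of s f] by (auto elim!: degree_eq_zeroE)
  then show "f \<in> Pol S" using coeff_xpn_Pol[OF f(1), of 0] by simp
qed

text \<open>The claim to be proved by adding variables one at a time. Divisibility is that of the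
  full ring, which makes no difference: cofactors of nonzero elements of \<open>Pol S\<close> stay
  in \<open>Pol S\<close> by \<open>Pol_divisor\<close>.\<close>

definition irreducibles_prime :: "'e set \<Rightarrow> bool" where
  "irreducibles_prime S \<longleftrightarrow>
     (\<forall>p\<in>Pol S. irreducible p \<longrightarrow> (\<forall>a\<in>Pol S. \<forall>b\<in>Pol S. p dvd a * b \<longrightarrow> p dvd a \<or> p dvd b))"

lemma dvd_iff_dvd_coeffs:
  assumes "p \<in> Pol S" "s \<notin> S"
  shows "p dvd f \<longleftrightarrow> (\<forall>i. p dvd coeff (xpn s f) i)"
proof
  assume "p dvd f"
  then obtain g where "f = p * g" by auto
  then show "\<forall>i. p dvd coeff (xpn s f) i"
    using xpn_indep[OF assms] by simp
next
  assume *: "\<forall>i. p dvd coeff (xpn s f) i"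
  have "p dvd poly (xpn s f) (Var s)"
    unfolding poly_altdef using * by (intro dvd_sum) (auto intro: dvd_mult2)
  then show "p dvd f" by (simp add: poly_xpn_Var)
qed

text \<open>Gauss's argument: if \<open>i\<close> and \<open>j\<close> are the first indices at
  which \<open>p\<close> fails to divide a coefficient of \<open>a\<close> and of \<open>b\<close>,
  then in the coefficient of index \<open>i + j\<close> of the product all terms but one are
  divisible by \<open>p\<close>.\<close>

lemma irreducible_prime_step_const:
  assumes S: "irreducibles_prime S" "s \<notin> S"
    and p: "p \<in> Pol S" "irreducible p"
    and ab: "a \<in> Pol (insert s S)" "b \<in> Pol (insert s S)" "p dvd a * b"
  shows "p dvd a \<or> p dvd b"
proof (rule ccontr)
  assume "\<not> ?thesis"
  then have ex: "\<exists>i. \<not> p dvd coeff (xpn s a) i" "\<exists>j. \<not> p dvd coeff (xpn s b) j"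
    using dvd_iff_dvd_coeffs[OF p(1) S(2)] by blast+
  define i where "i = (LEAST i. \<not> p dvd coeff (xpn s a) i)"
  define j where "j = (LEAST j. \<not> p dvd coeff (xpn s b) j)"
  have i: "\<not> p dvd coeff (xpn s a) i" "\<And>k. k < i \<Longrightarrow> p dvd coeff (xpn s a) k"
    unfolding i_def using ex(1) by (rule LeastI_ex) (use not_less_Least in blast)
  have j: "\<not> p dvd coeff (xpn s b) j" "\<And>k. k < j \<Longrightarrow> p dvd coeff (xpn s b) k"
    unfolding j_def using ex(2) by (rule LeastI_ex) (use not_less_Least in blast)
  let ?t = "\<lambda>k. coeff (xpn s a) k * coeff (xpn s b) (i + j - k)"
  have "p dvd coeff (xpn s (a * b)) (i + j)"
    using ab(3) dvd_iff_dvd_coeffs[OF p(1) S(2)] by blast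
  then have "p dvd (\<Sum>k\<le>i + j. ?t k)"
    by (simp add: coeff_mult)
  also have "(\<Sum>k\<le>i + j. ?t k) = ?t i + (\<Sum>k\<in>{..i + j} - {i}. ?t k)"
    by (rule sum.remove) auto
  finally have "p dvd ?t i + (\<Sum>k\<in>{..i + j} - {i}. ?t k)" .
  moreover have "p dvd (\<Sum>k\<in>{..i + j} - {i}. ?t k)"
  proof (rule dvd_sum)
    fix k assume "k \<in> {..i + j} - {i}"
    then have "k < i \<or> i + j - k < j" by auto
    then show "p dvd ?t k" using i(2) j(2) by (auto intro: dvd_mult dvd_mult2)
  qed
  ultimately have "p dvd ?t i"
    using dvd_add_left_iff by blast
  then have "p dvd coeff (xpn s a) i * coeff (xpn s b) j" by simp
  then show False
    using S(1) p i(1) j(1) coeff_xpn_Pol[OF ab(1)] coeff_xpn_Pol[OF ab(2)]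
    unfolding irreducibles_prime_def by blast
qed

text \<open>A factorisation of \<open>f\<close> with denominator \<open>d\<close> free of
  \<open>s\<close> becomes one without denominator. Every irreducible factor of \<open>d\<close> is
  prime by the preceding lemma and can be cancelled against \<open>c\<close> or against
  \<open>g\<close>; \<open>d1\<close> and \<open>d2\<close> collect what each of them loses.\<close>

lemma split_const_factor:
  assumes S: "irreducibles_prime S" "s \<notin> S"
    and d: "d \<in> Pol S" "d \<noteq> 0"
    and "f \<noteq> 0" "c \<in> Pol (insert s S)" "g \<in> Pol (insert s S)" "d * f = c * g"
  shows "\<exists>d1 d2 c1 g1. d1 \<in> Pol S \<and> d2 \<in> Pol S \<and> d1 \<noteq> 0 \<and> d2 \<noteq> 0 \<and>
    c = d1 * c1 \<and> g = d2 * g1 \<and> f = c1 * g1"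
  using d(2,1) assms(6-8)
proof (induction d arbitrary: c g rule: irreducible_factor_induct)
  case (unit u)
  then obtain v where v: "u * v = 1" by (metis dvdE)
  have "f = (v * c) * g"
    using unit.prems(4) v by (metis mult.assoc mult.commute mult.right_neutral)
  moreover have "c = u * (v * c)" using v by (metis mult.assoc mult_1)
  ultimately show ?case
    using unit.prems(1) v Pol_closed(3)[of S]
    by (intro exI[of _ u] exI[of _ 1] exI[of _ "v * c"] exI[of _ g]) auto
next
  case (mult p d)
  have p: "p \<in> Pol S" and dS: "d \<in> Pol S"
    using mult.prems(1) mult.hyps by (auto intro!: Pol_divisor[of "p * d"])
  have p0: "p \<noteq> 0" using mult.hyps by auto
  have cg0: "c \<noteq> 0" "g \<noteq> 0" using mult.prems(4) p0 mult.hyps(2) \<open>f \<noteq> 0\<close> by auto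
  have "p dvd c * g" by (metis mult.prems(4) dvd_triv_left mult.assoc)
  then consider "p dvd c" | "p dvd g"
    using irreducible_prime_step_const[OF S p mult.hyps(1) mult.prems(2,3)] by blast
  then show ?case
  proof cases
    case 1
    then obtain c' where c': "c = p * c'" by auto
    then have "c' \<in> Pol (insert s S)" using Pol_divisor mult.prems(2) cg0 by (metis dvd_triv_right)
    moreover have "d * f = c' * g" using mult.prems(4) c' p0 by (simp add: mult.assoc)
    ultimately obtain d1 d2 c1 g1 where *: "d1 \<in> Pol S" "d2 \<in> Pol S" "d1 \<noteq> 0" "d2 \<noteq> 0"
      "c' = d1 * c1" "g = d2 * g1" "f = c1 * g1"
      using mult.IH[OF dS _ mult.prems(3)] by blast
    show ?thesis
      by (rule exI[of _ "p * d1"], rule exI[of _ d2], rule exI[of _ c1], rule exI[of _ g1])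
        (use * c' p p0 Pol_closed(7) in auto)
  next
    case 2
    then obtain g' where g': "g = p * g'" by auto
    then have "g' \<in> Pol (insert s S)" using Pol_divisor mult.prems(3) cg0 by (metis dvd_triv_right)
    moreover have "d * f = c * g'" using mult.prems(4) g' p0 by (simp add: ac_simps)
    ultimately obtain d1 d2 c1 g1 where *: "d1 \<in> Pol S" "d2 \<in> Pol S" "d1 \<noteq> 0" "d2 \<noteq> 0"
      "c = d1 * c1" "g' = d2 * g1" "f = c1 * g1"
      using mult.IH[OF dS mult.prems(2)] by blast
    show ?thesis
      by (rule exI[of _ d1], rule exI[of _ "p * d2"], rule exI[of _ c1], rule exI[of _ g1])
        (use * g' p p0 Pol_closed(7) in auto)
  qed
qed

text \<open>Splitting \<open>c\<close> between \<open>f\<close> and its cofactor gives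
  \<open>f = d1 * c1\<close> with \<open>d1\<close> free of \<open>s\<close>. Since \<open>f\<close>
  involves \<open>s\<close>, the unit among these two factors must be \<open>d1\<close>, and
  \<open>c1\<close> divides \<open>a\<close>.\<close>

lemma irreducible_dvd_cancel_const:
  assumes S: "irreducibles_prime S" "s \<notin> S"
    and c: "c \<in> Pol S" "c \<noteq> 0"
    and f: "f \<in> Pol (insert s S)" "irreducible f" "f \<notin> Pol S"
    and a: "a \<in> Pol (insert s S)" "f dvd c * a"
  shows "f dvd a"
proof (cases "a = 0")
  case False
  obtain g where g: "c * a = f * g" using a(2) by auto
  have "c * a \<in> Pol (insert s S)"
    using a(1) c(1) Pol_mono[of c S "insert s S"] by (auto intro: Pol_closed)
  then have "g \<in> Pol (insert s S)"
    by (rule Pol_divisor) (use False c(2) g in \<open>metis mult_eq_0_iff dvd_triv_right\<close>)+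
  then obtain d1 d2 c1 g1 where *: "d1 \<in> Pol S" "f = d1 * c1" "a = c1 * g1"
    using split_const_factor[OF S c False f(1) _ g] by blast
  have "\<not> c1 dvd 1"
    using * f(3) unit_iff[of c1] Pol_closed(1,7) by metis
  then have "d1 dvd 1" using * f(2) irreducible_def by metis
  then obtain u where "1 = d1 * u" by (metis dvdE)
  then have "a = f * (u * g1)"
    using * by (metis mult.assoc mult.commute mult_1)
  then show ?thesis by simp
qed simp

text \<open>Over the field of fractions of \<open>Pol S\<close> an element of least degree in
  \<open>s\<close> generates the ideal \<open>J\<close>; here \<open>d\<close> clears the
  denominators.\<close>

lemma pseudo_division_ideal:
  assumes "s \<notin> S"
    and J: "\<And>y z. y \<in> J \<Longrightarrow> z \<in> Pol (insert s S) \<Longrightarrow> z * y \<in> J" "\<And>y z. y \<in> J \<Longrightarrow> z \<in> J \<Longrightarrow> y - z \<in> J"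
      "J \<subseteq> Pol (insert s S)"
    and c: "c \<in> J" "c \<noteq> 0" "\<And>y. y \<in> J \<Longrightarrow> y \<noteq> 0 \<Longrightarrow> degree (xpn s c) \<le> degree (xpn s y)"
    and "y \<in> J"
  shows "\<exists>d\<in>Pol S. d \<noteq> 0 \<and> (\<exists>g\<in>Pol (insert s S). d * y = c * g)"
  using \<open>y \<in> J\<close>
proof (induction "degree (xpn s y)" arbitrary: y rule: less_induct)
  case less
  show ?case
  proof (cases "y = 0")
    case True
    then show ?thesis using Pol_closed(2,3) by (metis mult_zero_right zero_neq_one)
  next
    case False
    define l m k where "l = lead_coeff (xpn s c)" and "m = lead_coeff (xpn s y)"
      and "k = degree (xpn s y) - degree (xpn s c)"
    have lm: "l \<in> Pol S" "m \<in> Pol S"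
      unfolding l_def m_def using J(3) c(1) less.prems by (auto intro: coeff_xpn_Pol)
    have lm': "l \<in> Pol (insert s S)" "m * Var s ^ k \<in> Pol (insert s S)"
      using lm by (auto intro!: Pol_closed intro: Pol_mono)
    have l0: "l \<noteq> 0" using c(2) by (simp add: l_def)
    \<comment> \<open>Instead of dividing by the leading coefficient \<open>l\<close> of
      \<open>c\<close>, \<open>y\<close> is multiplied by it; the leading terms in \<open>s\<close>
      then cancel.\<close>
    define z where "z = l * y - (m * Var s ^ k) * c"
    have zJ: "z \<in> J" unfolding z_def using J(1,2) lm' c(1) less.prems by blast
    have degle: "degree (xpn s c) \<le> degree (xpn s y)" using c(3) less.prems False by blast
    have xm: "xpn s (m * Var s ^ k) = monom m k"
      unfolding xpn_def psub_simps psub_power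
      using xpn_indep[OF lm(2) assms(1)] by (simp add: xpn_def monom_altdef)
    have xz: "xpn s z = smult l (xpn s y) - monom m k * xpn s c"
    proof -
      have "z + (m * Var s ^ k) * c = l * y" by (simp add: z_def)
      then have "xpn s z + xpn s ((m * Var s ^ k) * c) = xpn s (l * y)"
        by (metis xpn_simps(3))
      then have "xpn s z + xpn s (m * Var s ^ k) * xpn s c = xpn s l * xpn s y"
        by (simp only: xpn_simps(4))
      then show ?thesis unfolding xm xpn_indep[OF lm(1) assms(1)] by (simp add: algebra_simps)
    qed
    have "degree (monom m k * xpn s c) \<le> degree (xpn s y)"
      using degree_mult_le[of "monom m k" "xpn s c"] degree_monom_le[of m k] degle k_def by linarith
    then have le: "degree (xpn s z) \<le> degree (xpn s y)"
      unfolding xz by (intro degree_diff_le degree_smult_le) auto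
    have top: "coeff (xpn s z) (degree (xpn s y)) = 0"
      unfolding xz using degle by (simp add: coeff_monom_mult k_def l_def m_def)
    have "\<exists>d\<in>Pol S. d \<noteq> 0 \<and> (\<exists>g\<in>Pol (insert s S). d * z = c * g)"
    proof (cases "z = 0")
      case True
      then show ?thesis using Pol_closed(2,3) by (metis mult_zero_right zero_neq_one)
    next
      case False
      then have "xpn s z \<noteq> 0" by simp
      then have "degree (xpn s z) < degree (xpn s y)"
        using le top by (metis leading_coeff_0_iff le_neq_implies_less)
      then show ?thesis using less.hyps zJ by blast
    qed
    then obtain d g where dg: "d \<in> Pol S" "d \<noteq> 0" "g \<in> Pol (insert s S)" "d * z = c * g" by blast
    have d': "d \<in> Pol (insert s S)" using dg(1) Pol_mono by blast
    have "(d * l) * y = c * (g + d * (m * Var s ^ k))"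
      using dg(4) unfolding z_def by (simp add: algebra_simps)
    then show ?thesis
      using dg lm l0 d' lm'(2) by (intro bexI[of _ "d * l"] conjI bexI[of _ "g + d * (m * Var s ^ k)"])
        (auto intro!: Pol_closed)
  qed
qed

text \<open>Bezout's identity over the fractions of \<open>Pol S\<close>, doing the work of a
  resultant. The generator \<open>c\<close> of the ideal of \<open>f\<close> and \<open>a\<close>
  divides both up to factors free of \<open>s\<close>. If \<open>c\<close> involved \<open>s\<close>
  in an essential way, irreducibility would make it a multiple of \<open>f\<close>, and
  \<open>f\<close> would divide \<open>a\<close>.\<close>

lemma eliminate_variable:
  assumes S: "irreducibles_prime S" "s \<notin> S"
    and f: "f \<in> Pol (insert s S)" "irreducible f" "f \<notin> Pol S"
    and a: "a \<in> Pol (insert s S)" "\<not> f dvd a"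
  obtains c \<alpha> \<beta> where "c \<in> Pol S" "c \<noteq> 0" "\<alpha> \<in> Pol (insert s S)" "\<beta> \<in> Pol (insert s S)"
    "c = \<alpha> * f + \<beta> * a"
proof -
  let ?B = "Pol (insert s S)"
  define J where "J = {\<alpha> * f + \<beta> * a | \<alpha> \<beta>. \<alpha> \<in> ?B \<and> \<beta> \<in> ?B}"
  have f0: "f \<noteq> 0" using f(2) by auto
  have J_iff: "y \<in> J \<longleftrightarrow> (\<exists>\<alpha>\<in>?B. \<exists>\<beta>\<in>?B. y = \<alpha> * f + \<beta> * a)" for y
    unfolding J_def by blast
  have fJ: "f \<in> J" unfolding J_def
    by (intro CollectI exI[of _ 1] exI[of _ 0]) (simp add: Pol_closed)
  have aJ: "a \<in> J" unfolding J_def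
    by (intro CollectI exI[of _ 0] exI[of _ 1]) (simp add: Pol_closed)
  have J1: "z * y \<in> J" if yz: "y \<in> J" "z \<in> ?B" for y z
  proof -
    obtain \<alpha> \<beta> where "\<alpha> \<in> ?B" "\<beta> \<in> ?B" "y = \<alpha> * f + \<beta> * a" using yz(1)[unfolded J_iff] by blast
    then show ?thesis unfolding J_iff using yz(2)
      by (intro bexI[of _ "z * \<alpha>"] bexI[of _ "z * \<beta>"] Pol_closed) (simp_all add: algebra_simps)
  qed
  have J2: "y - z \<in> J" if yz: "y \<in> J" "z \<in> J" for y z
  proof -
    obtain \<alpha> \<beta> where 1: "\<alpha> \<in> ?B" "\<beta> \<in> ?B" "y = \<alpha> * f + \<beta> * a" using yz(1)[unfolded J_iff] by blast
    obtain \<alpha>' \<beta>' where 2: "\<alpha>' \<in> ?B" "\<beta>' \<in> ?B" "z = \<alpha>' * f + \<beta>' * a" using yz(2)[unfolded J_iff] by blast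
    show ?thesis unfolding J_iff using 1 2
      by (intro bexI[of _ "\<alpha> - \<alpha>'"] bexI[of _ "\<beta> - \<beta>'"] Pol_closed) (simp_all add: algebra_simps)
  qed
  have J3: "J \<subseteq> ?B" unfolding J_def using f(1) a(1) by (auto intro!: Pol_closed)
  obtain c where c: "c \<in> J" "c \<noteq> 0" "\<And>y. y \<in> J \<Longrightarrow> y \<noteq> 0 \<Longrightarrow> degree (xpn s c) \<le> degree (xpn s y)"
    using arg_min_nat_lemma[of "\<lambda>y. y \<in> J \<and> y \<noteq> 0" f "\<lambda>y. degree (xpn s y)"] fJ f0 by blast
  have pd: "\<exists>d\<in>Pol S. d \<noteq> 0 \<and> (\<exists>g\<in>?B. d * y = c * g)" if "y \<in> J" for y
    by (rule pseudo_division_ideal[OF S(2) _ _ J3 c(1,2) _ that]) (use J1 J2 c(3) in blast)+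
  obtain d g where dg: "d \<in> Pol S" "d \<noteq> 0" "g \<in> ?B" "d * f = c * g"
    using pd[OF fJ] by blast
  obtain d' g' where dg': "d' \<in> Pol S" "d' \<noteq> 0" "g' \<in> ?B" "d' * a = c * g'"
    using pd[OF aJ] by blast
  have cB: "c \<in> ?B" using J3 c(1) by blast
  obtain d1 d2 c1 g1 where sp: "d1 \<in> Pol S" "d2 \<in> Pol S" "d1 \<noteq> 0" "d2 \<noteq> 0"
    "c = d1 * c1" "g = d2 * g1" "f = c1 * g1"
    using split_const_factor[OF S dg(1,2) f0 cB dg(3,4)] by blast
  have "\<not> g1 dvd 1"
  proof
    assume "g1 dvd 1"
    then obtain u where "1 = g1 * u" by (metis dvdE)
    then have "c1 = f * u" using sp(7) by (metis mult.assoc mult.right_neutral)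
    then have "f dvd c1" by simp
    then have "f dvd d' * a" using sp(5) dg'(4) by (metis dvd_mult dvd_mult2)
    then show False
      using irreducible_dvd_cancel_const[OF S dg'(1,2) f a(1)] a(2) by blast
  qed
  then have "c1 dvd 1" using sp(7) f(2) irreducible_def by metis
  then have "c \<in> Pol S" using sp(1,5) unit_iff[of c1] Pol_closed(1,7) by metis
  then show ?thesis using c(1,2) that unfolding J_def by blast
qed

text \<open>Without variables there are no irreducible elements. In the step, Gauss's argument
  covers \<open>f\<close> free of \<open>s\<close>. Otherwise
  \<open>c = \<alpha> * f + \<beta> * b\<close> is multiplied by \<open>a\<close>, so that
  \<open>f\<close> divides \<open>c * a\<close>, and \<open>c\<close> is cancelled.\<close>

lemma irreducibles_prime_finite:
  assumes "finite S"
  shows "irreducibles_prime S"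
  using assms
proof (induction S rule: finite_induct)
  case empty
  have "\<not> irreducible f" if "f \<in> Pol {}" for f :: "'a mpol"
  proof
    assume "irreducible f"
    note f = that this
    have "f = Cst (ev f (\<lambda>_. 0))"
      by (rule mpol_eqI) (use f(1) in \<open>auto simp: Pol_def\<close>)
    moreover have "f \<noteq> 0" "\<not> f dvd 1" using f(2) by (auto simp: irreducible_def)
    ultimately show False using unit_iff[of f] by (metis Cst_hom(3))
  qed
  then show ?case unfolding irreducibles_prime_def by blast
next
  case (insert s S)
  show ?case
    unfolding irreducibles_prime_def
  proof (intro ballI impI)
    fix f a b assume f: "f \<in> Pol (insert s S)" "irreducible f" and a: "a \<in> Pol (insert s S)"
      and b: "b \<in> Pol (insert s S)" and ab: "f dvd a * b"
    show "f dvd a \<or> f dvd b"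
    proof (cases "f \<in> Pol S")
      case True
      then show ?thesis
        using irreducible_prime_step_const[OF insert.IH insert.hyps(2) _ f(2) a b ab] by blast
    next
      case False
      show ?thesis
      proof (rule disjCI)
        assume "\<not> f dvd b"
        then obtain c \<alpha> \<beta> where c: "c \<in> Pol S" "c \<noteq> 0" "c = \<alpha> * f + \<beta> * b"
          by (rule eliminate_variable[OF insert.IH insert.hyps(2) f False b])
        have "c * a = (\<alpha> * a) * f + \<beta> * (a * b)" unfolding c(3) by (simp add: algebra_simps)
        then have "f dvd c * a" using ab by simp
        then show "f dvd a"
          using irreducible_dvd_cancel_const[OF insert.IH insert.hyps(2) c(1,2) f False a] by blast
      qed
    qed
  qed
qed

lemma irreducible_imp_prime:
  fixes f :: "'e mpol"
  assumes "irreducible f"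
  shows "prime_elem f"
proof (rule prime_elemI)
  show "f \<noteq> 0" "\<not> f dvd 1" using assms by (auto simp: irreducible_def)
  fix a b assume ab: "f dvd a * b"
  obtain A B C where *: "finite A" "finite B" "finite C" "f \<in> Pol A" "a \<in> Pol B" "b \<in> Pol C"
    using Pol_finite by metis
  then have "finite (A \<union> B \<union> C)" "f \<in> Pol (A \<union> B \<union> C)" "a \<in> Pol (A \<union> B \<union> C)" "b \<in> Pol (A \<union> B \<union> C)"
    by (auto intro: Pol_mono)
  then show "f dvd a \<or> f dvd b"
    using irreducibles_prime_finite[of "A \<union> B \<union> C"] assms ab unfolding irreducibles_prime_def by simp
qed


section \<open>Factoriality of the polynomial ring\<close>

instantiation mpol :: (type) factorial_semiring
begin

definition divide_mpol :: "'a mpol \<Rightarrow> 'a mpol \<Rightarrow> 'a mpol" where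
  "divide_mpol f g = (if g = 0 then 0 else (SOME h. f = h * g))"

text \<open>The representative depends only on the set of associates of \<open>f\<close>.\<close>

definition normalize_mpol :: "'a mpol \<Rightarrow> 'a mpol" where
  "normalize_mpol f = (SOME g. g dvd f \<and> f dvd g \<and> (f dvd 1 \<longrightarrow> g = 1))"

definition unit_factor_mpol :: "'a mpol \<Rightarrow> 'a mpol" where
  "unit_factor_mpol f = f div normalize f"

instance
proof
  have div: "(f * g) div g = f" if "g \<noteq> 0" for f g :: "'a mpol"
    unfolding divide_mpol_def using that by (auto intro!: some_equality)
  then show "\<And>g f. g \<noteq> 0 \<Longrightarrow> (f * g) div g = (f :: 'a mpol)" .
  show div0: "\<And>f. f div 0 = (0 :: 'a mpol)" by (simp add: divide_mpol_def)
  have "\<exists>g. g dvd f \<and> f dvd g \<and> (f dvd 1 \<longrightarrow> g = 1)" for f :: "'a mpol"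
    by (intro exI[of _ "if f dvd 1 then 1 else f"]) auto
  from someI_ex[OF this] have norm: "normalize f dvd f" "f dvd normalize f" "f dvd 1 \<Longrightarrow> normalize f = 1"
    for f :: "'a mpol"
    unfolding normalize_mpol_def by auto
  show norm0: "normalize 0 = (0 :: 'a mpol)" using norm(2)[of 0] by simp
  show uf0: "unit_factor 0 = (0 :: 'a mpol)" by (simp add: unit_factor_mpol_def norm0 div0)
  have nz: "normalize f \<noteq> 0" if "f \<noteq> 0" for f :: "'a mpol"
    using norm(1)[of f] that by auto
  show un: "unit_factor f * normalize f = f" for f :: "'a mpol"
  proof (cases "f = 0")
    case False
    obtain u where "f = u * normalize f" using norm(1)[of f] by (metis dvdE mult.commute)
    then have "unit_factor f = u" using div[OF nz[OF False], of u] by (simp add: unit_factor_mpol_def)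
    with \<open>f = u * normalize f\<close> show ?thesis by simp
  qed (simp add: uf0 norm0)
  show "unit_factor f = f" if "f dvd 1" for f :: "'a mpol"
    using un[of f] norm(3)[OF that] by simp
  show "unit_factor f dvd 1" if "f \<noteq> 0" for f :: "'a mpol"
  proof -
    obtain v where v: "normalize f = f * v" using norm(2)[of f] by auto
    then have "f * (unit_factor f * v) = f * 1" using un[of f] by (metis mult.left_commute mult.right_neutral)
    then have "unit_factor f * v = 1" using that by simp
    then show ?thesis by (metis dvdI)
  qed
  show "unit_factor (u * f) = u * unit_factor f" if u: "u dvd 1" for u f :: "'a mpol"
  proof (cases "f = 0")
    case False
    obtain v where v: "u * v = 1" using u by (metis dvdE)
    have "f = (u * v) * f" using v by simp
    then have "f = v * (u * f)" by (simp only: ac_simps)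
    then have 1: "g dvd u * f \<longleftrightarrow> g dvd f" for g
      by (metis dvd_mult)
    have 2: "u * f dvd g \<longleftrightarrow> f dvd g" for g
    proof
      assume "f dvd g"
      then obtain h where "g = f * h" by auto
      then have "g = (u * v) * (f * h)" using v by simp
      then have "g = (u * f) * (v * h)" by (simp only: ac_simps)
      then show "u * f dvd g" by simp
    qed (auto intro: dvd_mult_right)
    have "normalize (u * f) = normalize f"
      unfolding normalize_mpol_def 1 2 ..
    then have "(unit_factor (u * f) - u * unit_factor f) * normalize f = 0"
      using un[of "u * f"] un[of f] by (simp add: left_diff_distrib mult.assoc)
    then show ?thesis using nz[OF False] by simp
  qed (simp add: uf0)
  show "\<exists>A. (\<forall>p. p \<in># A \<longrightarrow> prime_elem p) \<and> normalize (prod_mset A) = normalize f"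
    if "f \<noteq> 0" for f :: "'a mpol"
  proof -
    have "\<exists>A u. (\<forall>p. p \<in># A \<longrightarrow> prime_elem p) \<and> u dvd 1 \<and> f = u * prod_mset A"
      using that
    proof (induction f rule: irreducible_factor_induct)
      case (unit u)
      then show ?case by (intro exI[of _ "{#}"] exI[of _ u]) auto
    next
      case (mult p g)
      then obtain A u where "\<forall>p. p \<in># A \<longrightarrow> prime_elem p" "u dvd 1" "g = u * prod_mset A" by blast
      then show ?case using irreducible_imp_prime[OF mult.hyps(1)]
        by (intro exI[of _ "add_mset p A"] exI[of _ u]) auto
    qed
    then obtain A u where A: "\<forall>p. p \<in># A \<longrightarrow> prime_elem p" and u: "u dvd 1" "f = u * prod_mset A" by blast
    obtain v where v: "u * v = 1" using u(1) by (metis dvdE)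
    then have "prod_mset A = (u * v) * prod_mset A" by simp
    then have "prod_mset A = v * f" using u(2) by (simp only: ac_simps)
    then have "f dvd prod_mset A" "prod_mset A dvd f" using u(2) by (metis dvd_triv_right)+
    then have "prod_mset A dvd g \<longleftrightarrow> f dvd g" "g dvd prod_mset A \<longleftrightarrow> g dvd f" for g
      by (meson dvd_trans)+
    then have "normalize (prod_mset A) = normalize f"
      unfolding normalize_mpol_def by presburger
    then show ?thesis using A by blast
  qed
qed

end

instance mpol :: (type) idom_divide ..

text \<open>The Nullstellensatz for a hypersurface. Elimination gives a nonzero \<open>c\<close>
  free of \<open>s\<close> in the ideal of \<open>P\<close> and \<open>h\<close>; where
  \<open>c\<close> is nonzero, \<open>P\<close> and \<open>h\<close> have no common zero, so it
  suffices to solve \<open>P = 0\<close> for the variable \<open>s\<close> there.\<close>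

lemma prime_nullstellensatz:
  fixes P :: "'e mpol"
  assumes "prime_elem P" "\<not> P dvd h"
  obtains x where "ev P x = 0" "ev h x \<noteq> 0"
proof -
  have irr: "irreducible P" using assms(1) by (rule prime_elem_imp_irreducible)
  \<comment> \<open>A smallest set of variables, so that \<open>P\<close> really involves each of
    them.\<close>
  obtain S where S: "finite S" "P \<in> Pol S"
    and Smin: "\<And>T. finite T \<Longrightarrow> P \<in> Pol T \<Longrightarrow> card S \<le> card T"
  proof -
    obtain T where "finite T \<and> P \<in> Pol T" using Pol_finite by blast
    from arg_min_nat_lemma[of "\<lambda>S. finite S \<and> P \<in> Pol S", OF this, of card]
    show ?thesis using that by blast
  qed
  have "S \<noteq> {}"
  proof
    assume "S = {}"
    then have "P = Cst (ev P (\<lambda>_. 0))"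
      using S(2) by (intro mpol_eqI) (auto simp: Pol_def)
    then show False
      using assms(1) unit_iff[of P] by (metis Cst_hom(3) prime_elem_not_unit prime_elem_not_zeroI)
  qed
  then obtain s where s: "s \<in> S" by blast
  have notin: "P \<notin> Pol (S - {s})"
    using Smin[of "S - {s}"] S(1) s card_Diff1_less[OF S(1) s] by auto
  have deg: "degree (xpn s P) \<noteq> 0"
    using Pol_degree_xpn[of P s "S - {s}"] S(2) s notin by (auto simp: insert_absorb)
  obtain T where T: "finite T" "h \<in> Pol T" using Pol_finite by blast
  define U where "U = (S \<union> T) - {s}"
  have U: "finite U" "s \<notin> U" "insert s U = S \<union> T" using S T s unfolding U_def by auto
  have P: "P \<in> Pol (insert s U)" "P \<notin> Pol U" and h: "h \<in> Pol (insert s U)"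
    using S T U deg xpn_indep[of P U s] by (auto intro: Pol_mono)
  obtain c \<alpha> \<beta> where c: "c \<in> Pol U" "c \<noteq> 0" "c = \<alpha> * P + \<beta> * h"
    by (rule eliminate_variable[OF irreducibles_prime_finite[OF U(1)] U(2) P(1) irr P(2) h assms(2)])
  \<comment> \<open>At a point where the leading coefficient in \<open>s\<close> is nonzero,
    \<open>P\<close> stays non-constant in \<open>s\<close> and therefore has a root.\<close>
  have "c * lead_coeff (xpn s P) \<noteq> 0" using c(2) irr by auto
  then obtain y where y: "ev (c * lead_coeff (xpn s P)) y \<noteq> 0" by (rule mpol_nonzero_point)
  then have "degree (pev (xpn s P) y) \<noteq> 0"
    using deg by (metis coeff_pev degree_pev_le ev_simps(6) le_antisym le_degree mult_eq_0_iff)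
  then obtain t where "poly (pev (xpn s P) y) t = 0"
    using fundamental_theorem_of_algebra[of "pev (xpn s P) y"] by (auto simp: constant_degree)
  then have P0: "ev P (y(s := t)) = 0" by (simp add: poly_xpn)
  have "ev c (y(s := t)) = ev c y" by (rule PolD[OF c(1)]) (use U(2) in auto)
  then have "ev c (y(s := t)) \<noteq> 0" using y by auto
  then have "ev h (y(s := t)) \<noteq> 0" using P0 c(3) by auto
  with P0 that show ?thesis by blast
qed

lemma prime_elem_root:
  fixes P :: "'e mpol"
  assumes "prime_elem P"
  obtains x where "ev P x = 0"
  using prime_nullstellensatz[OF assms, of 1] prime_elem_not_unit[OF assms] by blast

lemma exists_fraction_with_multiplicities:
  fixes Q :: "'a :: factorial_semiring" and f :: "'a \<Rightarrow> int"
  assumes "Q \<noteq> 0"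
  obtains C N D where "C dvd Q ^ N" "D dvd Q ^ N"
    "\<And>p. prime p \<Longrightarrow> int (multiplicity p C) - int (multiplicity p D) = (if p dvd Q then f p else 0)"
proof -
  \<comment> \<open>\<open>nat\<close> cuts off negative values: \<open>pp f\<close> carries the
    positive part of \<open>f\<close> and \<open>pp (\<lambda>q. - f q)\<close> the negative
    part.\<close>
  define pp where "pp g = (\<Prod>q\<in>prime_factors Q. q ^ nat (g q))" for g :: "'a \<Rightarrow> int"
  have mult: "multiplicity p (pp g) = (if p dvd Q then nat (g p) else 0)" if "prime p" for p g
    unfolding pp_def using that assms
    by (subst multiplicity_prod_prime_powers) (auto simp: in_prime_factors_iff)
  have nz: "pp g \<noteq> 0" for g
    unfolding pp_def by auto
  \<comment> \<open>Each exponent is one of the summands, and every prime occurring divides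
    \<open>Q\<close> at least once, so \<open>Q ^ N\<close> absorbs the whole product.\<close>
  define N where "N = (\<Sum>q\<in>prime_factors Q. nat \<bar>f q\<bar>)"
  have dvd: "pp g dvd Q ^ N" if g: "\<And>q. nat (g q) \<le> nat \<bar>f q\<bar>" for g
  proof (rule multiplicity_le_imp_dvd[OF nz])
    fix p :: 'a assume p: "prime p"
    show "multiplicity p (pp g) \<le> multiplicity p (Q ^ N)"
    proof (cases "p dvd Q")
      case True
      then have "p \<in> prime_factors Q" using p assms by (simp add: in_prime_factors_iff)
      then have "nat \<bar>f p\<bar> \<le> N" unfolding N_def by (intro member_le_sum) auto
      with g have le: "nat (g p) \<le> N" using order_trans by blast
      have "multiplicity p Q \<ge> 1"
        using True p assms prime_multiplicity_gt_zero_iff[of p Q] by (simp add: Suc_le_eq)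
      then have "N * 1 \<le> N * multiplicity p Q" by (intro mult_left_mono) auto
      then have "nat (g p) \<le> N * multiplicity p Q" using le by linarith
      then show ?thesis
        using mult[OF p, of g] True p assms by (simp add: prime_elem_multiplicity_power_distrib)
    qed (simp add: mult[OF p])
  qed
  show ?thesis
    by (rule that[of "pp f" N "pp (\<lambda>q. - f q)"]) (auto simp: mult intro!: dvd)
qed

text \<open>\<open>A / B\<close> has order 0 along all primes outside \<open>Q\<close>, so up to a
  unit it is the fraction with its orders along the primes of \<open>Q\<close>; the unit
  \<open>u\<close> goes into the numerator.\<close>

lemma balanced_fraction:
  fixes Q A B :: "'a :: factorial_semiring"
  assumes "Q \<noteq> 0" "A \<noteq> 0" "B \<noteq> 0"
    and "\<And>p. prime p \<Longrightarrow> \<not> p dvd Q \<Longrightarrow> multiplicity p A = multiplicity p B"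
  obtains a b N where "a dvd Q ^ N" "b dvd Q ^ N" "A * b = B * a"
proof -
  obtain C N D where CD: "C dvd Q ^ N" "D dvd Q ^ N"
    "\<And>p. prime p \<Longrightarrow> int (multiplicity p C) - int (multiplicity p D) =
      (if p dvd Q then int (multiplicity p A) - int (multiplicity p B) else 0)"
    using exists_fraction_with_multiplicities[OF assms(1),
        of "\<lambda>p. int (multiplicity p A) - int (multiplicity p B)"] by blast
  have nz: "C \<noteq> 0" "D \<noteq> 0" using CD(1,2) assms(1) by auto
  have "multiplicity p (A * D) = multiplicity p (B * C)" if p: "prime p" for p
    using CD(3)[OF p] assms nz p by (auto simp: prime_elem_multiplicity_mult_distrib split: if_splits)
  then have "A * D dvd B * C" "B * C dvd A * D"
    using assms nz by (auto intro!: multiplicity_le_imp_dvd)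
  then obtain u v where u: "A * D = B * C * u" and v: "B * C = A * D * v"
    by (metis dvdE)
  then have "(A * D) * (v * u) = (A * D) * 1" by (metis mult.assoc mult.right_neutral)
  then have "u dvd 1" using assms nz by (metis mult_left_cancel mult_eq_0_iff dvd_triv_right)
  have "C * u dvd Q ^ N" using CD(1) \<open>u dvd 1\<close> by (simp add: mult_unit_dvd_iff)
  then show ?thesis using that[of "C * u" N D] CD(2) u by (simp add: mult.assoc)
qed


section \<open>Multihomogeneous forms\<close>

definition hmonom :: "'e set \<Rightarrow> ('e \<Rightarrow> nat) \<Rightarrow> ('e \<Rightarrow> nat) \<Rightarrow> ('e \<Rightarrow> P1) \<Rightarrow> complex" where
  "hmonom E d i x = (\<Prod>e\<in>E. hcoord0 (x e) ^ i e * hcoord1 (x e) ^ (d e - i e))"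

definition MF :: "'e set \<Rightarrow> ('e \<Rightarrow> nat) \<Rightarrow> (('e \<Rightarrow> P1) \<Rightarrow> complex) set" where
  "MF E d = range (multiform E d)"

lemma multiform_hmonom: "multiform E d c x = (\<Sum>i\<in>(\<Pi>\<^sub>E e\<in>E. {..d e}). c i * hmonom E d i x)"
  by (simp add: multiform_def hmonom_def)

lemma MF_cong: "(\<And>e. e \<in> E \<Longrightarrow> d e = d' e) \<Longrightarrow> MF E d = MF E d'"
proof -
  assume *: "\<And>e. e \<in> E \<Longrightarrow> d e = d' e"
  then have "multiform E d = multiform E d'"
    unfolding multiform_def fun_eq_iff by (auto intro!: sum.cong prod.cong simp: PiE_iff cong: PiE_cong)
  then show ?thesis by (simp add: MF_def)
qed

lemma MF_zero: "(\<lambda>x. 0) \<in> MF E d"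
  unfolding MF_def by (rule image_eqI[of _ _ "\<lambda>_. 0"]) (auto simp: multiform_def fun_eq_iff)

lemma MF_add: "F \<in> MF E d \<Longrightarrow> G \<in> MF E d \<Longrightarrow> (\<lambda>x. F x + G x) \<in> MF E d"
proof -
  assume "F \<in> MF E d" "G \<in> MF E d"
  then obtain a b where "F = multiform E d a" "G = multiform E d b" by (auto simp: MF_def)
  then have "(\<lambda>x. F x + G x) = multiform E d (\<lambda>i. a i + b i)"
    by (auto simp: multiform_def fun_eq_iff sum.distrib algebra_simps)
  then show ?thesis by (simp add: MF_def)
qed

lemma MF_scale: "F \<in> MF E d \<Longrightarrow> (\<lambda>x. a * F x) \<in> MF E d"
proof -
  assume "F \<in> MF E d"
  then obtain c where "F = multiform E d c" by (auto simp: MF_def)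
  then have "(\<lambda>x. a * F x) = multiform E d (\<lambda>i. a * c i)"
    by (auto simp: multiform_def fun_eq_iff sum_distrib_left algebra_simps)
  then show ?thesis by (simp add: MF_def)
qed

lemma MF_diff: "F \<in> MF E d \<Longrightarrow> G \<in> MF E d \<Longrightarrow> (\<lambda>x. F x - G x) \<in> MF E d"
  using MF_add[OF _ MF_scale[of G E d "-1"]] by simp

lemma MF_sum: "(\<And>i. i \<in> I \<Longrightarrow> F i \<in> MF E d) \<Longrightarrow> (\<lambda>x. \<Sum>i\<in>I. F i x) \<in> MF E d"
  by (induction I rule: infinite_finite_induct) (auto intro: MF_zero MF_add)

lemma MF_hmonom:
  assumes "finite E" and "\<And>e. e \<in> E \<Longrightarrow> i e \<le> d e"
  shows "hmonom E d i \<in> MF E d"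
proof -
  have "hmonom E d i x = multiform E d (\<lambda>j. if j = restrict i E then 1 else 0) x" for x
  proof -
    have mem: "restrict i E \<in> (\<Pi>\<^sub>E e\<in>E. {..d e})" using assms(2) by auto
    have "multiform E d (\<lambda>j. if j = restrict i E then 1 else 0) x =
        (\<Sum>j\<in>(\<Pi>\<^sub>E e\<in>E. {..d e}). if j = restrict i E then hmonom E d j x else 0)"
      unfolding multiform_hmonom by (intro sum.cong) auto
    also have "\<dots> = hmonom E d (restrict i E) x"
      using mem by (subst sum.delta) (auto intro!: finite_PiE assms(1))
    also have "\<dots> = hmonom E d i x" by (simp add: hmonom_def)
    finally show ?thesis by simp
  qed
  then show ?thesis unfolding MF_def by blast
qed

lemma MF_mult:
  assumes "finite E" "F \<in> MF E d" "G \<in> MF E d'"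
  shows "(\<lambda>x. F x * G x) \<in> MF E (\<lambda>e. d e + d' e)"
proof -
  obtain a b where F: "F = multiform E d a" and G: "G = multiform E d' b"
    using assms(2,3) by (auto simp: MF_def)
  have mm: "hmonom E d i x * hmonom E d' j x = hmonom E (\<lambda>e. d e + d' e) (\<lambda>e. i e + j e) x"
    if "i \<in> (\<Pi>\<^sub>E e\<in>E. {..d e})" "j \<in> (\<Pi>\<^sub>E e\<in>E. {..d' e})" for i j x
    unfolding hmonom_def prod.distrib[symmetric]
  proof (intro prod.cong refl)
    fix e assume "e \<in> E"
    then have "i e \<le> d e" "j e \<le> d' e" using that by (auto simp: PiE_iff)
    then have "d e + d' e - (i e + j e) = (d e - i e) + (d' e - j e)" by simp
    then show "hcoord0 (x e) ^ i e * hcoord1 (x e) ^ (d e - i e) *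
        (hcoord0 (x e) ^ j e * hcoord1 (x e) ^ (d' e - j e)) =
        hcoord0 (x e) ^ (i e + j e) * hcoord1 (x e) ^ (d e + d' e - (i e + j e))"
      by (simp add: power_add)
  qed
  have "(\<lambda>x. F x * G x) = (\<lambda>x. \<Sum>i\<in>(\<Pi>\<^sub>E e\<in>E. {..d e}). \<Sum>j\<in>(\<Pi>\<^sub>E e\<in>E. {..d' e}).
      (a i * b j) * hmonom E (\<lambda>e. d e + d' e) (\<lambda>e. i e + j e) x)"
    unfolding F G multiform_hmonom sum_product
    by (intro ext sum.cong refl) (simp add: mm[symmetric] algebra_simps)
  also have "\<dots> \<in> MF E (\<lambda>e. d e + d' e)"
    by (intro MF_sum MF_scale MF_hmonom assms(1) add_mono) (auto simp: PiE_iff)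
  finally show ?thesis .
qed

lemma MF_const: "(\<lambda>x. c) \<in> MF E (\<lambda>e. 0)"
proof -
  have "(\<Pi>\<^sub>E e\<in>E. {..(0::nat)}) = {\<lambda>e\<in>E. 0}"
    by (auto simp: PiE_iff extensional_def fun_eq_iff)
  then have "multiform E (\<lambda>e. 0) (\<lambda>_. c) = (\<lambda>x. c)"
    by (auto simp: multiform_def fun_eq_iff)
  then show ?thesis unfolding MF_def by (metis rangeI)
qed

lemma MF_power:
  assumes "finite E" "F \<in> MF E d"
  shows "(\<lambda>x. F x ^ n) \<in> MF E (\<lambda>e. n * d e)"
  using MF_mult[OF assms(1,2)] by (induction n) (auto intro: MF_const)

lemma multiform_in_MF: "multiform E d c \<in> MF E d"
  by (simp add: MF_def)


section \<open>The Zariski topology\<close>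

lemma topspace_zariski [simp]: "topspace (zariski E) = P1_power E"
proof -
  obtain c where "multiform E (\<lambda>e. 0) c = (\<lambda>x. 1)"
    using MF_const[of 1 E] unfolding MF_def by auto
  then have "{x \<in> P1_power E. multiform E (\<lambda>e. 0) c x \<noteq> 0} = P1_power E" by simp
  then show ?thesis unfolding zariski_def topology_generated_by_topspace by blast
qed

lemma openin_nonvanishing: "F \<in> MF E d \<Longrightarrow> openin (zariski E) {x \<in> P1_power E. F x \<noteq> 0}"
  unfolding zariski_def MF_def by (intro topology_generated_by_Basis) blast

text \<open>Multiplying forms intersects their nonvanishing sets, so the generating family is
  already a basis.\<close>

lemma zariski_basis:
  assumes "finite E" "openin (zariski E) U" "p \<in> U"
  obtains d F where "F \<in> MF E d" "F p \<noteq> 0" "{x \<in> P1_power E. F x \<noteq> 0} \<subseteq> U"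
proof -
  have "generate_topology_on {{x \<in> P1_power E. multiform E d c x \<noteq> 0} | d c. True} U"
    using assms(2) unfolding zariski_def by (rule openin_topology_generated_by)
  then have "\<forall>p\<in>U. \<exists>d F. F \<in> MF E d \<and> F p \<noteq> 0 \<and> {x \<in> P1_power E. F x \<noteq> 0} \<subseteq> U"
  proof induction
    case (Int A B)
    show ?case
    proof
      fix p assume "p \<in> A \<inter> B"
      then obtain d F d' G where "F \<in> MF E d" "F p \<noteq> 0" "{x \<in> P1_power E. F x \<noteq> 0} \<subseteq> A"
        "G \<in> MF E d'" "G p \<noteq> 0" "{x \<in> P1_power E. G x \<noteq> 0} \<subseteq> B"
        using Int.IH by blast
      then show "\<exists>d F. F \<in> MF E d \<and> F p \<noteq> 0 \<and> {x \<in> P1_power E. F x \<noteq> 0} \<subseteq> A \<inter> B"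
        by (intro exI[of _ "\<lambda>e. d e + d' e"] exI[of _ "\<lambda>x. F x * G x"])
          (auto intro: MF_mult[OF assms(1)])
    qed
  next
    case (UN K)
    then show ?case by blast
  next
    case (Basis s)
    then obtain d c where s: "s = {x \<in> P1_power E. multiform E d c x \<noteq> 0}" by blast
    show ?case unfolding s using multiform_in_MF by blast
  qed simp
  then show ?thesis using assms(3) that by blast
qed

lemma in_zariski_closureI:
  assumes "finite E" "p \<in> P1_power E"
    and "\<And>d F. F \<in> MF E d \<Longrightarrow> F p \<noteq> 0 \<Longrightarrow> \<exists>s\<in>S \<inter> P1_power E. F s \<noteq> 0"
  shows "p \<in> zariski E closure_of S"
  unfolding in_closure_of topspace_zariski
proof (intro conjI allI impI assms(2))
  fix U assume U: "p \<in> U \<and> openin (zariski E) U"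
  obtain d F where F: "F \<in> MF E d" "F p \<noteq> 0" "{x \<in> P1_power E. F x \<noteq> 0} \<subseteq> U"
    by (rule zariski_basis[OF assms(1) conjunct2[OF U] conjunct1[OF U]])
  then show "\<exists>y. y \<in> S \<and> y \<in> U" using assms(3)[OF F(1,2)] by blast
qed

lemma MF_vanish_closure:
  assumes "F \<in> MF E d" "\<And>s. s \<in> S \<Longrightarrow> F s = 0" "p \<in> zariski E closure_of S"
  shows "F p = 0"
proof (rule ccontr)
  assume "F p \<noteq> 0"
  then have "p \<in> {x \<in> P1_power E. F x \<noteq> 0}"
    using assms(3) by (simp add: in_closure_of)
  then have "\<exists>y. y \<in> S \<and> y \<in> {x \<in> P1_power E. F x \<noteq> 0}"
    using assms(3)[unfolded in_closure_of, THEN conjunct2, THEN spec, of "{x \<in> P1_power E. F x \<noteq> 0}"]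
      openin_nonvanishing[OF assms(1)] by simp
  then show False using assms(2) by blast
qed


section \<open>Regular functions\<close>

text \<open>Shrinking the neighbourhood to the nonvanishing set of a form \<open>r\<close> leaves
  only forms to reason about.\<close>

lemma regular_onE:
  assumes "finite E" "regular_on E W f" "p \<in> W" "W \<subseteq> P1_power E"
  obtains d F G d' r where "F \<in> MF E d" "G \<in> MF E d" "r \<in> MF E d'" "r p \<noteq> 0"
    "\<forall>x\<in>W. r x \<noteq> 0 \<longrightarrow> G x \<noteq> 0 \<and> f x = F x / G x"
proof -
  obtain U d a b where U: "openin (zariski E) U" "p \<in> U"
    "\<And>x. x \<in> U \<inter> W \<Longrightarrow> multiform E d b x \<noteq> 0 \<and> f x = multiform E d a x / multiform E d b x"
    using assms(2,3) unfolding regular_on_def by metis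
  obtain d' r where r: "r \<in> MF E d'" "r p \<noteq> 0" "{x \<in> P1_power E. r x \<noteq> 0} \<subseteq> U"
    by (rule zariski_basis[OF assms(1) U(1,2)])
  show ?thesis
    by (rule that[OF multiform_in_MF[of E d a] multiform_in_MF[of E d b] r(1,2)])
      (use U(3) r(3) assms(4) in blast)
qed

lemma regular_onI:
  assumes "\<And>p. p \<in> W \<Longrightarrow> \<exists>d F G d' r. F \<in> MF E d \<and> G \<in> MF E d \<and> r \<in> MF E d' \<and> r p \<noteq> 0 \<and>
      (\<forall>x\<in>W. r x \<noteq> 0 \<longrightarrow> G x \<noteq> 0 \<and> f x = F x / G x)"
    and "W \<subseteq> P1_power E"
  shows "regular_on E W f"
  unfolding regular_on_def
proof
  fix p assume p: "p \<in> W"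
  obtain d F G d' r where *: "F \<in> MF E d" "G \<in> MF E d" "r \<in> MF E d'" "r p \<noteq> 0"
    "\<forall>x\<in>W. r x \<noteq> 0 \<longrightarrow> G x \<noteq> 0 \<and> f x = F x / G x"
    using assms(1)[OF p] by blast
  obtain a b where "F = multiform E d a" "G = multiform E d b" using *(1,2) by (auto simp: MF_def)
  then show "\<exists>U d a b. openin (zariski E) U \<and> p \<in> U \<and>
      (\<forall>x\<in>U \<inter> W. multiform E d b x \<noteq> 0 \<and> f x = multiform E d a x / multiform E d b x)"
    using * p assms(2) openin_nonvanishing[OF *(3)]
    by (intro exI[of _ "{x \<in> P1_power E. r x \<noteq> 0}"] exI[of _ d] exI[of _ a] exI[of _ b]) auto
qed

lemma regular_on_cong:
  assumes "regular_on E W f" "\<And>x. x \<in> W \<Longrightarrow> g x = f x"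
  shows "regular_on E W g"
  using assms unfolding regular_on_def by (metis IntD2)

lemma regular_on_subset: "regular_on E W f \<Longrightarrow> W' \<subseteq> W \<Longrightarrow> regular_on E W' f"
  unfolding regular_on_def by (intro ballI) (drule bspec, blast, blast)

lemma regular_on_quotient:
  assumes "F \<in> MF E d" "G \<in> MF E d" "\<And>x. x \<in> W \<Longrightarrow> G x \<noteq> 0" "W \<subseteq> P1_power E"
  shows "regular_on E W (\<lambda>x. F x / G x)"
proof (rule regular_onI[OF _ assms(4)])
  fix p assume "p \<in> W"
  show "\<exists>d' F' G' d'' r. F' \<in> MF E d' \<and> G' \<in> MF E d' \<and> r \<in> MF E d'' \<and> r p \<noteq> 0 \<and>
      (\<forall>x\<in>W. r x \<noteq> 0 \<longrightarrow> G' x \<noteq> 0 \<and> F x / G x = F' x / G' x)"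
    by (rule exI[of _ d], rule exI[of _ F], rule exI[of _ G], rule exI[of _ "\<lambda>e. 0"], rule exI[of _ "\<lambda>x. 1"])
      (use assms MF_const in auto)
qed

lemma regular_on_mult:
  assumes E: "finite E" and f: "regular_on E W f" and g: "regular_on E W g" and W: "W \<subseteq> P1_power E"
  shows "regular_on E W (\<lambda>x. f x * g x)"
proof (rule regular_onI[OF _ W])
  fix p assume p: "p \<in> W"
  obtain d F G d' r where 1: "F \<in> MF E d" "G \<in> MF E d" "r \<in> MF E d'" "r p \<noteq> 0"
    "\<forall>x\<in>W. r x \<noteq> 0 \<longrightarrow> G x \<noteq> 0 \<and> f x = F x / G x"
    by (rule regular_onE[OF E f p W])
  obtain d1 F1 G1 d1' r1 where 2: "F1 \<in> MF E d1" "G1 \<in> MF E d1" "r1 \<in> MF E d1'" "r1 p \<noteq> 0"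
    "\<forall>x\<in>W. r1 x \<noteq> 0 \<longrightarrow> G1 x \<noteq> 0 \<and> g x = F1 x / G1 x"
    by (rule regular_onE[OF E g p W])
  show "\<exists>d F G d' r. F \<in> MF E d \<and> G \<in> MF E d \<and> r \<in> MF E d' \<and> r p \<noteq> 0 \<and>
      (\<forall>x\<in>W. r x \<noteq> 0 \<longrightarrow> G x \<noteq> 0 \<and> f x * g x = F x / G x)"
    by (rule exI[of _ "\<lambda>e. d e + d1 e"], rule exI[of _ "\<lambda>x. F x * F1 x"], rule exI[of _ "\<lambda>x. G x * G1 x"],
        rule exI[of _ "\<lambda>e. d' e + d1' e"], rule exI[of _ "\<lambda>x. r x * r1 x"])
      (use 1 2 in \<open>auto intro: MF_mult[OF E]\<close>)
qed

lemma regular_on_inverse: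
  assumes E: "finite E" and f: "regular_on E W f" and W: "W \<subseteq> P1_power E"
    and nz: "\<And>x. x \<in> W \<Longrightarrow> f x \<noteq> 0"
  shows "regular_on E W (\<lambda>x. inverse (f x))"
proof (rule regular_onI[OF _ W])
  fix p assume p: "p \<in> W"
  obtain d F G d' r where 1: "F \<in> MF E d" "G \<in> MF E d" "r \<in> MF E d'" "r p \<noteq> 0"
    "\<forall>x\<in>W. r x \<noteq> 0 \<longrightarrow> G x \<noteq> 0 \<and> f x = F x / G x"
    by (rule regular_onE[OF E f p W])
  have *: "F x \<noteq> 0 \<and> inverse (f x) = G x / F x" if "x \<in> W" "r x \<noteq> 0" for x
    using 1(5) that nz[OF that(1)] by auto
  show "\<exists>d F G d' r. F \<in> MF E d \<and> G \<in> MF E d \<and> r \<in> MF E d' \<and> r p \<noteq> 0 \<and>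
      (\<forall>x\<in>W. r x \<noteq> 0 \<longrightarrow> G x \<noteq> 0 \<and> inverse (f x) = F x / G x)"
    by (rule exI[of _ d], rule exI[of _ G], rule exI[of _ F], rule exI[of _ d'], rule exI[of _ r])
      (use 1(1-4) * in auto)
qed

lemma regular_on_local:
  assumes E: "finite E" and W: "W \<subseteq> P1_power E"
    and loc: "\<And>p. p \<in> W \<Longrightarrow> \<exists>d r. r \<in> MF E d \<and> r p \<noteq> 0 \<and> regular_on E {x \<in> W. r x \<noteq> 0} f"
  shows "regular_on E W f"
proof (rule regular_onI[OF _ W])
  fix p assume p: "p \<in> W"
  obtain k s where s: "s \<in> MF E k" "s p \<noteq> 0" "regular_on E {x \<in> W. s x \<noteq> 0} f"
    using loc[OF p] by blast
  obtain d F G d' r where 1: "F \<in> MF E d" "G \<in> MF E d" "r \<in> MF E d'" "r p \<noteq> 0"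
    "\<forall>x\<in>{x \<in> W. s x \<noteq> 0}. r x \<noteq> 0 \<longrightarrow> G x \<noteq> 0 \<and> f x = F x / G x"
    by (rule regular_onE[OF E s(3), of p]) (use p s(2) W in auto)
  show "\<exists>d F G d' r. F \<in> MF E d \<and> G \<in> MF E d \<and> r \<in> MF E d' \<and> r p \<noteq> 0 \<and>
      (\<forall>x\<in>W. r x \<noteq> 0 \<longrightarrow> G x \<noteq> 0 \<and> f x = F x / G x)"
    by (rule exI[of _ d], rule exI[of _ F], rule exI[of _ G],
        rule exI[of _ "\<lambda>e. d' e + k e"], rule exI[of _ "\<lambda>x. r x * s x"])
      (use 1 s in \<open>auto intro: MF_mult[OF E]\<close>)
qed


section \<open>Linear subspaces\<close>

lemma subspace_comb:
  assumes "linear_subspace E V" "v \<in> V" "w \<in> V"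
  shows "(\<lambda>e\<in>E. v e + t * w e) \<in> V"
proof -
  have "(\<lambda>e\<in>E. t * w e) \<in> V" using assms unfolding linear_subspace_def by blast
  then have "(\<lambda>e\<in>E. v e + (\<lambda>e\<in>E. t * w e) e) \<in> V"
    using assms unfolding linear_subspace_def by blast
  then show ?thesis by (simp cong: restrict_cong)
qed

lemma subspace_scale: "linear_subspace E V \<Longrightarrow> v \<in> V \<Longrightarrow> (\<lambda>e\<in>E. a * v e) \<in> V"
  unfolding linear_subspace_def by blast

lemma subspace_ext: "linear_subspace E V \<Longrightarrow> v \<in> V \<Longrightarrow> v = restrict v E"
  unfolding linear_subspace_def by (auto simp: fun_eq_iff PiE_iff extensional_def)

lemma subspace_hyperplane:
  assumes "linear_subspace E V" "e \<in> E"
  shows "linear_subspace E {v \<in> V. v e = 0}"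
  using assms unfolding linear_subspace_def by auto

lemma subspace_unit_coord:
  assumes "linear_subspace E V" "e \<in> E" "v \<in> V" "v e \<noteq> 0"
  obtains u where "u \<in> V" "u e = 1"
  by (rule that[OF subspace_scale[OF assms(1,3), of "inverse (v e)"]]) (use assms in auto)

text \<open>A coordinate \<open>a\<close> that is not identically zero on \<open>V\<close> and a
  vector \<open>u\<close> with \<open>u a = 1\<close> split \<open>V\<close> into the hyperplane
  \<open>W\<close> and the line through \<open>u\<close>. The induction is on the number of such
  coordinates.\<close>

lemma linear_retraction:
  assumes "finite E" "linear_subspace E V"
  shows "\<exists>\<rho>. (\<forall>x. (\<lambda>e\<in>E. ev (\<rho> e) x) \<in> V) \<and> (\<forall>v\<in>V. \<forall>e\<in>E. ev (\<rho> e) v = v e) \<and>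
    (\<forall>e x y t. ev (\<rho> e) (\<lambda>e. x e + t * y e) = ev (\<rho> e) x + t * ev (\<rho> e) y) \<and> (\<forall>e. \<rho> e \<in> Pol E)"
  using assms(2)
proof (induction "card {e \<in> E. \<exists>v\<in>V. v e \<noteq> 0}" arbitrary: V rule: less_induct)
  case less
  show ?case
  proof (cases "\<exists>e\<in>E. \<exists>v\<in>V. v e \<noteq> 0")
    case False
    then show ?thesis
      using less.prems by (intro exI[of _ "\<lambda>_. 0"]) (auto simp: linear_subspace_def Pol_closed)
  next
    case True
    then obtain a where a: "a \<in> E" "\<exists>v\<in>V. v a \<noteq> 0" by blast
    then obtain u where u: "u \<in> V" "u a = 1" using subspace_unit_coord[OF less.prems a(1)] by blast
    define W where "W = {v \<in> V. v a = 0}"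
    have W: "linear_subspace E W" unfolding W_def using less.prems a(1) by (rule subspace_hyperplane)
    have "{e \<in> E. \<exists>v\<in>W. v e \<noteq> 0} \<subset> {e \<in> E. \<exists>v\<in>V. v e \<noteq> 0}"
      using a unfolding W_def by blast
    then have "card {e \<in> E. \<exists>v\<in>W. v e \<noteq> 0} < card {e \<in> E. \<exists>v\<in>V. v e \<noteq> 0}"
      by (intro psubset_card_mono) (use assms(1) in auto)
    from less.hyps[OF this W] obtain \<rho> where
      r1: "\<And>x. (\<lambda>e\<in>E. ev (\<rho> e) x) \<in> W" and r2: "\<And>v e. v \<in> W \<Longrightarrow> e \<in> E \<Longrightarrow> ev (\<rho> e) v = v e"
      and r3: "\<And>e x y t. ev (\<rho> e) (\<lambda>e. x e + t * y e) = ev (\<rho> e) x + t * ev (\<rho> e) y"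
      and r4: "\<And>e. \<rho> e \<in> Pol E"
      by blast
    \<comment> \<open>The map sends \<open>x\<close> to \<rho>(x) + x(a) (u - \<rho>(u)). On
      \<open>V\<close> this is the identity, because \<open>\<rho>\<close> fixes v - v(a) u, which
      lies in \<open>W\<close>.\<close>
    define \<sigma> where "\<sigma> e = \<rho> e + Var a * Cst (u e - ev (\<rho> e) u)" for e
    have "(\<lambda>e\<in>E. ev (\<sigma> e) x) \<in> V" for x
    proof -
      have "(\<lambda>e\<in>E. ev (\<rho> e) x) \<in> V" "(\<lambda>e\<in>E. ev (\<rho> e) u) \<in> V"
        using r1 unfolding W_def by blast+
      then have "(\<lambda>e\<in>E. (\<lambda>e\<in>E. ev (\<rho> e) x) e + x a * (\<lambda>e\<in>E. u e + (-1) * (\<lambda>e\<in>E. ev (\<rho> e) u) e) e) \<in> V"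
        using less.prems u(1) by (intro subspace_comb)
      moreover have "(\<lambda>e\<in>E. (\<lambda>e\<in>E. ev (\<rho> e) x) e + x a * (\<lambda>e\<in>E. u e + (-1) * (\<lambda>e\<in>E. ev (\<rho> e) u) e) e)
          = (\<lambda>e\<in>E. ev (\<sigma> e) x)"
        by (rule restrict_ext) (simp add: \<sigma>_def)
      ultimately show ?thesis by simp
    qed
    moreover have "ev (\<sigma> e) v = v e" if "v \<in> V" "e \<in> E" for v e
    proof -
      have "(\<lambda>e\<in>E. v e + (- v a) * u e) \<in> W"
        using subspace_comb[OF less.prems that(1) u(1), of "- v a"] a(1) u(2) by (simp add: W_def)
      from r2[OF this that(2)]
      have "ev (\<rho> e) (\<lambda>e\<in>E. v e + (- v a) * u e) = v e - v a * u e" using that(2) by simp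
      moreover have "ev (\<rho> e) (\<lambda>e\<in>E. v e + (- v a) * u e) = ev (\<rho> e) (\<lambda>e. v e + (- v a) * u e)"
        by (rule PolD[OF r4]) simp
      ultimately have "ev (\<rho> e) v - v a * ev (\<rho> e) u = v e - v a * u e"
        using r3[of e v "- v a" u] by simp
      then show ?thesis by (simp add: \<sigma>_def algebra_simps)
    qed
    moreover have "ev (\<sigma> e) (\<lambda>e. x e + t * y e) = ev (\<sigma> e) x + t * ev (\<sigma> e) y" for e x y t
      by (simp add: \<sigma>_def r3 algebra_simps)
    moreover have "\<sigma> e \<in> Pol E" for e
      unfolding \<sigma>_def using a(1) by (intro Pol_closed r4)
    ultimately show ?thesis by blast
  qed
qed

text \<open>Along \<open>u\<close> every \<open>v\<close> in \<open>V\<close> is moved to v - v(e) u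
  in the hyperplane. As a polynomial in the parameter of this line, \<open>k\<close> has a constant
  coefficient that vanishes on \<open>V\<close>; the remaining terms contain the parameter, whose
  value at \<open>v\<close> is \<open>v e\<close>.\<close>

lemma subspace_divide_coord:
  assumes V: "linear_subspace E V" and e: "e \<in> E" and u: "u \<in> V" "u e = 1"
    and k: "k \<in> Pol E" "\<And>v. v \<in> V \<Longrightarrow> v e = 0 \<Longrightarrow> ev k v = 0"
  obtains h where "h \<in> Pol E" "\<And>v. v \<in> V \<Longrightarrow> ev k v = v e * ev h v"
proof -
  define \<tau> where "\<tau> a = Var a - Cst (u a) * Var e" for a
  define p where "p = psub (\<lambda>a. if a \<in> E then [:\<tau> a, Cst (u a):] else [:Var a:]) k"
  have p: "poly (pev p x) t = ev k (\<lambda>a. x a - u a * x e + t * u a)" for x t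
    unfolding p_def poly_psub by (rule PolD[OF k(1)]) (simp add: \<tau>_def)
  obtain c q where cq: "p = pCons c q" by (cases p)
  define h where "h = poly q (Var e)"
  have agree: "pev p x = pev p y" if "\<And>a. a \<in> E \<Longrightarrow> x a = y a" for x y
  proof -
    have "poly (pev p x) t = poly (pev p y) t" for t
      unfolding p by (rule PolD[OF k(1)]) (use that e in simp)
    then show ?thesis by (rule complex_poly_eqI)
  qed
  have "h \<in> Pol E"
    unfolding Pol_def
  proof (intro CollectI allI impI)
    fix x y :: "'a \<Rightarrow> complex" assume xy: "\<forall>e\<in>E. x e = y e"
    then have "pev q x = pev q y" using agree[of x y] cq by simp
    then show "ev h x = ev h y"
      using xy e unfolding h_def poly_pev[symmetric] by simp
  qed
  moreover have "ev k v = v e * ev h v" if v: "v \<in> V" for v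
  proof -
    have "ev c v = poly (pev p v) 0" using cq by simp
    also have "\<dots> = ev k (\<lambda>a\<in>E. v a + (- v e) * u a)"
      unfolding p by (rule PolD[OF k(1)]) simp
    also have "\<dots> = 0"
      using subspace_comb[OF V v u(1), of "- v e"] e u(2) by (intro k(2)) auto
    finally have c0: "ev c v = 0" .
    have "ev k v = poly (pev p v) (v e)"
      unfolding p by (rule PolD[OF k(1)]) simp
    also have "\<dots> = v e * ev h v"
      using poly_pev[of q v "Var e"] c0 by (simp add: cq h_def)
    finally show ?thesis .
  qed
  ultimately show ?thesis using that by blast
qed

section \<open>Growth of forms along linear substitutions\<close>

lemma coeff_shf_Pol:
  assumes "f \<in> Pol S"
  shows "coeff (shf w f) i \<in> Pol S"
  unfolding Pol_def
proof (intro CollectI allI impI)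
  fix x y :: "'a \<Rightarrow> complex" assume xy: "\<forall>e\<in>S. x e = y e"
  have "poly (pev (shf w f) x) t = poly (pev (shf w f) y) t" for t
    unfolding poly_shf by (rule PolD[OF assms]) (use xy in auto)
  then have "pev (shf w f) x = pev (shf w f) y"
    by (rule complex_poly_eqI)
  then show "ev (coeff (shf w f) i) x = ev (coeff (shf w f) i) y"
    by (metis coeff_pev)
qed

text \<open>The dehomogenised form with \<open>\<sigma> e\<close> as affine coordinates: used for
  \<open>Var\<close>, and for the components of the retraction.\<close>

definition fpoly :: "'e set \<Rightarrow> ('e \<Rightarrow> 'e mpol) \<Rightarrow> ('e \<Rightarrow> nat) \<Rightarrow> (('e \<Rightarrow> nat) \<Rightarrow> complex) \<Rightarrow> 'e mpol" where
  "fpoly E \<sigma> d c = (\<Sum>i\<in>(\<Pi>\<^sub>E e\<in>E. {..d e}). Cst (c i) * (\<Prod>e\<in>E. \<sigma> e ^ i e))"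

lemma ev_fpoly: "ev (fpoly E \<sigma> d c) x = multiform E d c (\<lambda>e\<in>E. Fin (ev (\<sigma> e) x))"
  by (simp add: fpoly_def multiform_def)

lemma fpoly_Pol: "(\<And>e. e \<in> E \<Longrightarrow> \<sigma> e \<in> Pol S) \<Longrightarrow> fpoly E \<sigma> d c \<in> Pol S"
  unfolding Pol_def fpoly_def by (auto intro!: sum.cong prod.cong arg_cong2[of _ _ _ _ times] arg_cong2[of _ _ _ _ power])

text \<open>Degree bounds instead of degrees, since the coefficient at the bound may well vanish;
  whether it does is the point of the applications.\<close>

lemma coeff_mult_le_degrees:
  fixes p q :: "'a :: comm_semiring_1 poly"
  assumes "degree p \<le> m" "degree q \<le> n"
  shows "coeff (p * q) (m + n) = coeff p m * coeff q n"
proof -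
  have "coeff (p * q) (m + n) = (\<Sum>i\<le>m + n. coeff p i * coeff q (m + n - i))"
    by (rule coeff_mult)
  also have "\<dots> = (\<Sum>i\<le>m + n. if i = m then coeff p m * coeff q n else 0)"
  proof (intro sum.cong refl)
    fix i assume "i \<in> {..m + n}"
    show "coeff p i * coeff q (m + n - i) = (if i = m then coeff p m * coeff q n else 0)"
      using assms by (cases i m rule: linorder_cases) (auto simp: coeff_eq_0)
  qed
  finally show ?thesis by simp
qed

lemma coeff_prod_le_degrees:
  fixes p :: "'i \<Rightarrow> 'a :: idom poly"
  assumes "finite I" "\<And>i. i \<in> I \<Longrightarrow> degree (p i) \<le> n i"
  shows "degree (prod p I) \<le> sum n I \<and> coeff (prod p I) (sum n I) = (\<Prod>i\<in>I. coeff (p i) (n i))"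
  using assms
proof (induction I rule: finite_induct)
  case (insert i I)
  then have "degree (prod p I) \<le> sum n I" "coeff (prod p I) (sum n I) = (\<Prod>i\<in>I. coeff (p i) (n i))" by auto
  then show ?case
    using insert coeff_mult_le_degrees[of "p i" "n i" "prod p I" "sum n I"]
    by (auto intro!: order.trans[OF degree_mult_le] add_mono)
qed auto

text \<open>Only coordinates with \<open>\<beta> e \<noteq> 0\<close> grow, which explains
  \<open>N\<close>. The factor \<open>0 ^ (d e - i e)\<close> is 1 exactly for
  \<open>i e = d e\<close>, as is the power of \<open>hcoord1\<close> at \<open>Infty\<close>: the
  coefficient at \<open>N\<close> is the form at a limit point, up to normalisation.\<close>

lemma psub_fpoly:
  fixes \<sigma> :: "'e \<Rightarrow> 'e mpol" and d :: "'e \<Rightarrow> nat"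
  assumes "finite E" and lin: "\<And>e. e \<in> E \<Longrightarrow> psub \<tau> (\<sigma> e) = [:\<alpha> e, \<beta> e:]"
  defines "N \<equiv> (\<Sum>e\<in>E. if \<beta> e = 0 then 0 else d e)"
  shows "degree (psub \<tau> (fpoly E \<sigma> d c)) \<le> N"
    and "coeff (psub \<tau> (fpoly E \<sigma> d c)) N = (\<Sum>i\<in>(\<Pi>\<^sub>E e\<in>E. {..d e}). Cst (c i) *
      (\<Prod>e\<in>E. if \<beta> e = 0 then \<alpha> e ^ i e else \<beta> e ^ d e * 0 ^ (d e - i e)))"
proof -
  let ?I = "\<Pi>\<^sub>E e\<in>E. {..d e}" and ?n = "\<lambda>e. if \<beta> e = 0 then 0 else d e"
  let ?p = "\<lambda>i e. [:\<alpha> e, \<beta> e:] ^ i e"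
  have eq: "psub \<tau> (fpoly E \<sigma> d c) = (\<Sum>i\<in>?I. smult (Cst (c i)) (\<Prod>e\<in>E. ?p i e))"
    unfolding fpoly_def using lin by (simp cong: prod.cong)
  have "degree (?p i e) \<le> ?n e \<and> coeff (?p i e) (?n e) = (if \<beta> e = 0 then \<alpha> e ^ i e else \<beta> e ^ d e * 0 ^ (d e - i e))"
    if "i \<in> ?I" "e \<in> E" for i e
  proof -
    have le: "i e \<le> d e" using that by (auto simp: PiE_iff)
    show ?thesis
    proof (cases "\<beta> e = 0")
      case True
      then have "?p i e = [:\<alpha> e ^ i e:]" by (simp add: poly_const_pow)
      then show ?thesis using True by simp
    next
      case False
      then have "degree [:\<alpha> e, \<beta> e:] = 1" by simp
      then have "degree (?p i e) = i e" using False by (simp add: degree_power_eq)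
      moreover have "lead_coeff (?p i e) = \<beta> e ^ i e"
        unfolding lead_coeff_power using False by simp
      ultimately show ?thesis using False le by (cases "i e = d e") (auto simp: coeff_eq_0)
    qed
  qed
  then have "degree (\<Prod>e\<in>E. ?p i e) \<le> N \<and> coeff (\<Prod>e\<in>E. ?p i e) N =
      (\<Prod>e\<in>E. if \<beta> e = 0 then \<alpha> e ^ i e else \<beta> e ^ d e * 0 ^ (d e - i e))" if "i \<in> ?I" for i
    using coeff_prod_le_degrees[OF assms(1), of "?p i" ?n] that unfolding N_def by (simp cong: prod.cong)
  then show "degree (psub \<tau> (fpoly E \<sigma> d c)) \<le> N"
    "coeff (psub \<tau> (fpoly E \<sigma> d c)) N = (\<Sum>i\<in>?I. Cst (c i) *
      (\<Prod>e\<in>E. if \<beta> e = 0 then \<alpha> e ^ i e else \<beta> e ^ d e * 0 ^ (d e - i e)))"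
    unfolding eq by (auto simp: coeff_sum intro!: degree_sum_le finite_PiE assms(1)
        order.trans[OF degree_smult_le])
qed

text \<open>The largest possible growth along \<open>w\<close> of a form of multidegree
  \<open>n\<close>. It is polymorphic because multidegrees are natural numbers and twists are
  integers.\<close>

definition wt :: "'e set \<Rightarrow> ('e \<Rightarrow> complex) \<Rightarrow> ('e \<Rightarrow> 'a) \<Rightarrow> 'a :: comm_monoid_add" where
  "wt E w n = (\<Sum>e\<in>{e \<in> E. w e \<noteq> 0}. n e)"

lemma ev_coeff_line:
  assumes "linear_subspace E V" "f \<in> Pol E" "v \<in> V" "w \<in> V"
  shows "poly (pev (shf w f) v) t = ev f (\<lambda>e\<in>E. v e + t * w e)"
  unfolding poly_shf by (rule PolD[OF assms(2)]) simp

text \<open>The substitute for normality of the matroid Schubert variety.  The restriction of \<open>h\<close> to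
  \<open>{v e = 0}\<close> is a form by induction; subtracting a lift of it leaves a multiple of \<open>v e\<close>.\<close>

lemma bounded_poly_is_form:
  assumes "finite E" "linear_subspace E V" "h \<in> Pol E"
    and "\<And>w v j. w \<in> V \<Longrightarrow> v \<in> V \<Longrightarrow> j > wt E w n \<Longrightarrow> ev (coeff (shf w h) j) v = 0"
  shows "\<exists>F\<in>MF E n. \<forall>v\<in>V. ev h v = F (affine_embed E v)"
  using assms(2-4)
proof (induction "sum n E" arbitrary: V n h rule: less_induct)
  case less
  note V = less.prems(1) and hP = less.prems(2) and bd = less.prems(3)
  consider (const) "\<And>e. e \<in> E \<Longrightarrow> n e = 0"
    | (loop) e where "e \<in> E" "n e \<noteq> 0" "\<And>v. v \<in> V \<Longrightarrow> v e = 0"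
    | (main) e where "e \<in> E" "n e \<noteq> 0" "\<exists>v\<in>V. v e \<noteq> 0"
    by blast
  then show ?case
  proof cases
    case const
    have "ev h w = ev h (\<lambda>e\<in>E. 0)" if w: "w \<in> V" for w
    proof -
      have z: "(\<lambda>e\<in>E. 0) \<in> V" using V by (simp add: linear_subspace_def)
      have "wt E w n = 0" using const by (simp add: wt_def)
      then have "coeff (pev (shf w h) (\<lambda>e\<in>E. 0)) j = 0" if "j > 0" for j
        using bd[OF w z, of j] that by simp
      then have "degree (pev (shf w h) (\<lambda>e\<in>E. 0)) = 0"
        by (metis leading_coeff_0_iff degree_0 neq0_conv)
      then obtain c where "pev (shf w h) (\<lambda>e\<in>E. 0) = [:c:]" by (rule degree_eq_zeroE)
      then have "ev h (\<lambda>e\<in>E. (\<lambda>e\<in>E. 0) e + t * w e) = c" for t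
        using ev_coeff_line[OF V hP z w, of t] by simp
      from this[of 1] this[of 0] show ?thesis
        using subspace_ext[OF V w] by (simp cong: restrict_cong)
    qed
    moreover have "(\<lambda>x. ev h (\<lambda>e\<in>E. 0)) \<in> MF E n"
      using MF_const MF_cong[of E n "\<lambda>_. 0"] const by blast
    ultimately show ?thesis by (intro bexI[of _ "\<lambda>x. ev h (\<lambda>e\<in>E. 0)"]) auto
  next
    \<comment> \<open>Coordinates vanishing on the whole space arise because the induction passes to
      the hyperplane sections \<open>V0\<close>.\<close>
    case loop
    define n' where "n' = n(e := 0)"
    have "sum n' E < sum n E"
      using assms(1) loop(1,2) by (intro sum_strict_mono_ex1) (auto simp: n'_def)
    moreover have "wt E w n' = wt E w n" if "w \<in> V" for w
      unfolding wt_def by (rule sum.cong) (use loop(3)[OF that] in \<open>auto simp: n'_def\<close>)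
    ultimately obtain F where F: "F \<in> MF E n'" "\<forall>v\<in>V. ev h v = F (affine_embed E v)"
      using less.hyps[of n' V h] V hP bd by auto
    \<comment> \<open>The added monomial is \<open>hcoord1 (x e) ^ n e\<close>, which is 1 at finite
      points: it raises the multidegree and leaves the values on \<open>V\<close> alone.\<close>
    define G where "G x = F x * hmonom E (\<lambda>a. if a = e then n e else 0) (\<lambda>_. 0) x" for x
    have "G \<in> MF E (\<lambda>a. n' a + (if a = e then n e else 0))"
      unfolding G_def by (intro MF_mult F(1) MF_hmonom assms(1)) auto
    moreover have "(\<lambda>a. n' a + (if a = e then n e else 0)) = n"
      by (auto simp: n'_def)
    moreover have "hmonom E d (\<lambda>_. 0) (affine_embed E v) = 1" for d v
      by (simp add: hmonom_def affine_embed_def)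
    ultimately show ?thesis using F(2) by (intro bexI[of _ G]) (auto simp: G_def)
  next
    case main
    obtain u where u: "u \<in> V" "u e = 1" using main(3) subspace_unit_coord[OF V main(1)] by blast
    define V0 where "V0 = {v \<in> V. v e = 0}"
    have V0: "linear_subspace E V0" unfolding V0_def using V main(1) by (rule subspace_hyperplane)
    define n' where "n' = n(e := 0)"
    have lt: "sum n' E < sum n E"
      using assms(1) main(1,2) by (intro sum_strict_mono_ex1) (auto simp: n'_def)
    have "wt E w n' = wt E w n" if "w \<in> V0" for w
      unfolding wt_def by (rule sum.cong) (use that in \<open>auto simp: n'_def V0_def\<close>)
    then obtain F where F: "F \<in> MF E n'" "\<forall>v\<in>V0. ev h v = F (affine_embed E v)"
      using less.hyps[OF lt V0 hP] bd by (auto simp: V0_def)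
    obtain c where Fc: "F = multiform E n' c" using F(1) by (auto simp: MF_def)
    define f where "f = fpoly E Var n' c"
    have ev_f: "ev f v = F (affine_embed E v)" for v
      by (simp add: f_def ev_fpoly Fc affine_embed_def)
    have fP: "f \<in> Pol E" unfolding f_def by (intro fpoly_Pol Pol_closed)
    have degf: "degree (shf w f) \<le> wt E w n" for w
    proof -
      have "degree (shf w f) \<le> (\<Sum>a\<in>E. if Cst (w a) = (0 :: 'a mpol) then 0 else n' a)"
        unfolding f_def shf_def by (rule psub_fpoly(1)[OF assms(1)]) simp
      also have "\<dots> = wt E w n'"
        using assms(1) unfolding wt_def by (auto simp: sum.If_cases Int_def intro!: sum.cong)
      also have "\<dots> \<le> wt E w n" unfolding wt_def by (intro sum_mono) (auto simp: n'_def)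
      finally show ?thesis .
    qed
    have k: "h - f \<in> Pol E" "\<And>v. v \<in> V \<Longrightarrow> v e = 0 \<Longrightarrow> ev (h - f) v = 0"
      using hP fP F(2) by (auto intro!: Pol_closed simp: ev_f V0_def)
    obtain g where gP: "g \<in> Pol E" and g: "\<And>v. v \<in> V \<Longrightarrow> ev (h - f) v = v e * ev g v"
      using subspace_divide_coord[OF V main(1) u k] by blast
    \<comment> \<open>Dividing by \<open>v e\<close> lowers the growth by one in the directions with
      \<open>w e \<noteq> 0\<close>, and in no other.\<close>
    define n1 where "n1 = n(e := n e - 1)"
    have lt1: "sum n1 E < sum n E"
      using assms(1) main(1,2) by (intro sum_strict_mono_ex1) (auto simp: n1_def)
    have bdk: "coeff (pev (shf w (h - f)) v) j = 0" if "w \<in> V" "v \<in> V" "j > wt E w n" for w v j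
    proof -
      have "shf w (h - f) + shf w f = shf w h" by (simp flip: shf_simps(3))
      then have "coeff (shf w (h - f)) j = coeff (shf w h) j - coeff (shf w f) j"
        by (metis add_diff_cancel_right' coeff_diff)
      moreover have "coeff (shf w f) j = 0" using degf[of w] that(3) by (intro coeff_eq_0) simp
      ultimately show ?thesis using bd[OF that] by simp
    qed
    have line: "pev (shf w (h - f)) v = [:v e, w e:] * pev (shf w g) v" if "w \<in> V" "v \<in> V" for w v
    proof -
      have "poly (pev (shf w (h - f)) v) t = poly ([:v e, w e:] * pev (shf w g) v) t" for t
        using g[OF subspace_comb[OF V that(2,1)], of t] main(1)
        unfolding poly_mult ev_coeff_line[OF V k(1) that(2,1)] ev_coeff_line[OF V gP that(2,1)] by simp
      then show ?thesis by (rule complex_poly_eqI)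
    qed
    have "ev (coeff (shf w g) j) v = 0" if wv: "w \<in> V" "v \<in> V" "j > wt E w n1" for w v j
    proof (cases "w e = 0")
      case False
      have "wt E w n = wt E w n1 + 1"
        unfolding wt_def using assms(1) main(1,2) False
        by (subst (1 2) sum.remove[of _ e]) (auto simp: n1_def intro!: sum.cong)
      show ?thesis
      proof (rule ccontr)
        assume "ev (coeff (shf w g) j) v \<noteq> 0"
        then have nz: "coeff (pev (shf w g) v) j \<noteq> 0" by simp
        then have g0: "pev (shf w g) v \<noteq> 0" and "degree (pev (shf w g) v) \<ge> j"
          by (metis coeff_0) (rule le_degree[OF nz])
        moreover have "degree (pev (shf w (h - f)) v) = 1 + degree (pev (shf w g) v)"
          unfolding line[OF wv(1,2)] using False g0 by (subst degree_mult_eq) auto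
        ultimately have "degree (pev (shf w (h - f)) v) > wt E w n"
          using wv(3) \<open>wt E w n = wt E w n1 + 1\<close> by simp
        from bdk[OF wv(1,2) this] have "pev (shf w (h - f)) v = 0"
          by (simp only: leading_coeff_0_iff)
        then have "[:v e, w e:] * pev (shf w g) v = 0" using line[OF wv(1,2)] by simp
        then show False using g0 False by (metis mult_eq_0_iff pCons_eq_0_iff)
      qed
    next
      case True
      have "wt E w n = wt E w n1"
        unfolding wt_def by (rule sum.cong) (use True in \<open>auto simp: n1_def\<close>)
      then have nz: "ev (coeff (shf w g) j) v' = 0" if "v' \<in> V" "v' e \<noteq> 0" for v'
        using bdk[OF wv(1) that(1), of j] wv(3) line[OF wv(1) that(1)] that(2) True by simp
      show ?thesis
      proof (cases "v e = 0")
        case ve: True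
        \<comment> \<open>For \<open>w e = 0\<close> the factor \<open>v e\<close> is constant along
          the line and cannot be cancelled at \<open>v e = 0\<close>. Moving \<open>v\<close> along
          \<open>u\<close> makes it nonzero, and a polynomial vanishing for all
          \<open>s \<noteq> 0\<close> vanishes at 0.\<close>
        let ?P = "pev (shf u (coeff (shf w g) j)) v"
        have P: "poly ?P s = ev (coeff (shf w g) j) (\<lambda>a\<in>E. v a + s * u a)" for s
          by (rule ev_coeff_line[OF V coeff_shf_Pol[OF gP] wv(2) u(1)])
        have "poly ?P s = 0" if "s \<noteq> 0" for s
          unfolding P using subspace_comb[OF V wv(2) u(1)] that ve u(2) main(1) by (intro nz) auto
        then have "poly (?P * [:0, 1:]) = poly 0" by (auto simp: fun_eq_iff)
        then have "?P * [:0, 1:] = 0" by (metis poly_eq_poly_eq_iff)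
        then have "poly ?P 0 = 0" by simp
        then show ?thesis by (simp add: poly_shf)
      qed (use nz wv in auto)
    qed
    then obtain F1 where F1: "F1 \<in> MF E n1" "\<forall>v\<in>V. ev g v = F1 (affine_embed E v)"
      using less.hyps[OF lt1 V gP] by blast
    define G where "G x = F x * hmonom E (\<lambda>a. if a = e then n e else 0) (\<lambda>_. 0) x
      + F1 x * hmonom E (\<lambda>a. if a = e then 1 else 0) (\<lambda>a. if a = e then 1 else 0) x" for x
    have "(\<lambda>x. F x * hmonom E (\<lambda>a. if a = e then n e else 0) (\<lambda>_. 0) x)
        \<in> MF E (\<lambda>a. n' a + (if a = e then n e else 0))"
      by (intro MF_mult F(1) MF_hmonom assms(1)) auto
    moreover have "(\<lambda>a. n' a + (if a = e then n e else 0)) = n" by (auto simp: n'_def)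
    moreover have "(\<lambda>x. F1 x * hmonom E (\<lambda>a. if a = e then 1 else 0) (\<lambda>a. if a = e then 1 else 0) x)
        \<in> MF E (\<lambda>a. n1 a + (if a = e then 1 else 0))"
      by (intro MF_mult F1(1) MF_hmonom assms(1)) auto
    moreover have "(\<lambda>a. n1 a + (if a = e then 1 else 0)) = n" using main(2) by (auto simp: n1_def)
    ultimately have "G \<in> MF E n" unfolding G_def by (intro MF_add) simp_all
    moreover have "ev h v = G (affine_embed E v)" if v: "v \<in> V" for v
    proof -
      have m0: "hmonom E (\<lambda>a. if a = e then n e else 0) (\<lambda>_. 0) (affine_embed E v) = 1"
        by (simp add: hmonom_def affine_embed_def)
      have "hmonom E (\<lambda>a. if a = e then 1 else 0) (\<lambda>a. if a = e then 1 else 0) (affine_embed E v)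
          = (\<Prod>a\<in>E. if a = e then v a else 1)"
        unfolding hmonom_def affine_embed_def by (intro prod.cong) auto
      also have "\<dots> = v e" using main(1) assms(1) by (simp add: prod.delta)
      finally have m1: "hmonom E (\<lambda>a. if a = e then 1 else 0) (\<lambda>a. if a = e then 1 else 0) (affine_embed E v) = v e" .
      have "ev h v = ev f v + ev (h - f) v" by simp
      then show ?thesis using F1(2) g[OF v] v ev_f[of v] by (simp add: G_def m0 m1 algebra_simps)
    qed
    ultimately show ?thesis by blast
  qed
qed


section \<open>Pulling forms back to the linear space\<close>

locale subspace_retraction =
  fixes E :: "'e set" and V :: "('e \<Rightarrow> complex) set" and \<rho> :: "'e \<Rightarrow> 'e mpol"
  assumes finE: "finite E"
    and subV: "linear_subspace E V"
    and not_hyperplane: "\<forall>e\<in>E. \<not> V \<subseteq> coord_hyperplane E e"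
    and retr_in': "\<And>x. (\<lambda>e\<in>E. ev (\<rho> e) x) \<in> V"
    and rho_id: "\<And>v e. v \<in> V \<Longrightarrow> e \<in> E \<Longrightarrow> ev (\<rho> e) v = v e"
    and rho_lin: "\<And>e x y t. ev (\<rho> e) (\<lambda>e. x e + t * y e) = ev (\<rho> e) x + t * ev (\<rho> e) y"
    and rho_Pol: "\<And>e. \<rho> e \<in> Pol E"
begin

abbreviation Y :: "('e \<Rightarrow> P1) set" where
  "Y \<equiv> matroid_schubert_variety E V"

definition retr :: "('e \<Rightarrow> complex) \<Rightarrow> ('e \<Rightarrow> complex)" where
  "retr x = (\<lambda>e\<in>E. ev (\<rho> e) x)"

definition pt :: "('e \<Rightarrow> complex) \<Rightarrow> ('e \<Rightarrow> P1)" where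
  "pt x = affine_embed E (retr x)"

lemma pt_eq: "pt x = (\<lambda>e\<in>E. Fin (ev (\<rho> e) x))"
  by (auto simp: pt_def affine_embed_def retr_def fun_eq_iff)

lemma retr_in: "retr x \<in> V"
  unfolding retr_def by (rule retr_in')

lemma retr_id: "v \<in> V \<Longrightarrow> retr v = v"
proof -
  assume v: "v \<in> V"
  then have "retr v = restrict v E"
    unfolding retr_def by (intro restrict_ext) (simp add: rho_id)
  then show ?thesis using subspace_ext[OF subV v] by simp
qed

lemma range_pt: "affine_embed E ` V = range pt"
proof
  show "affine_embed E ` V \<subseteq> range pt"
  proof
    fix p assume "p \<in> affine_embed E ` V"
    then obtain v where "v \<in> V" "p = affine_embed E v" by blast
    then have "p = pt v" by (simp add: pt_def retr_id)
    then show "p \<in> range pt" by simp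
  qed
  show "range pt \<subseteq> affine_embed E ` V"
    using retr_in by (auto simp: pt_def)
qed

lemma Y_eq: "Y = zariski E closure_of range pt"
  by (simp add: matroid_schubert_variety_def range_pt)

lemma pt_in_P1: "pt x \<in> P1_power E"
  by (simp add: pt_eq P1_power_def)

lemma pt_in_Y: "pt x \<in> Y"
  unfolding Y_eq using closure_of_subset[of "range pt" "zariski E"] pt_in_P1 by auto

lemma Y_subset: "Y \<subseteq> P1_power E"
  unfolding Y_eq using closure_of_subset_topspace[of "zariski E"] by auto

text \<open>The restriction of a form to \<open>V\<close>, spread over the whole coordinate space by
  the retraction.\<close>

definition pull :: "(('e \<Rightarrow> P1) \<Rightarrow> complex) \<Rightarrow> 'e mpol" where
  "pull F = (THE f. \<forall>x. ev f x = F (pt x))"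

lemma pull_unique: "(\<And>x. ev f x = F (pt x)) \<Longrightarrow> pull F = f"
  unfolding pull_def by (rule the_equality) (auto intro: mpol_eqI)

lemma pull_multiform: "pull (multiform E d c) = fpoly E \<rho> d c"
  by (rule pull_unique) (simp add: ev_fpoly pt_eq)

lemma ev_pull: "F \<in> MF E d \<Longrightarrow> ev (pull F) x = F (pt x)"
  by (auto simp: MF_def pull_multiform ev_fpoly pt_eq)

lemma pull_mult: "F \<in> MF E d \<Longrightarrow> G \<in> MF E d' \<Longrightarrow> pull (\<lambda>x. F x * G x) = pull F * pull G"
  by (rule pull_unique) (simp add: ev_pull)

lemma pull_power: "F \<in> MF E d \<Longrightarrow> pull (\<lambda>x. F x ^ n) = pull F ^ n"
  by (rule pull_unique) (simp add: ev_pull)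

lemma pull_eq_imp_eq_on_Y:
  assumes "F \<in> MF E d" "G \<in> MF E d" "pull F = pull G" "p \<in> Y"
  shows "F p = G p"
proof -
  have "(\<lambda>x. F x - G x) p = 0"
  proof (rule MF_vanish_closure[OF MF_diff[OF assms(1,2)]])
    fix s assume "s \<in> range pt"
    then show "F s - G s = 0" using assms(3) ev_pull[OF assms(1)] ev_pull[OF assms(2)] by auto
  qed (use assms(4) Y_eq in blast)
  then show ?thesis by simp
qed

lemma pull_nonzero:
  assumes "F \<in> MF E d" "F p \<noteq> 0" "p \<in> Y"
  shows "pull F \<noteq> 0"
proof
  assume "pull F = 0"
  then have "pull F = pull (\<lambda>x. 0)" by (metis pull_unique ev_simps(3))
  then show False using pull_eq_imp_eq_on_Y[OF assms(1) MF_zero _ assms(3)] assms(2) by simp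
qed

text \<open>The copy of the coordinate ring of \<open>V\<close> inside the polynomial ring.
  Factorisations are taken in the large ring, so it matters that this copy is closed under
  divisors.\<close>

definition rinv :: "'e mpol \<Rightarrow> bool" where
  "rinv f \<longleftrightarrow> (\<forall>x. ev f (retr x) = ev f x)"

lemma rinv_Pol: "rinv f \<Longrightarrow> f \<in> Pol E"
  unfolding Pol_def
proof (intro CollectI allI impI)
  fix x y :: "'e \<Rightarrow> complex" assume f: "rinv f" and xy: "\<forall>e\<in>E. x e = y e"
  have "retr x = retr y"
    unfolding retr_def by (rule restrict_ext, rule PolD[OF rho_Pol]) (use xy in auto)
  then show "ev f x = ev f y" using f unfolding rinv_def by metis
qed

lemma rinv_pull: "F \<in> MF E d \<Longrightarrow> rinv (pull F)"
  using retr_id[OF retr_in] by (simp add: rinv_def ev_pull pt_def)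

lemma rinv_mult: "rinv f \<Longrightarrow> rinv g \<Longrightarrow> rinv (f * g)"
  by (simp add: rinv_def)

lemma rinv_power: "rinv f \<Longrightarrow> rinv (f ^ n)"
  by (simp add: rinv_def)

text \<open>\<open>c\<close> is constant in the kernel directions of the retraction. Degrees along
  such a direction add up, so its divisors are constant there as well.\<close>

lemma rinv_divisor:
  assumes c: "rinv c" "c \<noteq> 0" and "d dvd c"
  shows "rinv d"
  unfolding rinv_def
proof
  fix x
  \<comment> \<open>The difference is formed at every index, also outside \<open>E\<close>, where
    \<open>retr x\<close> is \<open>undefined\<close>; thus adding \<open>u\<close> to
    \<open>retr x\<close> gives back exactly \<open>x\<close>.\<close>
  define u where "u e = x e + (-1) * retr x e" for e
  have rho_u: "ev (\<rho> e) u = 0" if "e \<in> E" for e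
  proof -
    have "ev (\<rho> e) u = ev (\<rho> e) x + (-1) * ev (\<rho> e) (retr x)"
      unfolding u_def by (rule rho_lin)
    then show ?thesis using rho_id[OF retr_in that, of x] that by (simp add: retr_def)
  qed
  have "retr (\<lambda>e. y e + t * u e) = retr y" for y t
    unfolding retr_def by (rule restrict_ext) (simp add: rho_lin rho_u)
  then have "ev c (\<lambda>e. y e + t * u e) = ev c y" for y t
    using c(1) unfolding rinv_def by metis
  then have "poly (pev (shf u c) y) t = poly (pev [:c:] y) t" for y t
    by (simp add: poly_shf)
  then have "shf u c = [:c:]"
    by (intro pev_eqI complex_poly_eqI)
  then have "degree (shf u c) = 0" by simp
  moreover obtain e where e: "c = d * e" using assms(3) by auto
  moreover have "d \<noteq> 0" "e \<noteq> 0" using c(2) e by auto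
  ultimately have "degree (shf u d) = 0" by (simp add: degree_mult_eq)
  then obtain a where "shf u d = [:a:]" by (rule degree_eq_zeroE)
  then have const: "ev d (\<lambda>e. y e + t * u e) = ev d (\<lambda>e. y e + s * u e)" for y t s
    by (metis poly_shf pev_hom(1,5) poly_pCons mult_zero_right poly_0 add_0_right)
  have "(\<lambda>e. retr x e + 0 * u e) = retr x" "(\<lambda>e. retr x e + 1 * u e) = x"
    by (auto simp: u_def)
  then show "ev d (retr x) = ev d x" using const[of "retr x" 0 1] by simp
qed


section \<open>Degrees along the boundary\<close>

lemma shf_rho:
  assumes "w \<in> V" "e \<in> E"
  shows "shf w (\<rho> e) = [:\<rho> e, Cst (w e):]"
proof (rule pev_eqI)
  fix x
  have "poly (pev (shf w (\<rho> e)) x) t = poly (pev [:\<rho> e, Cst (w e):] x) t" for t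
    using rho_lin[of e x t w] rho_id[OF assms] by (simp add: poly_shf)
  then show "pev (shf w (\<rho> e)) x = pev [:\<rho> e, Cst (w e):] x"
    by (rule complex_poly_eqI)
qed

lemma scl_rho: "scl (\<rho> e) = [:0, \<rho> e:]"
proof (rule pev_eqI)
  fix x
  have z: "ev (\<rho> e) (\<lambda>_. 0) = 0" using rho_lin[of e x "-1" x] by simp
  have "poly (pev (scl (\<rho> e)) x) t = poly (pev [:0, \<rho> e:] x) t" for t
    using rho_lin[of e "\<lambda>_. 0" t x] z by (simp add: poly_scl)
  then show "pev (scl (\<rho> e)) x = pev [:0, \<rho> e:] x"
    by (rule complex_poly_eqI)
qed

text \<open>This is where the hypothesis on coordinate hyperplanes enters.\<close>

lemma rho_nonzero: "e \<in> E \<Longrightarrow> \<rho> e \<noteq> 0"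
proof
  assume e: "e \<in> E" "\<rho> e = 0"
  have "v \<in> coord_hyperplane E e" if "v \<in> V" for v
    using rho_id[OF that e(1)] e(2) subV that unfolding coord_hyperplane_def linear_subspace_def by auto
  then show False using not_hyperplane e(1) by blast
qed

text \<open>The limit of \<open>pt (x + t w)\<close> for \<open>t \<rightarrow> \<infinity>\<close>.\<close>

definition lm :: "('e \<Rightarrow> complex) \<Rightarrow> ('e \<Rightarrow> complex) \<Rightarrow> ('e \<Rightarrow> P1)" where
  "lm x w = (\<lambda>e\<in>E. if w e = 0 then Fin (ev (\<rho> e) x) else Infty)"

definition infp :: "'e \<Rightarrow> P1" where
  "infp = (\<lambda>e\<in>E. Infty)"

lemma wt_alt: "wt E w d = (\<Sum>e\<in>E. if w e = 0 then 0 else d e)"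
  unfolding wt_def using finE by (auto simp: sum.If_cases Int_def intro!: sum.cong)

text \<open>For large t the coordinates [x + t w : 1] with \<open>w e \<noteq> 0\<close> tend to
  [w : 0], whereas \<open>Infty\<close> is normalised to [1 : 0]; the product of the
  \<open>w e ^ d e\<close> is this change of normalisation. Hence full growth along \<open>w\<close>
  means that the form is not identically zero on the boundary stratum.\<close>

lemma
  assumes F: "F \<in> MF E d" and w: "w \<in> V"
  shows degree_shf_pull: "degree (shf w (pull F)) \<le> wt E w d"
    and coeff_shf_pull: "ev (coeff (shf w (pull F)) (wt E w d)) x =
      F (lm x w) * (\<Prod>e\<in>E. if w e = 0 then 1 else w e ^ d e)"
proof -
  obtain c where c: "F = multiform E d c" using F by (auto simp: MF_def)
  have lin: "psub (\<lambda>e. [:Var e, Cst (w e):]) (\<rho> e) = [:\<rho> e, Cst (w e):]" if "e \<in> E" for e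
    using shf_rho[OF w that] by (simp add: shf_def)
  note ps = psub_fpoly[where \<tau> = "\<lambda>e. [:Var e, Cst (w e):]" and \<sigma> = \<rho> and \<alpha> = \<rho> and \<beta> = "\<lambda>e. Cst (w e)",
      OF finE lin, of d c, folded shf_def]
  have N: "(\<Sum>e\<in>E. if Cst (w e) = (0 :: 'e mpol) then 0 else d e) = wt E w d"
    by (simp add: wt_alt)
  show "degree (shf w (pull F)) \<le> wt E w d"
    using ps(1) unfolding N c pull_multiform by simp
  have "ev (coeff (shf w (pull F)) (wt E w d)) x = (\<Sum>i\<in>(\<Pi>\<^sub>E e\<in>E. {..d e}). c i *
      (\<Prod>e\<in>E. if w e = 0 then ev (\<rho> e) x ^ i e else w e ^ d e * 0 ^ (d e - i e)))"
    using ps(2) unfolding N c pull_multiform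
    by (auto intro!: sum.cong prod.cong arg_cong2[of _ _ _ _ times])
  also have "\<dots> = (\<Sum>i\<in>(\<Pi>\<^sub>E e\<in>E. {..d e}). c i *
      ((\<Prod>e\<in>E. hcoord0 (lm x w e) ^ i e * hcoord1 (lm x w e) ^ (d e - i e)) *
       (\<Prod>e\<in>E. if w e = 0 then 1 else w e ^ d e)))"
    unfolding prod.distrib[symmetric]
    by (intro sum.cong refl arg_cong2[of _ _ _ _ times] prod.cong) (auto simp: lm_def)
  also have "\<dots> = F (lm x w) * (\<Prod>e\<in>E. if w e = 0 then 1 else w e ^ d e)"
    unfolding c multiform_def sum_distrib_right by (simp add: mult.assoc)
  finally show "ev (coeff (shf w (pull F)) (wt E w d)) x =
      F (lm x w) * (\<Prod>e\<in>E. if w e = 0 then 1 else w e ^ d e)" .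
qed

text \<open>The same comparison for the rays through the origin: where no \<open>\<rho> e\<close>
  vanishes they tend to \<infinity>, so the value at \<infinity> decides whether the coefficient at
  \<open>sum d E\<close> is nonzero.\<close>

lemma
  assumes F: "F \<in> MF E d"
  shows degree_scl_pull: "degree (scl (pull F)) \<le> sum d E"
    and coeff_scl_pull: "coeff (scl (pull F)) (sum d E) = Cst (F infp) * (\<Prod>e\<in>E. \<rho> e ^ d e)"
proof -
  obtain c where c: "F = multiform E d c" using F by (auto simp: MF_def)
  have lin: "psub (\<lambda>e. [:0, Var e:]) (\<rho> e) = [:0, \<rho> e:]" for e
    using scl_rho[of e] by (simp add: scl_def)
  note ps = psub_fpoly[where \<tau> = "\<lambda>e. [:0, Var e:]" and \<sigma> = \<rho> and \<alpha> = "\<lambda>_. 0" and \<beta> = \<rho>,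
      OF finE lin, of d c, folded scl_def]
  have N: "(\<Sum>e\<in>E. if \<rho> e = 0 then 0 else d e) = sum d E"
    by (intro sum.cong) (auto simp: rho_nonzero)
  show "degree (scl (pull F)) \<le> sum d E"
    using ps(1) unfolding N c pull_multiform by simp
  have "coeff (scl (pull F)) (sum d E) = (\<Sum>i\<in>(\<Pi>\<^sub>E e\<in>E. {..d e}). Cst (c i) *
      (\<Prod>e\<in>E. if \<rho> e = 0 then 0 ^ i e else \<rho> e ^ d e * 0 ^ (d e - i e)))"
    using ps(2) unfolding N c pull_multiform by simp
  also have "\<dots> = (\<Sum>i\<in>(\<Pi>\<^sub>E e\<in>E. {..d e}). Cst (c i * (\<Prod>e\<in>E. 0 ^ (d e - i e))) * (\<Prod>e\<in>E. \<rho> e ^ d e))"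
  proof (intro sum.cong refl)
    fix i
    have "(\<Prod>e\<in>E. if \<rho> e = 0 then 0 ^ i e else \<rho> e ^ d e * 0 ^ (d e - i e)) =
        (\<Prod>e\<in>E. \<rho> e ^ d e * 0 ^ (d e - i e))"
      by (intro prod.cong) (auto simp: rho_nonzero)
    also have "\<dots> = Cst (\<Prod>e\<in>E. 0 ^ (d e - i e)) * (\<Prod>e\<in>E. \<rho> e ^ d e)"
      by (rule mpol_eqI) (simp add: prod.distrib mult.commute)
    finally show "Cst (c i) * (\<Prod>e\<in>E. if \<rho> e = 0 then 0 ^ i e else \<rho> e ^ d e * 0 ^ (d e - i e)) =
        Cst (c i * (\<Prod>e\<in>E. 0 ^ (d e - i e))) * (\<Prod>e\<in>E. \<rho> e ^ d e)"
      by (simp add: Cst_hom)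
  qed
  also have "\<dots> = Cst (F infp) * (\<Prod>e\<in>E. \<rho> e ^ d e)"
    unfolding c multiform_def sum_distrib_right[symmetric]
    by (rule arg_cong2[of _ _ _ _ times], rule mpol_eqI) (simp_all add: infp_def)
  finally show "coeff (scl (pull F)) (sum d E) = Cst (F infp) * (\<Prod>e\<in>E. \<rho> e ^ d e)" .
qed

lemma lm_factor_nonzero: "(\<Prod>e\<in>E. if w e = 0 then 1 else w e ^ d e) \<noteq> (0 :: complex)"
  using finE by auto

lemma degree_shf_pull_eq:
  assumes "F \<in> MF E d" "w \<in> V" "F (lm x w) \<noteq> 0"
  shows "degree (shf w (pull F)) = wt E w d"
proof -
  have "ev (coeff (shf w (pull F)) (wt E w d)) x \<noteq> 0"
    using coeff_shf_pull[OF assms(1,2), of x] lm_factor_nonzero assms(3) by simp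
  then have "coeff (shf w (pull F)) (wt E w d) \<noteq> 0" by auto
  then show ?thesis using degree_shf_pull[OF assms(1,2)] le_degree le_antisym by blast
qed

text \<open>No limit is taken: a form that is nonzero at this point has a nonzero coefficient along
  \<open>w\<close>, so it is not identically zero on \<open>V\<close>.\<close>

lemma lm_in_Y:
  assumes "w \<in> V"
  shows "lm x w \<in> Y"
  unfolding Y_eq
proof (rule in_zariski_closureI[OF finE])
  show "lm x w \<in> P1_power E" by (simp add: lm_def P1_power_def)
  fix d F assume F: "F \<in> MF E d" "F (lm x w) \<noteq> 0"
  then have "coeff (shf w (pull F)) (wt E w d) \<noteq> 0"
    using coeff_shf_pull[OF F(1) assms, of x] lm_factor_nonzero by auto
  then have "pull F \<noteq> 0" by auto
  then obtain y where "ev (pull F) y \<noteq> 0" by (rule mpol_nonzero_point)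
  then show "\<exists>s\<in>range pt \<inter> P1_power E. F s \<noteq> 0" using ev_pull[OF F(1)] pt_in_P1 by auto
qed

text \<open>The product of the nonzero linear forms \<open>\<rho> e\<close> is nonzero, so
  \<open>V\<close> contains a vector without zero coordinates; in its direction all coordinates
  become infinite.\<close>

lemma infp_in_Y: "infp \<in> Y"
proof -
  have "(\<Prod>e\<in>E. \<rho> e) \<noteq> 0" using finE rho_nonzero by auto
  then obtain x where "ev (\<Prod>e\<in>E. \<rho> e) x \<noteq> 0" by (rule mpol_nonzero_point)
  then have "lm x (retr x) = infp"
    using finE by (auto simp: lm_def infp_def retr_def fun_eq_iff)
  then show ?thesis using lm_in_Y[OF retr_in] by metis
qed

section \<open>Top homogeneous components\<close>

lemma degree_shf_top:
  fixes f :: "'e mpol"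
  shows "degree (shf w (lead_coeff (scl f))) \<le> degree (shf w f)"
proof (rule degree_le, intro allI impI)
  fix k assume k: "k > degree (shf w f)"
  define d D c where "d = degree (scl f)" and "D = degree (shf w f)" and "c j = coeff (shf w f) j" for j
  \<comment> \<open>Expand f(l (x + t w)) in \<open>l\<close> and in \<open>t\<close>. No power of
    \<open>t\<close> exceeds the degree \<open>D\<close> along \<open>w\<close>; in particular the
    coefficient of \<open>l ^ d\<close>, which is the top component at x + t w, has degree at most
    \<open>D\<close> in \<open>t\<close>.\<close>
  have id: "pev (scl f) (\<lambda>e. x e + t * w e) = (\<Sum>j\<le>D. smult (t ^ j) (monom 1 j * pev (scl (c j)) x))" for x t
  proof -
    have "poly (pev (scl f) (\<lambda>e. x e + t * w e)) l =
        poly (\<Sum>j\<le>D. smult (t ^ j) (monom 1 j * pev (scl (c j)) x)) l" for l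
    proof -
      have "poly (pev (scl f) (\<lambda>e. x e + t * w e)) l = poly (pev (shf w f) (\<lambda>e. l * x e)) (l * t)"
        by (simp add: poly_scl poly_shf algebra_simps)
      also have "\<dots> = (\<Sum>j\<le>D. ev (c j) (\<lambda>e. l * x e) * (l * t) ^ j)"
        using arg_cong[OF poly_as_sum_of_monoms'[of "pev (shf w f) (\<lambda>e. l * x e)" D],
            of "\<lambda>p. poly p (l * t)"] degree_pev_le[of "shf w f"]
        by (simp add: D_def c_def poly_sum poly_monom)
      finally show ?thesis
        by (simp add: poly_sum poly_monom poly_scl power_mult_distrib algebra_simps)
    qed
    then show ?thesis by (rule complex_poly_eqI)
  qed
  show "coeff (shf w (lead_coeff (scl f))) k = 0"
  proof (rule mpol_eqI)
    fix x
    \<comment> \<open>For \<open>j > d\<close> the factor \<open>monom 1 j\<close> leaves no term of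
      degree \<open>d\<close> in \<open>l\<close>; the case distinction also guards the truncated
      \<open>d - j\<close>.\<close>
    define a where "a j = (if j \<le> d then ev (coeff (scl (c j)) (d - j)) x else 0)" for j
    have "poly (pev (shf w (lead_coeff (scl f))) x) t = poly (\<Sum>j\<le>D. monom (a j) j) t" for t
    proof -
      have "poly (pev (shf w (lead_coeff (scl f))) x) t = coeff (pev (scl f) (\<lambda>e. x e + t * w e)) d"
        by (simp add: poly_shf d_def)
      then show ?thesis unfolding id
        by (simp add: coeff_sum coeff_monom_mult poly_sum poly_monom a_def algebra_simps cong: if_cong)
          (auto intro!: sum.cong)
    qed
    then have "pev (shf w (lead_coeff (scl f))) x = (\<Sum>j\<le>D. monom (a j) j)"
      by (rule complex_poly_eqI)
    then have "coeff (pev (shf w (lead_coeff (scl f))) x) k = 0"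
      using k by (simp add: coeff_sum D_def)
    then show "ev (coeff (shf w (lead_coeff (scl f))) k) x = ev 0 x" by simp
  qed
qed

lemma irreducible_rho:
  assumes "e \<in> E"
  shows "irreducible (\<rho> e)"
proof (rule irreducibleI)
  show "\<rho> e \<noteq> 0" using assms by (rule rho_nonzero)
  have deg: "degree (scl (\<rho> e)) = 1" using rho_nonzero[OF assms] by (simp add: scl_rho)
  show "\<not> \<rho> e dvd 1" using deg degree_scl_unit[OF rho_nonzero[OF assms]] by simp
  fix a b assume ab: "\<rho> e = a * b"
  then have nz: "a \<noteq> 0" "b \<noteq> 0" using rho_nonzero[OF assms] by auto
  then have "degree (scl a) + degree (scl b) = 1" using degree_mult_scl[OF nz] ab deg by simp
  then have "degree (scl a) = 0 \<or> degree (scl b) = 0" by linarith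
  then show "a dvd 1 \<or> b dvd 1" using degree_scl_unit nz by blast
qed

text \<open>The linear forms \<open>\<rho> e\<close> are prime, so they can be taken out one at a
  time. Some of them may be proportional; the exponents \<open>n\<close> exist but are not
  determined by \<open>g\<close>.\<close>

lemma divisor_of_rho_monomial:
  assumes "g dvd (\<Prod>e\<in>E. \<rho> e ^ k e)"
  shows "\<exists>c n. c \<noteq> 0 \<and> g = Cst c * (\<Prod>e\<in>E. \<rho> e ^ n e)"
  using assms
proof (induction "sum k E" arbitrary: g k)
  case 0
  then have "(\<Prod>e\<in>E. \<rho> e ^ k e) = 1" using finE by (auto intro!: prod.neutral)
  then have "g dvd 1" using 0 by simp
  then obtain c where "c \<noteq> 0" "g = Cst c" using unit_iff by blast
  then show ?case by (intro exI[of _ c] exI[of _ "\<lambda>_. 0"]) simp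
next
  case (Suc s)
  then obtain e where e: "e \<in> E" "k e \<noteq> 0" by (metis sum.neutral nat.distinct(1))
  define k' where "k' = k(e := k e - 1)"
  have upd: "(\<Prod>a\<in>E. \<rho> a ^ m a) = \<rho> e * (\<Prod>a\<in>E. \<rho> a ^ (m(e := m e - 1)) a)" if "m e \<noteq> 0" for m
  proof -
    have "(\<Prod>a\<in>E. \<rho> a ^ m a) = \<rho> e ^ m e * (\<Prod>a\<in>E - {e}. \<rho> a ^ m a)"
      using finE e(1) by (rule prod.remove)
    moreover have "(\<Prod>a\<in>E. \<rho> a ^ (m(e := m e - 1)) a) = \<rho> e ^ (m e - 1) * (\<Prod>a\<in>E - {e}. \<rho> a ^ m a)"
      using finE e(1) by (subst prod.remove[of _ e]) (auto intro!: prod.cong)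
    ultimately show ?thesis using that by (simp add: power_eq_if)
  qed
  have sumk: "sum k' E = s"
    using Suc.hyps(2) finE e by (simp add: k'_def sum.remove[of E e])
  have pr: "prime_elem (\<rho> e)" using irreducible_imp_prime[OF irreducible_rho[OF e(1)]] .
  obtain h where h: "(\<Prod>a\<in>E. \<rho> a ^ k a) = g * h" using Suc.prems by auto
  then have gh: "\<rho> e * (\<Prod>a\<in>E. \<rho> a ^ k' a) = g * h" using upd[of k] e(2) by (simp add: k'_def)
  then have "\<rho> e dvd g \<or> \<rho> e dvd h" using pr by (metis dvd_triv_left prime_elem_dvd_multD)
  then show ?case
  proof
    assume "\<rho> e dvd g"
    then obtain g' where g': "g = \<rho> e * g'" by auto
    then have "(\<Prod>a\<in>E. \<rho> a ^ k' a) = g' * h" using gh rho_nonzero[OF e(1)] by (simp add: mult.assoc)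
    then have "g' dvd (\<Prod>a\<in>E. \<rho> a ^ k' a)" by simp
    from Suc.hyps(1)[OF _ this] sumk obtain c n where cn: "c \<noteq> 0" "g' = Cst c * (\<Prod>e\<in>E. \<rho> e ^ n e)" by auto
    have "(\<Prod>a\<in>E. \<rho> a ^ (n(e := n e + 1)) a) = \<rho> e * (\<Prod>a\<in>E. \<rho> a ^ n a)"
      using upd[of "n(e := n e + 1)"] by simp
    then show ?thesis using cn g' by (intro exI[of _ c] exI[of _ "n(e := n e + 1)"]) (simp add: ac_simps)
  next
    assume "\<rho> e dvd h"
    then obtain h' where h': "h = \<rho> e * h'" by auto
    then have "(\<Prod>a\<in>E. \<rho> a ^ k' a) = g * h'" using gh rho_nonzero[OF e(1)] by (simp add: ac_simps)
    then have "g dvd (\<Prod>a\<in>E. \<rho> a ^ k' a)" by simp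
    from Suc.hyps(1)[OF _ this] sumk show ?thesis by auto
  qed
qed

lemma degree_shf_rho_monomial:
  assumes "w \<in> V" "c \<noteq> 0"
  shows "degree (shf w (Cst c * (\<Prod>e\<in>E. \<rho> e ^ n e))) = wt E w n"
proof -
  have "degree (shf w (\<rho> e ^ n e)) = (if w e = 0 then 0 else n e)" if "e \<in> E" for e
    using rho_nonzero[OF that] shf_rho[OF assms(1) that] by (auto simp: degree_power_eq)
  moreover have "shf w (\<rho> e ^ n e) \<noteq> 0" if "e \<in> E" for e
    using rho_nonzero[OF that] by (simp del: shf_simps)
  ultimately have "degree (\<Prod>e\<in>E. shf w (\<rho> e ^ n e)) = wt E w n"
    by (subst degree_prod_eq_sum_degree) (auto simp: wt_alt simp del: shf_simps cong: sum.cong)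
  then show ?thesis using assms(2) by simp
qed

lemma lead_coeff_scl_pull:
  assumes "q \<in> MF E d" "q infp \<noteq> 0"
  shows "lead_coeff (scl (pull q)) = Cst (q infp) * (\<Prod>e\<in>E. \<rho> e ^ d e)"
proof -
  have "(\<Prod>e\<in>E. \<rho> e ^ d e) \<noteq> 0" using finE rho_nonzero by auto
  then have "coeff (scl (pull q)) (sum d E) \<noteq> 0" unfolding coeff_scl_pull[OF assms(1)] using assms(2) by auto
  then have "degree (scl (pull q)) = sum d E"
    using degree_scl_pull[OF assms(1)] le_degree[of "scl (pull q)"] by (metis le_antisym)
  then show ?thesis using coeff_scl_pull[OF assms(1)] by simp
qed

text \<open>The top component is a product of coordinates and already has the largest possible
  growth in every direction. Geometrically, a neighbourhood of \<infinity> meets every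
  stratum.\<close>

lemma degree_shf_pull_infp:
  assumes "q \<in> MF E d" "q infp \<noteq> 0" "w \<in> V"
  shows "degree (shf w (pull q)) = wt E w d"
  using degree_shf_top[of w "pull q"] degree_shf_pull[OF assms(1,3)]
    degree_shf_rho_monomial[OF assms(3,2)] lead_coeff_scl_pull[OF assms(1,2)] by simp

text \<open>The degrees along \<open>w\<close> of the divisors of a form add up, and so do those of their top homogeneous
  components, which are products of coordinates; hence no degree drops on passing to the top
  component.\<close>

lemma degree_shf_divisor:
  assumes q: "q \<in> MF E d" "q infp \<noteq> 0" and g: "g dvd pull q ^ N"
  shows "\<exists>n. \<forall>w\<in>V. degree (shf w g) = wt E w n"
proof -
  let ?Q = "pull q ^ N" and ?top = "\<lambda>f :: 'e mpol. lead_coeff (scl f)"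
  have qN: "(\<lambda>x. q x ^ N) \<in> MF E (\<lambda>e. N * d e)" by (rule MF_power[OF finE q(1)])
  have Q: "?Q = pull (\<lambda>x. q x ^ N)" using pull_power[OF q(1)] by simp
  have Qnz: "?Q \<noteq> 0" using pull_nonzero[OF q infp_in_Y] by simp
  have topQ: "?top ?Q = Cst (q infp ^ N) * (\<Prod>e\<in>E. \<rho> e ^ (N * d e))"
    unfolding Q by (rule lead_coeff_scl_pull[OF qN]) (use q(2) in simp)
  obtain h where h: "?Q = g * h" using g by auto
  have nz: "g \<noteq> 0" "h \<noteq> 0" using Qnz h by auto
  have topm: "?top ?Q = ?top g * ?top h" unfolding h by (simp add: lead_coeff_mult)
  have unit: "Cst (q infp ^ N) dvd (1 :: 'e mpol)" using q(2) unit_iff by (metis power_not_zero)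
  have "?top g dvd ?top ?Q" "?top h dvd ?top ?Q"
    unfolding topm by simp_all
  then have "?top g dvd (\<Prod>e\<in>E. \<rho> e ^ (N * d e))" "?top h dvd (\<Prod>e\<in>E. \<rho> e ^ (N * d e))"
    unfolding topQ using dvd_mult_unit_iff'[OF unit] by blast+
  from this[THEN divisor_of_rho_monomial] obtain a n b m
    where g': "a \<noteq> 0" "?top g = Cst a * (\<Prod>e\<in>E. \<rho> e ^ n e)"
    and h': "b \<noteq> 0" "?top h = Cst b * (\<Prod>e\<in>E. \<rho> e ^ m e)"
    by blast
  have "degree (shf w g) = wt E w n" if w: "w \<in> V" for w
  proof -
    have dg: "degree (shf w (?top g)) = wt E w n" "degree (shf w (?top h)) = wt E w m"
      unfolding g'(2) h'(2) using degree_shf_rho_monomial[OF w] g'(1) h'(1) by auto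
    have "degree (shf w (?top ?Q)) = wt E w (\<lambda>e. N * d e)"
      unfolding topQ using degree_shf_rho_monomial[OF w] q(2) by auto
    moreover have "degree (shf w (?top ?Q)) = degree (shf w (?top g)) + degree (shf w (?top h))"
      unfolding topm shf_simps using nz by (subst degree_mult_eq) auto
    ultimately have 1: "wt E w n + wt E w m = wt E w (\<lambda>e. N * d e)" using dg by simp
    have "degree (shf w ?Q) = degree (shf w g) + degree (shf w h)"
      unfolding h shf_simps using nz by (subst degree_mult_eq) auto
    moreover have "degree (shf w ?Q) \<le> wt E w (\<lambda>e. N * d e)"
      unfolding Q by (rule degree_shf_pull[OF qN w])
    ultimately show ?thesis
      using 1 dg degree_shf_top[of w g] degree_shf_top[of w h] by linarith
  qed
  then show ?thesis by blast
qed

end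


section \<open>From fractions with controlled growth to forms\<close>

context subspace_retraction
begin

lemma wt_int_le_sum_abs: "\<bar>wt E w (m :: 'e \<Rightarrow> int)\<bar> \<le> (\<Sum>e\<in>E. \<bar>m e\<bar>)"
proof -
  have "\<bar>wt E w m\<bar> \<le> (\<Sum>e\<in>{e \<in> E. w e \<noteq> 0}. \<bar>m e\<bar>)"
    unfolding wt_def by (rule sum_abs)
  also have "\<dots> \<le> (\<Sum>e\<in>E. \<bar>m e\<bar>)" by (rule sum_mono2) (use finE in auto)
  finally show ?thesis .
qed

lemma degree_shf_mult: "f \<noteq> 0 \<Longrightarrow> g \<noteq> 0 \<Longrightarrow> degree (shf w (f * g)) = degree (shf w f) + degree (shf w g)"
  by (simp add: degree_mult_eq)

lemma degree_shf_power: "f \<noteq> 0 \<Longrightarrow> degree (shf w (f ^ n)) = n * degree (shf w f)"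
  by (simp add: degree_power_eq)

text \<open>Along the strata on which \<open>q\<close> vanishes identically, the degree of \<open>pull h\<close> is small enough
  because \<open>M\<close> is large.\<close>

lemma twisted_form:
  assumes q: "q \<in> MF E k" "pull q \<noteq> 0" and k: "\<And>e. e \<in> E \<Longrightarrow> k e \<ge> 1"
    and ab: "a dvd pull q ^ N" "b dvd pull q ^ N"
    and deg: "\<And>w. w \<in> V \<Longrightarrow> degree (shf w (pull q)) = wt E w k \<Longrightarrow>
      int (degree (shf w a)) - int (degree (shf w b)) = wt E w m"
    and M: "int M \<ge> int N + int N * int (sum k E) + (\<Sum>e\<in>E. \<bar>m e\<bar>)"
  shows "\<exists>h\<in>MF E (\<lambda>e. nat (int (M * k e) + m e)). pull h * b = pull q ^ M * a"
proof -
  let ?Q = "pull q"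
  \<comment> \<open>As \<open>k e \<ge> 1\<close> and \<open>M\<close> exceeds each
    \<open>\<bar>m e\<bar>\<close>, \<open>nat\<close> truncates nothing here.\<close>
  let ?n = "\<lambda>e. nat (int (M * k e) + m e)"
  have m_le: "\<bar>m e\<bar> \<le> int M" if "e \<in> E" for e
  proof -
    have "\<bar>m e\<bar> \<le> (\<Sum>e\<in>E. \<bar>m e\<bar>)" using that finE by (intro member_le_sum) auto
    moreover have "0 \<le> int N * int (sum k E)" by (intro mult_nonneg_nonneg of_nat_0_le_iff)
    ultimately show ?thesis using M by linarith
  qed
  have pos: "int (M * k e) + m e \<ge> 0" if "e \<in> E" for e
  proof -
    have "int M * 1 \<le> int M * int (k e)" using k[OF that] by (intro mult_left_mono) auto
    then show ?thesis using m_le[OF that] by simp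
  qed
  have wtn: "int (wt E w ?n) = int M * int (wt E w k) + wt E w m" for w
  proof -
    have "int (wt E w ?n) = (\<Sum>e\<in>{e \<in> E. w e \<noteq> 0}. int M * int (k e) + m e)"
      unfolding wt_def of_nat_sum by (rule sum.cong) (use pos in auto)
    then show ?thesis by (simp add: wt_def sum.distrib sum_distrib_left)
  qed
  have "N \<le> M"
  proof -
    have "0 \<le> int N * int (sum k E)" "0 \<le> (\<Sum>e\<in>E. \<bar>m e\<bar>)" by (intro mult_nonneg_nonneg of_nat_0_le_iff sum_nonneg abs_ge_zero)+
    then show ?thesis using M by linarith
  qed
  then have "b dvd ?Q ^ M" using ab(2) le_imp_power_dvd dvd_trans by blast
  then obtain b' where b': "?Q ^ M = b * b'" by auto
  define h where "h = b' * a"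
  have hb: "h * b = ?Q ^ M * a" by (simp add: h_def b' ac_simps)
  have Qnz: "?Q ^ n \<noteq> 0" for n using q(2) by simp
  have nz: "a \<noteq> 0" "b \<noteq> 0" "b' \<noteq> 0" "h \<noteq> 0"
  proof -
    show "a \<noteq> 0" "b \<noteq> 0" using ab q(2) by auto
    show "b' \<noteq> 0" using b' Qnz[of M] by auto
    then show "h \<noteq> 0" using \<open>a \<noteq> 0\<close> by (simp add: h_def)
  qed
  have "rinv h" unfolding h_def
    using rinv_divisor[OF rinv_power[OF rinv_pull[OF q(1)]] Qnz] ab(1) b' by (metis rinv_mult dvd_triv_right)
  have degh: "degree (shf w h) \<le> wt E w ?n" if w: "w \<in> V" for w
  proof -
    have sum: "degree (shf w h) + degree (shf w b) = M * degree (shf w ?Q) + degree (shf w a)"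
      using arg_cong[OF hb, of "\<lambda>f. degree (shf w f)"] nz Qnz q(2)
      by (simp add: degree_shf_mult degree_shf_power del: shf_simps)
    have Qle: "degree (shf w ?Q) \<le> wt E w k" by (rule degree_shf_pull[OF q(1) w])
    show ?thesis
    proof (cases "degree (shf w ?Q) = wt E w k")
      case True
      then have "int (degree (shf w h)) = int M * int (wt E w k) + wt E w m"
        using deg[OF w True] sum by (simp flip: of_nat_mult of_nat_add)
      then show ?thesis using wtn[of w] by linarith
    next
      case False
      \<comment> \<open>Each of the \<open>M\<close> factors \<open>?Q\<close> falls short of its
        bound by at least 1. This total of \<open>M\<close> pays for the degree of \<open>a\<close>,
        at most \<open>N * sum k E\<close>, and for a negative \<open>wt E w m\<close>.\<close>
      then have lt: "int (degree (shf w ?Q)) + 1 \<le> int (wt E w k)" using Qle by simp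
      obtain a' where a': "?Q ^ N = a * a'" using ab(1) by auto
      then have "a' \<noteq> 0" using Qnz[of N] by auto
      then have "degree (shf w a) \<le> N * degree (shf w ?Q)"
        using arg_cong[OF a', of "\<lambda>f. degree (shf w f)"] nz q(2)
        by (simp add: degree_shf_mult degree_shf_power del: shf_simps)
      also have "\<dots> \<le> N * sum k E"
        using Qle by (intro mult_left_mono order.trans[OF Qle]) (auto simp: wt_def finE intro!: sum_mono2)
      finally have "int (degree (shf w a)) \<le> int N * int (sum k E)" by (metis of_nat_mono of_nat_mult)
      moreover have "int M * (int (degree (shf w ?Q)) + 1) \<le> int M * int (wt E w k)"
        using lt by (intro mult_left_mono) auto
      moreover have "- wt E w m \<le> (\<Sum>e\<in>E. \<bar>m e\<bar>)" using wt_int_le_sum_abs[of w m] by linarith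
      moreover have "int (degree (shf w h)) \<le> int M * int (degree (shf w ?Q)) + int (degree (shf w a))"
        using sum by (simp flip: of_nat_mult of_nat_add)
      ultimately have "int (degree (shf w h)) \<le> int M * int (wt E w k) + wt E w m"
        using M by (simp add: distrib_left)
      then show ?thesis using wtn[of w] by linarith
    qed
  qed
  have "\<exists>F\<in>MF E ?n. \<forall>v\<in>V. ev h v = F (affine_embed E v)"
  proof (rule bounded_poly_is_form[OF finE subV rinv_Pol[OF \<open>rinv h\<close>]])
    fix w v j assume "w \<in> V" "v \<in> V" "wt E w ?n < j"
    then have "coeff (shf w h) j = 0" using degh[of w] by (intro coeff_eq_0) simp
    then show "ev (coeff (shf w h) j) v = 0" by simp
  qed
  then obtain F where F: "F \<in> MF E ?n" "\<And>v. v \<in> V \<Longrightarrow> ev h v = F (affine_embed E v)" by blast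
  have "pull F = h"
    using F(2)[OF retr_in] \<open>rinv h\<close> by (intro pull_unique) (simp add: rinv_def pt_def)
  then show ?thesis using F(1) hb by blast
qed

end

section \<open>Cocycles on the matroid Schubert variety\<close>

text \<open>The charts are indexed by points: chart \<open>p\<close> is the set where
  \<open>q p\<close> is nonzero, and \<open>g p p'\<close> turns coordinates in chart
  \<open>p\<close> into those in chart \<open>p'\<close>. Positive \<open>k p\<close> make room for
  a negative twist once \<open>q p\<close> is raised to a power.\<close>

locale regular_cocycle = subspace_retraction E V \<rho>
  for E :: "'e set" and V :: "('e \<Rightarrow> complex) set" and \<rho> :: "'e \<Rightarrow> 'e mpol" +
  fixes k :: "('e \<Rightarrow> P1) \<Rightarrow> 'e \<Rightarrow> nat" and q :: "('e \<Rightarrow> P1) \<Rightarrow> ('e \<Rightarrow> P1) \<Rightarrow> complex"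
    and g :: "('e \<Rightarrow> P1) \<Rightarrow> ('e \<Rightarrow> P1) \<Rightarrow> ('e \<Rightarrow> P1) \<Rightarrow> complex"
  assumes q_MF: "\<And>p. p \<in> Y \<Longrightarrow> q p \<in> MF E (k p)"
    and q_self: "\<And>p. p \<in> Y \<Longrightarrow> q p p \<noteq> 0"
    and k_pos: "\<And>p e. p \<in> Y \<Longrightarrow> e \<in> E \<Longrightarrow> k p e \<ge> 1"
    and g_regular: "\<And>p p'. p \<in> Y \<Longrightarrow> p' \<in> Y \<Longrightarrow> regular_on E {x \<in> Y. q p x \<noteq> 0 \<and> q p' x \<noteq> 0} (g p p')"
    and g_nonzero: "\<And>p p' x. p \<in> Y \<Longrightarrow> p' \<in> Y \<Longrightarrow> x \<in> Y \<Longrightarrow> q p x \<noteq> 0 \<Longrightarrow> q p' x \<noteq> 0 \<Longrightarrow> g p p' x \<noteq> 0"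
    and g_cocycle: "\<And>p p' p'' x. p \<in> Y \<Longrightarrow> p' \<in> Y \<Longrightarrow> p'' \<in> Y \<Longrightarrow> x \<in> Y \<Longrightarrow>
      q p x \<noteq> 0 \<Longrightarrow> q p' x \<noteq> 0 \<Longrightarrow> q p'' x \<noteq> 0 \<Longrightarrow> g p p'' x = g p p' x * g p' p'' x"
begin

text \<open>\<open>f\<close> equals the rational function \<open>a / b\<close> on a nonempty open
  subset of \<open>V\<close>, which is all that can be asked of a function with irrelevant values
  off its domain.\<close>

definition repr :: "(('e \<Rightarrow> P1) \<Rightarrow> complex) \<Rightarrow> 'e mpol \<Rightarrow> 'e mpol \<Rightarrow> bool" where
  "repr f a b \<longleftrightarrow> (\<exists>R. R \<noteq> 0 \<and> (\<forall>x. ev R x \<noteq> 0 \<longrightarrow> ev b x \<noteq> 0 \<and> f (pt x) = ev a x / ev b x))"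

lemma pull_q_nonzero: "p \<in> Y \<Longrightarrow> pull (q p) \<noteq> 0"
  using pull_nonzero[OF q_MF q_self] by blast

lemma local_fraction:
  assumes p: "p \<in> Y" "p' \<in> Y" and y: "y \<in> Y" "q p y \<noteq> 0" "q p' y \<noteq> 0"
  obtains d F G where "F \<in> MF E d" "G \<in> MF E d" "F y \<noteq> 0" "G y \<noteq> 0" "g p p' y = F y / G y"
    "repr (g p p') (pull F) (pull G)"
proof -
  let ?W = "{x \<in> Y. q p x \<noteq> 0 \<and> q p' x \<noteq> 0}"
  obtain d F G d' r where *: "F \<in> MF E d" "G \<in> MF E d" "r \<in> MF E d'" "r y \<noteq> 0"
    "\<forall>x\<in>?W. r x \<noteq> 0 \<longrightarrow> G x \<noteq> 0 \<and> g p p' x = F x / G x"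
    by (rule regular_onE[OF finE g_regular[OF p], of y]) (use y Y_subset in auto)
  have gy: "G y \<noteq> 0" "g p p' y = F y / G y" using * y by auto
  then have "F y \<noteq> 0" using g_nonzero[OF p y] by auto
  moreover have "repr (g p p') (pull F) (pull G)"
    unfolding repr_def
  proof (intro exI[of _ "pull (q p) * pull (q p') * pull r"] conjI allI impI)
    show "pull (q p) * pull (q p') * pull r \<noteq> 0"
      using pull_q_nonzero[OF p(1)] pull_q_nonzero[OF p(2)] pull_nonzero[OF *(3,4) y(1)] by simp
    fix x assume "ev (pull (q p) * pull (q p') * pull r) x \<noteq> 0"
    then have "q p (pt x) \<noteq> 0" "q p' (pt x) \<noteq> 0" "r (pt x) \<noteq> 0"
      using ev_pull[OF q_MF[OF p(1)]] ev_pull[OF q_MF[OF p(2)]] ev_pull[OF *(3)] by auto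
    then show "ev (pull G) x \<noteq> 0" "g p p' (pt x) = ev (pull F) x / ev (pull G) x"
      using *(5) pt_in_Y ev_pull[OF *(1)] ev_pull[OF *(2)] by auto
  qed
  ultimately show ?thesis using that[OF *(1,2)] gy by blast
qed

text \<open>The cocycle identity holds where the product \<open>R\<close> of all denominators and
  chart forms is nonzero; multiplying by \<open>R\<close> makes it a polynomial identity, and
  \<open>R\<close> cancels.\<close>

lemma repr_cocycle:
  assumes p: "p \<in> Y" "p' \<in> Y" "p'' \<in> Y"
    and r: "repr (g p p'') a b" "repr (g p' p'') a' b'" "repr (g p p') c d"
  shows "a * b' * d = a' * b * c"
proof -
  obtain R1 where R1: "R1 \<noteq> 0" "\<And>x. ev R1 x \<noteq> 0 \<Longrightarrow> ev b x \<noteq> 0 \<and> g p p'' (pt x) = ev a x / ev b x"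
    using r(1) unfolding repr_def by blast
  obtain R2 where R2: "R2 \<noteq> 0" "\<And>x. ev R2 x \<noteq> 0 \<Longrightarrow> ev b' x \<noteq> 0 \<and> g p' p'' (pt x) = ev a' x / ev b' x"
    using r(2) unfolding repr_def by blast
  obtain R3 where R3: "R3 \<noteq> 0" "\<And>x. ev R3 x \<noteq> 0 \<Longrightarrow> ev d x \<noteq> 0 \<and> g p p' (pt x) = ev c x / ev d x"
    using r(3) unfolding repr_def by blast
  define R where "R = R1 * R2 * R3 * pull (q p) * pull (q p') * pull (q p'')"
  have "R \<noteq> 0" unfolding R_def using R1(1) R2(1) R3(1) p pull_q_nonzero by simp
  have "R * (a * b' * d - a' * b * c) = 0"
  proof (rule mpol_eqI)
    fix x
    show "ev (R * (a * b' * d - a' * b * c)) x = ev 0 x"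
    proof (cases "ev R x = 0")
      case False
      then have "ev R1 x \<noteq> 0" "ev R2 x \<noteq> 0" "ev R3 x \<noteq> 0" "q p (pt x) \<noteq> 0" "q p' (pt x) \<noteq> 0" "q p'' (pt x) \<noteq> 0"
        using ev_pull[OF q_MF[OF p(1)]] ev_pull[OF q_MF[OF p(2)]] ev_pull[OF q_MF[OF p(3)]]
        by (auto simp: R_def)
      then show ?thesis
        using R1(2)[of x] R2(2)[of x] R3(2)[of x] g_cocycle[OF p pt_in_Y[of x]]
        by (auto simp: field_simps)
    qed simp
  qed
  then show ?thesis using \<open>R \<noteq> 0\<close> by simp
qed

text \<open>\<open>A p / B p\<close> is the frame at \<open>p\<close> measured by the frame at
  \<infinity>. The cocycle identity turns each transition function into a quotient of two such
  fractions, and at \<infinity> itself the fraction is 1.\<close>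

lemma rational_trivialisation:
  obtains A B where "\<And>p. p \<in> Y \<Longrightarrow> A p \<noteq> 0 \<and> B p \<noteq> 0" "A infp = B infp"
    "\<And>p p' y. p \<in> Y \<Longrightarrow> p' \<in> Y \<Longrightarrow> y \<in> Y \<Longrightarrow> q p y \<noteq> 0 \<Longrightarrow> q p' y \<noteq> 0 \<Longrightarrow>
      \<exists>d. \<exists>F\<in>MF E d. \<exists>G\<in>MF E d. F y \<noteq> 0 \<and> G y \<noteq> 0 \<and> g p p' y = F y / G y \<and>
        A p * B p' * pull G = A p' * B p * pull F"
proof -
  have "\<exists>a b. a \<noteq> 0 \<and> b \<noteq> 0 \<and> repr (g p infp) a b" if p: "p \<in> Y" for p
  proof -
    have "pull (q p) * pull (q infp) \<noteq> 0" using p infp_in_Y pull_q_nonzero by simp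
    then obtain x where "ev (pull (q p) * pull (q infp)) x \<noteq> 0" by (rule mpol_nonzero_point)
    then have x: "q p (pt x) \<noteq> 0" "q infp (pt x) \<noteq> 0"
      using ev_pull[OF q_MF[OF p]] ev_pull[OF q_MF[OF infp_in_Y]] by auto
    obtain d F G where "F \<in> MF E d" "G \<in> MF E d" "F (pt x) \<noteq> 0" "G (pt x) \<noteq> 0"
      "g p infp (pt x) = F (pt x) / G (pt x)" "repr (g p infp) (pull F) (pull G)"
      by (rule local_fraction[OF p infp_in_Y pt_in_Y x])
    then show ?thesis using pull_nonzero pt_in_Y by blast
  qed
  then have "\<forall>p. \<exists>a b. p \<in> Y \<longrightarrow> a \<noteq> 0 \<and> b \<noteq> 0 \<and> repr (g p infp) a b" by blast
  then obtain A B where AB: "\<And>p. p \<in> Y \<Longrightarrow> A p \<noteq> 0 \<and> B p \<noteq> 0 \<and> repr (g p infp) (A p) (B p)"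
    by metis
  have "A infp * B infp * B infp = A infp * B infp * A infp"
    using repr_cocycle[OF infp_in_Y infp_in_Y infp_in_Y] AB[OF infp_in_Y] by blast
  then have eq: "A infp = B infp" using AB[OF infp_in_Y] by simp
  show ?thesis
  proof (rule that[of A B])
    fix p p' y assume *: "p \<in> Y" "p' \<in> Y" "y \<in> Y" "q p y \<noteq> 0" "q p' y \<noteq> 0"
    obtain d F G where FG: "F \<in> MF E d" "G \<in> MF E d" "F y \<noteq> 0" "G y \<noteq> 0" "g p p' y = F y / G y"
      "repr (g p p') (pull F) (pull G)"
      by (rule local_fraction[OF *])
    then show "\<exists>d. \<exists>F\<in>MF E d. \<exists>G\<in>MF E d. F y \<noteq> 0 \<and> G y \<noteq> 0 \<and> g p p' y = F y / G y \<and>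
        A p * B p' * pull G = A p' * B p * pull F"
      using repr_cocycle[OF *(1,2) infp_in_Y] AB[OF *(1)] AB[OF *(2)] by blast
  qed (use AB eq in auto)
qed

theorem cocycle_is_twist:
  obtains m :: "'e \<Rightarrow> int" and M :: "('e \<Rightarrow> P1) \<Rightarrow> nat" and H
  where "\<And>p e. p \<in> Y \<Longrightarrow> e \<in> E \<Longrightarrow> int (M p * k p e) + m e \<ge> 0"
    "\<And>p. p \<in> Y \<Longrightarrow> H p \<in> MF E (\<lambda>e. nat (int (M p * k p e) + m e))"
    "\<And>p y. p \<in> Y \<Longrightarrow> y \<in> Y \<Longrightarrow> q p y \<noteq> 0 \<Longrightarrow> H p y \<noteq> 0"
    "\<And>p p' y. p \<in> Y \<Longrightarrow> p' \<in> Y \<Longrightarrow> y \<in> Y \<Longrightarrow> q p y \<noteq> 0 \<Longrightarrow> q p' y \<noteq> 0 \<Longrightarrow>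
      g p p' y * (H p' y / q p' y ^ M p') = H p y / q p y ^ M p"
proof -
  obtain A B where AB0: "\<And>p. p \<in> Y \<Longrightarrow> A p \<noteq> 0 \<and> B p \<noteq> 0" and ABinf: "A infp = B infp"
    and coc: "\<And>p p' y. p \<in> Y \<Longrightarrow> p' \<in> Y \<Longrightarrow> y \<in> Y \<Longrightarrow> q p y \<noteq> 0 \<Longrightarrow> q p' y \<noteq> 0 \<Longrightarrow>
      \<exists>d. \<exists>F\<in>MF E d. \<exists>G\<in>MF E d. F y \<noteq> 0 \<and> G y \<noteq> 0 \<and> g p p' y = F y / G y \<and>
        A p * B p' * pull G = A p' * B p * pull F"
    using rational_trivialisation by blast
  define Q where "Q p = pull (q p)" for p
  have Q0: "Q p \<noteq> 0" if "p \<in> Y" for p unfolding Q_def by (rule pull_q_nonzero[OF that])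
  have evQ: "ev (Q p) x = q p (pt x)" if "p \<in> Y" for p x
    unfolding Q_def by (rule ev_pull[OF q_MF[OF that]])
  define vo where "vo P p = int (multiplicity P (A p)) - int (multiplicity P (B p))" for P p
  \<comment> \<open>At a point of the divisor lying in both charts the transition function is a
    quotient of forms nonzero there, so it contributes no order along \<open>P\<close>.\<close>
  have vo_eq: "vo P p = vo P p'" if P: "prime P" and p: "p \<in> Y" "p' \<in> Y" and nd: "\<not> P dvd Q p" "\<not> P dvd Q p'"
    for P p p'
  proof -
    have "\<not> P dvd Q p * Q p'" using P nd prime_dvd_multD by blast
    then obtain x where x: "ev P x = 0" "ev (Q p * Q p') x \<noteq> 0"
      using prime_nullstellensatz P prime_imp_prime_elem by blast
    then obtain d F G where FG: "F \<in> MF E d" "G \<in> MF E d" "F (pt x) \<noteq> 0" "G (pt x) \<noteq> 0"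
      "A p * B p' * pull G = A p' * B p * pull F"
      using coc[OF p pt_in_Y[of x]] evQ p by auto
    have nF: "\<not> P dvd pull F" "\<not> P dvd pull G"
      using x(1) FG(3,4) ev_pull[OF FG(1), of x] ev_pull[OF FG(2), of x] by (auto elim!: dvdE)
    then have "pull F \<noteq> 0" "pull G \<noteq> 0" by auto
    then have "multiplicity P (A p) + multiplicity P (B p') = multiplicity P (A p') + multiplicity P (B p)"
      using arg_cong[OF FG(5), of "multiplicity P"] AB0[OF p(1)] AB0[OF p(2)] P nF
      by (simp add: prime_elem_multiplicity_mult_distrib not_dvd_imp_multiplicity_0)
    then show ?thesis unfolding vo_def by linarith
  qed
  \<comment> \<open>The chart at any zero of \<open>P\<close> meets the divisor of
    \<open>P\<close>.\<close>
  have ex: "\<exists>p\<in>Y. \<not> P dvd Q p" if P: "prime P" for P :: "'e mpol"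
  proof -
    obtain x where "ev P x = 0" using prime_elem_root[OF prime_imp_prime_elem[OF P]] by blast
    then have "\<not> P dvd Q (pt x)" using evQ[OF pt_in_Y, of x x] q_self[OF pt_in_Y, of x] by (auto elim!: dvdE)
    then show ?thesis using pt_in_Y by blast
  qed
  define n where "n P = vo P (SOME p. p \<in> Y \<and> \<not> P dvd Q p)" for P
  have n_eq: "n P = vo P p" if "prime P" "p \<in> Y" "\<not> P dvd Q p" for P p
  proof -
    have "\<exists>p. p \<in> Y \<and> \<not> P dvd Q p" using ex[OF that(1)] by blast
    from someI_ex[OF this] show ?thesis unfolding n_def using vo_eq that by blast
  qed
  \<comment> \<open>\<open>C / D\<close> times the frame at \<infinity> is to be the section without
    zeros and poles on \<open>V\<close>, so \<open>C / D\<close> must have order \<open>n P\<close>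
    along every \<open>P\<close>.\<close>
  obtain C N0 D where CD: "C dvd Q infp ^ N0" "D dvd Q infp ^ N0"
    and CDn: "\<And>P. prime P \<Longrightarrow> int (multiplicity P C) - int (multiplicity P D) = (if P dvd Q infp then n P else 0)"
    using exists_fraction_with_multiplicities[OF Q0[OF infp_in_Y], of n] by blast
  have CD0: "C \<noteq> 0" "D \<noteq> 0" using CD Q0[OF infp_in_Y] by auto
  \<comment> \<open>Primes not dividing \<open>Q infp\<close> meet the chart at \<infinity>, where
    the fraction is 1 and \<open>n P\<close> is therefore 0.\<close>
  have CDn': "int (multiplicity P C) - int (multiplicity P D) = n P" if P: "prime P" for P
    using CDn[OF P] n_eq[OF P infp_in_Y] by (auto simp: vo_def ABinf)
  obtain nC nD where nC: "\<And>w. w \<in> V \<Longrightarrow> degree (shf w C) = wt E w nC"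
    and nD: "\<And>w. w \<in> V \<Longrightarrow> degree (shf w D) = wt E w nD"
    using degree_shf_divisor[OF q_MF[OF infp_in_Y] q_self[OF infp_in_Y]] CD unfolding Q_def by metis
  \<comment> \<open>The growth of \<open>D / C\<close>. Both parts divide a power of a form that is
    nonzero at \<infinity>, so each grows like a product of coordinates.\<close>
  define m where "m e = int (nD e) - int (nC e)" for e
  have wtm: "wt E w m = int (degree (shf w D)) - int (degree (shf w C))" if "w \<in> V" for w
    unfolding nC[OF that] nD[OF that] wt_def m_def by (simp add: sum_subtractf)
  \<comment> \<open>Full growth of \<open>Q p\<close> gives a point \<open>lm x w\<close> at which
    \<open>q p\<close> and \<open>q infp\<close> are both nonzero. Near it the transition function
    is a quotient of nonvanishing forms of one multidegree, so \<open>A p / B p\<close> does not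
    grow.\<close>
  have deg_AB: "degree (shf w (A p)) = degree (shf w (B p))"
    if p: "p \<in> Y" and w: "w \<in> V" and full: "degree (shf w (Q p)) = wt E w (k p)" for p w
  proof -
    have "coeff (shf w (Q p)) (wt E w (k p)) \<noteq> 0"
      using full Q0[OF p] by (metis leading_coeff_0_iff shf_eq_0_iff)
    moreover have "coeff (shf w (Q infp)) (wt E w (k infp)) \<noteq> 0"
      using degree_shf_pull_infp[OF q_MF[OF infp_in_Y] q_self[OF infp_in_Y] w] Q0[OF infp_in_Y]
      unfolding Q_def by (metis leading_coeff_0_iff shf_eq_0_iff)
    ultimately have "coeff (shf w (Q p)) (wt E w (k p)) * coeff (shf w (Q infp)) (wt E w (k infp)) \<noteq> 0"
      by simp
    then obtain x where
      "ev (coeff (shf w (Q p)) (wt E w (k p)) * coeff (shf w (Q infp)) (wt E w (k infp))) x \<noteq> 0"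
      by (rule mpol_nonzero_point)
    then have "q p (lm x w) \<noteq> 0" "q infp (lm x w) \<noteq> 0"
      unfolding Q_def by (auto simp: coeff_shf_pull[OF q_MF[OF p] w] coeff_shf_pull[OF q_MF[OF infp_in_Y] w])
    then obtain d F G where FG: "F \<in> MF E d" "G \<in> MF E d" "F (lm x w) \<noteq> 0" "G (lm x w) \<noteq> 0"
      "A p * B infp * pull G = A infp * B p * pull F"
      using coc[OF p infp_in_Y lm_in_Y[OF w]] by metis
    then have "A p * pull G = B p * pull F"
      using ABinf AB0[OF infp_in_Y] by (simp add: ac_simps)
    moreover have "pull F \<noteq> 0" "pull G \<noteq> 0" using FG lm_in_Y[OF w] pull_nonzero by blast+
    ultimately have "degree (shf w (A p)) + degree (shf w (pull G)) = degree (shf w (B p)) + degree (shf w (pull F))"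
      using AB0[OF p] by (metis degree_shf_mult)
    then show ?thesis
      using degree_shf_pull_eq[OF FG(1) w FG(3)] degree_shf_pull_eq[OF FG(2) w FG(4)] by simp
  qed
  have main: "\<exists>M H. (\<forall>e\<in>E. int (M * k p e) + m e \<ge> 0) \<and> H \<in> MF E (\<lambda>e. nat (int (M * k p e) + m e)) \<and>
      (\<forall>y\<in>Y. q p y \<noteq> 0 \<longrightarrow> H y \<noteq> 0) \<and> pull H * (B p * C) = Q p ^ M * (A p * D)" if p: "p \<in> Y" for p
  proof -
    \<comment> \<open>The function \<open>\<phi> p\<close> of the overview is
      \<open>A p * D / (B p * C)\<close>; it has order 0 along the primes meeting chart
      \<open>p\<close>, and \<open>a / b\<close> is its form with controlled numerator and
      denominator.\<close>
    have "multiplicity P (A p * D) = multiplicity P (B p * C)" if P: "prime P" "\<not> P dvd Q p" for P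
      using CDn'[OF P(1)] n_eq[OF P(1) p P(2)] AB0[OF p] CD0 P(1)
      by (simp add: prime_elem_multiplicity_mult_distrib vo_def)
    then obtain a b N where ab: "a dvd Q p ^ N" "b dvd Q p ^ N" and abeq: "A p * D * b = B p * C * a"
      using balanced_fraction[OF Q0[OF p], of "A p * D" "B p * C"] AB0[OF p] CD0 by (metis mult_eq_0_iff)
    have ab0: "a \<noteq> 0" "b \<noteq> 0" using ab Q0[OF p] by auto
    have degab: "int (degree (shf w a)) - int (degree (shf w b)) = wt E w m"
      if w: "w \<in> V" "degree (shf w (Q p)) = wt E w (k p)" for w
    proof -
      have "degree (shf w (A p)) + degree (shf w D) + degree (shf w b) =
          degree (shf w (B p)) + degree (shf w C) + degree (shf w a)"
        using arg_cong[OF abeq, of "\<lambda>f. degree (shf w f)"] AB0[OF p] CD0 ab0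
        by (simp add: degree_shf_mult del: shf_simps)
      then show ?thesis using deg_AB[OF p w] wtm[OF w(1)] by linarith
    qed
    \<comment> \<open>The bound demanded by \<open>twisted_form\<close>. It contains
      \<open>m\<close> only through absolute values, so the same \<open>M\<close> serves for the
      opposite twist.\<close>
    define M where "M = nat (int N + int N * int (sum (k p) E) + (\<Sum>e\<in>E. \<bar>m e\<bar>))"
    have M: "int M = int N + int N * int (sum (k p) E) + (\<Sum>e\<in>E. \<bar>m e\<bar>)"
      unfolding M_def by (intro nat_0_le add_nonneg_nonneg sum_nonneg mult_nonneg_nonneg of_nat_0_le_iff abs_ge_zero)
    have m_le: "\<bar>m e\<bar> \<le> int (M * k p e)" if e: "e \<in> E" for e
    proof -
      have "\<bar>m e\<bar> \<le> (\<Sum>e\<in>E. \<bar>m e\<bar>)" using e finE by (intro member_le_sum) auto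
      also have "\<dots> \<le> int M"
      proof -
        have "0 \<le> int N * int (sum (k p) E)" by (intro mult_nonneg_nonneg of_nat_0_le_iff)
        then show ?thesis unfolding M by linarith
      qed
      also have "int M = int M * 1" by simp
      also have "\<dots> \<le> int M * int (k p e)" using k_pos[OF p e] by (intro mult_left_mono) auto
      finally show ?thesis by simp
    qed
    have "\<exists>h\<in>MF E (\<lambda>e. nat (int (M * k p e) + m e)). pull h * b = pull (q p) ^ M * a"
      by (rule twisted_form[OF q_MF[OF p] pull_q_nonzero[OF p] k_pos[OF p] ab[unfolded Q_def]])
        (use degab M in \<open>simp_all only: Q_def order.refl\<close>)
    then obtain h where h: "h \<in> MF E (\<lambda>e. nat (int (M * k p e) + m e))" "pull h * b = Q p ^ M * a"
      unfolding Q_def by blast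
    \<comment> \<open>The inverse fraction has the opposite twist. Its form \<open>h'\<close>
      multiplies with \<open>h\<close> to \<open>q p ^ (2 * M)\<close>, so \<open>h\<close> can
      vanish only where \<open>q p\<close> does.\<close>
    have degba: "int (degree (shf w b)) - int (degree (shf w a)) = wt E w (\<lambda>e. - m e)"
      if w: "w \<in> V" "degree (shf w (Q p)) = wt E w (k p)" for w
      using degab[OF w] unfolding wt_def by (simp add: sum_negf)
    have "\<exists>h\<in>MF E (\<lambda>e. nat (int (M * k p e) + - m e)). pull h * a = pull (q p) ^ M * b"
      by (rule twisted_form[OF q_MF[OF p] pull_q_nonzero[OF p] k_pos[OF p] ab(2,1)[unfolded Q_def]])
        (use degba M in \<open>simp_all only: Q_def abs_minus_cancel order.refl\<close>)
    then obtain h' where h': "h' \<in> MF E (\<lambda>e. nat (int (M * k p e) + - m e))" "pull h' * a = Q p ^ M * b"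
      unfolding Q_def by blast
    have hh: "(\<lambda>x. h x * h' x) \<in> MF E (\<lambda>e. (2 * M) * k p e)"
    proof -
      have eq: "MF E (\<lambda>e. nat (int (M * k p e) + m e) + nat (int (M * k p e) + - m e)) =
          MF E (\<lambda>e. (2 * M) * k p e)"
      proof (rule MF_cong)
        fix e assume "e \<in> E"
        from m_le[OF this] show "nat (int (M * k p e) + m e) + nat (int (M * k p e) + - m e) = (2 * M) * k p e"
          by (simp add: nat_add_distrib[symmetric] flip: of_nat_mult)
      qed
      show ?thesis using MF_mult[OF finE h(1) h'(1)] unfolding eq .
    qed
    have "(pull h * pull h') * (a * b) = (pull h * b) * (pull h' * a)" by (simp add: ac_simps)
    also have "\<dots> = Q p ^ (2 * M) * (a * b)" unfolding h(2) h'(2) mult_2 power_add by (simp only: ac_simps)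
    finally have "pull h * pull h' = Q p ^ (2 * M)" using ab0 by simp
    then have "pull (\<lambda>x. h x * h' x) = pull (\<lambda>x. q p x ^ (2 * M))"
      using pull_mult[OF h(1) h'(1)] pull_power[OF q_MF[OF p]] by (simp add: Q_def)
    from pull_eq_imp_eq_on_Y[OF hh MF_power[OF finE q_MF[OF p]] this]
    have "h y * h' y = q p y ^ (2 * M)" if "y \<in> Y" for y using that by simp
    then have hnz: "h y \<noteq> 0" if "y \<in> Y" "q p y \<noteq> 0" for y
      using that by (metis mult_zero_left power_not_zero)
    have "pull h * (B p * C) * b = (pull h * b) * (B p * C)" by (simp add: ac_simps)
    also have "\<dots> = Q p ^ M * (B p * C * a)" unfolding h(2) by (simp add: ac_simps)
    also have "\<dots> = Q p ^ M * (A p * D) * b" unfolding abeq[symmetric] by (simp add: ac_simps)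
    finally have "pull h * (B p * C) = Q p ^ M * (A p * D)" using ab0 by simp
    moreover have "int (M * k p e) + m e \<ge> 0" if "e \<in> E" for e using m_le[OF that] by linarith
    ultimately show ?thesis using h(1) hnz by blast
  qed
  have "\<forall>p. \<exists>M H. p \<in> Y \<longrightarrow> (\<forall>e\<in>E. int (M * k p e) + m e \<ge> 0) \<and> H \<in> MF E (\<lambda>e. nat (int (M * k p e) + m e)) \<and>
      (\<forall>y\<in>Y. q p y \<noteq> 0 \<longrightarrow> H y \<noteq> 0) \<and> pull H * (B p * C) = Q p ^ M * (A p * D)"
    using main by blast
  from choice[OF this] obtain M where
    "\<forall>p. \<exists>H. p \<in> Y \<longrightarrow> (\<forall>e\<in>E. int (M p * k p e) + m e \<ge> 0) \<and>
      H \<in> MF E (\<lambda>e. nat (int (M p * k p e) + m e)) \<and>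
      (\<forall>y\<in>Y. q p y \<noteq> 0 \<longrightarrow> H y \<noteq> 0) \<and> pull H * (B p * C) = Q p ^ M p * (A p * D)"
    by blast
  from choice[OF this] obtain H where MH: "\<And>p. p \<in> Y \<Longrightarrow> (\<forall>e\<in>E. int (M p * k p e) + m e \<ge> 0) \<and>
      H p \<in> MF E (\<lambda>e. nat (int (M p * k p e) + m e)) \<and>
      (\<forall>y\<in>Y. q p y \<noteq> 0 \<longrightarrow> H p y \<noteq> 0) \<and> pull (H p) * (B p * C) = Q p ^ M p * (A p * D)"
    by blast
  show ?thesis
  proof (rule that[of M m H])
    fix p p' y assume *: "p \<in> Y" "p' \<in> Y" "y \<in> Y" "q p y \<noteq> 0" "q p' y \<noteq> 0"
    obtain d F G where FG: "F \<in> MF E d" "G \<in> MF E d" "G y \<noteq> 0" "g p p' y = F y / G y"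
      "A p * B p' * pull G = A p' * B p * pull F"
      using coc[OF *] by blast
    note Hp = MH[OF *(1)] and Hp' = MH[OF *(2)]
    let ?d = "\<lambda>p e. nat (int (M p * k p e) + m e)"
    have H1: "H p \<in> MF E (?d p)" and H2: "H p' \<in> MF E (?d p')" using Hp Hp' by blast+
    have q1: "(\<lambda>x. q p x ^ M p) \<in> MF E (\<lambda>e. M p * k p e)" and q2: "(\<lambda>x. q p' x ^ M p') \<in> MF E (\<lambda>e. M p' * k p' e)"
      using MF_power[OF finE q_MF] * by blast+
    have L: "(\<lambda>x. F x * (H p' x * q p x ^ M p)) \<in> MF E (\<lambda>e. d e + (?d p' e + M p * k p e))"
      by (intro MF_mult finE FG(1) H2 q1)
    have R: "(\<lambda>x. G x * (H p x * q p' x ^ M p')) \<in> MF E (\<lambda>e. d e + (?d p e + M p' * k p' e))"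
      by (intro MF_mult finE FG(2) H1 q2)
    \<comment> \<open>Two forms can be compared on \<open>Y\<close> only in one multidegree. Both
      sides have \<open>d e + M p * k p e + M p' * k p' e + m e\<close>, as no \<open>nat\<close>
      truncates.\<close>
    have R': "(\<lambda>x. G x * (H p x * q p' x ^ M p')) \<in> MF E (\<lambda>e. d e + (?d p' e + M p * k p e))"
    proof -
      have eq: "MF E (\<lambda>e. d e + (?d p e + M p' * k p' e)) = MF E (\<lambda>e. d e + (?d p' e + M p * k p e))"
      proof (rule MF_cong)
        fix e assume "e \<in> E"
        then have "int (M p * k p e) + m e \<ge> 0" "int (M p' * k p' e) + m e \<ge> 0" using Hp Hp' by blast+
        then show "d e + (?d p e + M p' * k p' e) = d e + (?d p' e + M p * k p e)"
          by linarith
      qed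
      show ?thesis using R unfolding eq .
    qed
    have e1: "pull (\<lambda>x. F x * (H p' x * q p x ^ M p)) * (B p' * C * B p) =
        (pull F * A p' * B p) * (Q p ^ M p * Q p' ^ M p' * D)"
    proof -
      have "pull (\<lambda>x. F x * (H p' x * q p x ^ M p)) = pull F * (pull (H p') * Q p ^ M p)"
        unfolding Q_def pull_mult[OF FG(1) MF_mult[OF finE H2 q1]] pull_mult[OF H2 q1] pull_power[OF q_MF[OF *(1)]] ..
      then have "pull (\<lambda>x. F x * (H p' x * q p x ^ M p)) * (B p' * C * B p) =
          pull F * Q p ^ M p * B p * (pull (H p') * (B p' * C))"
        by (simp only: ac_simps)
      also have "\<dots> = (pull F * A p' * B p) * (Q p ^ M p * Q p' ^ M p' * D)"
        using Hp' by (simp only: ac_simps)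
      finally show ?thesis .
    qed
    have e2: "pull (\<lambda>x. G x * (H p x * q p' x ^ M p')) * (B p' * C * B p) =
        (pull G * A p * B p') * (Q p ^ M p * Q p' ^ M p' * D)"
    proof -
      have "pull (\<lambda>x. G x * (H p x * q p' x ^ M p')) = pull G * (pull (H p) * Q p' ^ M p')"
        unfolding Q_def pull_mult[OF FG(2) MF_mult[OF finE H1 q2]] pull_mult[OF H1 q2] pull_power[OF q_MF[OF *(2)]] ..
      then have "pull (\<lambda>x. G x * (H p x * q p' x ^ M p')) * (B p' * C * B p) =
          pull G * Q p' ^ M p' * B p' * (pull (H p) * (B p * C))"
        by (simp only: ac_simps)
      also have "\<dots> = (pull G * A p * B p') * (Q p ^ M p * Q p' ^ M p' * D)"
        using Hp by (simp only: ac_simps)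
      finally show ?thesis .
    qed
    have e3: "pull F * A p' * B p = pull G * A p * B p'" using FG(5) by (simp only: ac_simps)
    have "B p' * C * B p \<noteq> 0" using AB0[OF *(1)] AB0[OF *(2)] CD0 by simp
    moreover have "pull (\<lambda>x. F x * (H p' x * q p x ^ M p)) * (B p' * C * B p) =
        pull (\<lambda>x. G x * (H p x * q p' x ^ M p')) * (B p' * C * B p)"
      unfolding e1 e2 e3 ..
    ultimately have "pull (\<lambda>x. F x * (H p' x * q p x ^ M p)) = pull (\<lambda>x. G x * (H p x * q p' x ^ M p'))"
      by (rule iffD1[OF mult_right_cancel])
    from pull_eq_imp_eq_on_Y[OF L R' this *(3)]
    have "G y * (g p p' y * H p' y * q p y ^ M p) = G y * (H p y * q p' y ^ M p')"
      using FG(3,4) by (simp add: mult.assoc)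
    then have "g p p' y * H p' y * q p y ^ M p = H p y * q p' y ^ M p'" using FG(3) by simp
    then show "g p p' y * (H p' y / q p' y ^ M p') = H p y / q p y ^ M p"
      using *(4,5) by (simp add: frac_eq_eq)
  qed (use MH in blast)+
qed

end


section \<open>The line bundles of given multidegree on the product\<close>

lemma exists_form_nonzero:
  assumes "finite E"
  shows "\<exists>F\<in>MF E d. F p \<noteq> 0"
proof
  let ?F = "hmonom E d (\<lambda>e. if hcoord0 (p e) = 0 then 0 else d e)"
  show "?F \<in> MF E d" by (rule MF_hmonom[OF assms]) simp
  have "hcoord0 (p e) = 0 \<Longrightarrow> hcoord1 (p e) \<noteq> 0" for e by (cases "p e") auto
  then show "?F p \<noteq> 0" using assms by (auto simp: hmonom_def)
qed

text \<open>\<open>F / G\<close> is a nowhere vanishing local section of multidegree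
  \<open>m\<close>. A quotient is needed because \<open>m\<close> may have negative entries.\<close>

definition twist_chart :: "'e set \<Rightarrow> (('e \<Rightarrow> P1) \<Rightarrow> complex) \<Rightarrow> (('e \<Rightarrow> P1) \<Rightarrow> complex) \<Rightarrow>
    ('e \<Rightarrow> P1) set \<times> (('e \<Rightarrow> P1) \<times> complex \<Rightarrow> complex)" where
  "twist_chart E F G = ({x \<in> P1_power E. F x \<noteq> 0 \<and> G x \<noteq> 0}, \<lambda>l. snd l * (G (fst l) / F (fst l)))"

definition form_pairs where
  "form_pairs E m = {(F, G). \<exists>d d'. F \<in> MF E d \<and> G \<in> MF E d' \<and> (\<forall>e\<in>E. int (d e) - int (d' e) = m e)}"

text \<open>A point \<open>(x, c)\<close> of the total space is the value \<open>c\<close> of a section of multidegree \<open>m\<close> at the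
  normalised homogeneous coordinates of \<open>x\<close>; dividing by a quotient of forms of that multidegree
  makes it independent of the normalisation.\<close>

definition twist_bundle :: "'e set \<Rightarrow> ('e \<Rightarrow> int) \<Rightarrow> 'e P1_power_bundle" where
  "twist_bundle E m =
     \<lparr>total = P1_power E \<times> UNIV, proj = fst, fadd = (\<lambda>l l'. (fst l, snd l + snd l')),
      fscale = (\<lambda>a l. (fst l, a * snd l)), atlas = (\<lambda>(F, G). twist_chart E F G) ` form_pairs E m\<rparr>"

lemma form_pairs_quotient_regular:
  assumes "finite E" "(F, G) \<in> form_pairs E m" "(F', G') \<in> form_pairs E m"
    and "\<And>x. x \<in> W \<Longrightarrow> G x \<noteq> 0 \<and> F' x \<noteq> 0" "W \<subseteq> P1_power E"
  shows "regular_on E W (\<lambda>x. (F x * G' x) / (F' x * G x))"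
proof -
  obtain d d' where 1: "F \<in> MF E d" "G \<in> MF E d'" "\<forall>e\<in>E. int (d e) - int (d' e) = m e"
    using assms(2) unfolding form_pairs_def by blast
  obtain k k' where 2: "F' \<in> MF E k" "G' \<in> MF E k'" "\<forall>e\<in>E. int (k e) - int (k' e) = m e"
    using assms(3) unfolding form_pairs_def by blast
  have eq: "MF E (\<lambda>e. k e + d' e) = MF E (\<lambda>e. d e + k' e)"
  proof (rule MF_cong)
    fix e assume "e \<in> E"
    then have "int (d e) - int (d' e) = m e" "int (k e) - int (k' e) = m e" using 1(3) 2(3) by blast+
    then show "k e + d' e = d e + k' e" by linarith
  qed
  have den: "(\<lambda>x. F' x * G x) \<in> MF E (\<lambda>e. d e + k' e)"
    using MF_mult[OF assms(1) 2(1) 1(2)] unfolding eq .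
  show ?thesis
    by (rule regular_on_quotient[OF MF_mult[OF assms(1) 1(1) 2(2)] den _ assms(5)]) (use assms(4) in simp)
qed

lemma fibre_twist: "x \<in> P1_power E \<Longrightarrow> fibre (twist_bundle E m) x = {x} \<times> UNIV"
  by (auto simp: fibre_def twist_bundle_def)

lemma line_bundle_twist:
  assumes "finite E"
  shows "line_bundle E (P1_power E) (twist_bundle E m)"
proof -
  have cover: "\<exists>c\<in>form_pairs E m. x \<in> fst ((\<lambda>(F, G). twist_chart E F G) c)" if "x \<in> P1_power E" for x
  proof -
    \<comment> \<open>The positive part of \<open>m\<close> goes into the numerator, the negative
      part into the denominator.\<close>
    obtain F where F: "F \<in> MF E (\<lambda>e. nat (m e))" "F x \<noteq> 0" using exists_form_nonzero[OF assms] by blast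
    obtain G where G: "G \<in> MF E (\<lambda>e. nat (- m e))" "G x \<noteq> 0" using exists_form_nonzero[OF assms] by blast
    have "(F, G) \<in> form_pairs E m"
      unfolding form_pairs_def
      by (intro CollectI case_prodI exI[of _ "\<lambda>e. nat (m e)"] exI[of _ "\<lambda>e. nat (- m e)"] conjI F(1) G(1)) auto
    moreover have "x \<in> fst (twist_chart E F G)" using that F(2) G(2) by (simp add: twist_chart_def)
    ultimately show ?thesis by (intro bexI[of _ "(F, G)"]) auto
  qed
  have triv: "local_trivialisation E (P1_power E) (twist_bundle E m) W \<phi>"
    if FG: "(F, G) \<in> form_pairs E m" and W\<phi>: "(W, \<phi>) = twist_chart E F G" for W \<phi> F G
  proof -
    have W: "W = {x \<in> P1_power E. F x \<noteq> 0 \<and> G x \<noteq> 0}" and \<phi>: "\<phi> = (\<lambda>l. snd l * (G (fst l) / F (fst l)))"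
      using W\<phi> by (auto simp: twist_chart_def)
    obtain d d' where "F \<in> MF E d" "G \<in> MF E d'" using FG unfolding form_pairs_def by blast
    then have "openin (zariski E) {x \<in> P1_power E. F x * G x \<noteq> 0}"
      by (rule openin_nonvanishing[OF MF_mult[OF assms]])
    moreover have "{x \<in> P1_power E. F x * G x \<noteq> 0} = W" unfolding W by auto
    ultimately have "openin (subtopology (zariski E) (P1_power E)) W"
      by (metis subtopology_topspace topspace_zariski)
    moreover have "bij_betw \<phi> (fibre (twist_bundle E m) x) UNIV" if x: "x \<in> W" for x
    proof -
      have xP: "x \<in> P1_power E" using x by (simp add: W)
      show ?thesis unfolding fibre_twist[OF xP]
        by (rule bij_betw_byWitness[where f' = "\<lambda>c. (x, c * (F x / G x))"])
          (use x in \<open>auto simp: \<phi> W\<close>)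
    qed
    ultimately show ?thesis
      unfolding local_trivialisation_def
      by (auto simp: fibre_def twist_bundle_def \<phi> W algebra_simps add_divide_distrib)
  qed
  have trans: "\<exists>g. regular_on E (W \<inter> W') g \<and> (\<forall>x\<in>W \<inter> W'. \<forall>l\<in>fibre (twist_bundle E m) x. \<phi>' l = g x * \<phi> l)"
    if FG: "(F, G) \<in> form_pairs E m" and W\<phi>: "(W, \<phi>) = twist_chart E F G"
      and FG': "(F', G') \<in> form_pairs E m" and W\<phi>': "(W', \<phi>') = twist_chart E F' G'" for W \<phi> F G W' \<phi>' F' G'
  proof (intro exI conjI)
    have W: "W = {x \<in> P1_power E. F x \<noteq> 0 \<and> G x \<noteq> 0}" and \<phi>: "\<phi> = (\<lambda>l. snd l * (G (fst l) / F (fst l)))"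
      and W': "W' = {x \<in> P1_power E. F' x \<noteq> 0 \<and> G' x \<noteq> 0}" and \<phi>': "\<phi>' = (\<lambda>l. snd l * (G' (fst l) / F' (fst l)))"
      using W\<phi> W\<phi>' by (auto simp: twist_chart_def)
    show "regular_on E (W \<inter> W') (\<lambda>x. (F x * G' x) / (F' x * G x))"
      by (rule form_pairs_quotient_regular[OF assms FG FG']) (auto simp: W W')
    show "\<forall>x\<in>W \<inter> W'. \<forall>l\<in>fibre (twist_bundle E m) x. \<phi>' l = (F x * G' x) / (F' x * G x) * \<phi> l"
      by (auto simp: W W' \<phi> \<phi>' fibre_twist)
  qed
  have at: "atlas (twist_bundle E m) = (\<lambda>(F, G). twist_chart E F G) ` form_pairs E m"
    by (simp add: twist_bundle_def)
  have "\<forall>(W, \<phi>)\<in>atlas (twist_bundle E m). local_trivialisation E (P1_power E) (twist_bundle E m) W \<phi>"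
    unfolding at using triv by (auto split: prod.splits)
  moreover have "\<forall>(W, \<phi>)\<in>atlas (twist_bundle E m). \<forall>(W', \<phi>')\<in>atlas (twist_bundle E m).
      \<exists>g. regular_on E (W \<inter> W') g \<and> (\<forall>x\<in>W \<inter> W'. \<forall>l\<in>fibre (twist_bundle E m) x. \<phi>' l = g x * \<phi> l)"
  proof (intro ballI, clarify)
    fix W \<phi> W' \<phi>'
    assume "(W, \<phi>) \<in> atlas (twist_bundle E m)" "(W', \<phi>') \<in> atlas (twist_bundle E m)"
    then obtain F G F' G' where "(F, G) \<in> form_pairs E m" "(W, \<phi>) = twist_chart E F G"
      "(F', G') \<in> form_pairs E m" "(W', \<phi>') = twist_chart E F' G'"
      unfolding at by (auto split: prod.splits)
    then show "\<exists>g. regular_on E (W \<inter> W') g \<and> (\<forall>x\<in>W \<inter> W'. \<forall>l\<in>fibre (twist_bundle E m) x. \<phi>' l = g x * \<phi> l)"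
      by (rule trans)
  qed
  moreover have "(\<Union>(W, \<phi>)\<in>atlas (twist_bundle E m). W) = P1_power E"
  proof
    show "(\<Union>(W, \<phi>)\<in>atlas (twist_bundle E m). W) \<subseteq> P1_power E"
      unfolding at by (auto simp: twist_chart_def)
    show "P1_power E \<subseteq> (\<Union>(W, \<phi>)\<in>atlas (twist_bundle E m). W)"
      using cover unfolding at by (fastforce simp: twist_chart_def)
  qed
  ultimately show ?thesis
    unfolding line_bundle_def by (auto simp: fibre_def twist_bundle_def)
qed


section \<open>Recognising a twist\<close>

lemma fibre_restrict: "y \<in> Y \<Longrightarrow> fibre (restrict_bundle L Y) y = fibre L y"
  by (auto simp: fibre_def restrict_bundle_def)

text \<open>A global fibrewise linear coordinate \<open>\<kappa>\<close> that behaves like a section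
  value of multidegree \<open>m\<close> gives the isomorphism sending \<open>l\<close> to
  \<open>(proj L l, \<kappa> l)\<close>.\<close>

lemma isomorphic_to_twist:
  fixes L :: "('e, 'l) line_bundle_data"
  assumes E: "finite E" and Y: "Y \<subseteq> P1_power E" and L: "line_bundle E Y L"
    and bij: "\<And>y. y \<in> Y \<Longrightarrow> bij_betw \<kappa> (fibre L y) UNIV"
    and add: "\<And>y l l'. y \<in> Y \<Longrightarrow> l \<in> fibre L y \<Longrightarrow> l' \<in> fibre L y \<Longrightarrow> \<kappa> (fadd L l l') = \<kappa> l + \<kappa> l'"
    and scale: "\<And>y l a. y \<in> Y \<Longrightarrow> l \<in> fibre L y \<Longrightarrow> \<kappa> (fscale L a l) = a * \<kappa> l"
    and reg: "\<And>W \<phi> F G. (W, \<phi>) \<in> atlas L \<Longrightarrow> (F, G) \<in> form_pairs E m \<Longrightarrow>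
      \<exists>g. regular_on E {x \<in> W. F x \<noteq> 0 \<and> G x \<noteq> 0} g \<and>
        (\<forall>x\<in>W. F x \<noteq> 0 \<longrightarrow> G x \<noteq> 0 \<longrightarrow> (\<forall>l\<in>fibre L x. \<kappa> l * (G x / F x) = g x * \<phi> l))"
  shows "line_bundle_isomorphic E Y L (restrict_bundle (twist_bundle E m) Y)"
proof -
  let ?R = "restrict_bundle (twist_bundle E m) Y"
  have fibR: "fibre ?R y = {y} \<times> UNIV" if "y \<in> Y" for y
    using that Y fibre_restrict[OF that, of "twist_bundle E m"] fibre_twist[of y E m] by blast
  have Rops: "fadd ?R = (\<lambda>l l'. (fst l, snd l + snd l'))" "fscale ?R = (\<lambda>a l. (fst l, a * snd l))"
    "proj ?R = fst" "total ?R = Y \<times> UNIV"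
    using Y by (auto simp: restrict_bundle_def twist_bundle_def)
  have atR: "\<exists>F G. (F, G) \<in> form_pairs E m \<and> W = {x \<in> Y. F x \<noteq> 0 \<and> G x \<noteq> 0} \<and>
      \<psi> = (\<lambda>l. snd l * (G (fst l) / F (fst l)))" if "(W, \<psi>) \<in> atlas ?R" for W \<psi>
    using that Y unfolding restrict_bundle_def twist_bundle_def twist_chart_def by auto
  have WY: "W \<subseteq> Y" if "(W, \<phi>) \<in> atlas L" for W \<phi>
    using L that unfolding line_bundle_def by blast
  have totL: "l \<in> total L \<Longrightarrow> proj L l \<in> Y \<and> l \<in> fibre L (proj L l)" for l
    using L unfolding line_bundle_def fibre_def by auto
  have Lclosed: "y \<in> Y \<Longrightarrow> l \<in> fibre L y \<Longrightarrow> l' \<in> fibre L y \<Longrightarrow> fadd L l l' \<in> fibre L y"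
    "y \<in> Y \<Longrightarrow> l \<in> fibre L y \<Longrightarrow> fscale L a l \<in> fibre L y" for y l l' a
    using L unfolding line_bundle_def by blast+
  define h where "h l = (proj L l, \<kappa> l)" for l
  define j where "j z = inv_into (fibre L (fst z)) \<kappa> (snd z)" for z
  have h_fib: "l \<in> fibre L y \<Longrightarrow> h l = (y, \<kappa> l)" for l y
    by (simp add: h_def fibre_def)
  have j_fib: "j (y, c) \<in> fibre L y" "\<kappa> (j (y, c)) = c" if "y \<in> Y" for y c
    using bij[OF that] unfolding j_def
    by (auto simp: bij_betw_def intro!: inv_into_into f_inv_into_f)
  have j_eq: "j (y, c) = l" if "y \<in> Y" "l \<in> fibre L y" "\<kappa> l = c" for y c l
    using bij[OF that(1)] that(2,3) unfolding j_def by (auto simp: bij_betw_def intro: inv_into_f_eq)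
  have "line_bundle_hom E Y L ?R h"
    unfolding line_bundle_hom_def
  proof (intro conjI ballI allI)
    fix y assume y: "y \<in> Y"
    show "h ` fibre L y \<subseteq> fibre ?R y" using h_fib fibR[OF y] by auto
    show "h (fadd L l l') = fadd ?R (h l) (h l')" if "l \<in> fibre L y" "l' \<in> fibre L y" for l l'
      using h_fib[OF Lclosed(1)[OF y that]] h_fib[OF that(1)] h_fib[OF that(2)] add[OF y that] by (simp add: Rops)
    show "h (fscale L a l) = fscale ?R a (h l)" if "l \<in> fibre L y" for l a
      using h_fib[OF Lclosed(2)[OF y that]] h_fib[OF that] scale[OF y that] by (simp add: Rops)
  next
    fix c assume c: "c \<in> atlas L"
    obtain W \<phi> where c_eq: "c = (W, \<phi>)" by (cases c)
    show "case c of (W, \<phi>) \<Rightarrow> \<forall>(W', \<psi>)\<in>atlas ?R.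
        \<exists>g. regular_on E (W \<inter> W') g \<and> (\<forall>x\<in>W \<inter> W'. \<forall>l\<in>fibre L x. \<psi> (h l) = g x * \<phi> l)"
      unfolding c_eq case_prod_conv
    proof (rule ballI)
      fix c' assume c': "c' \<in> atlas ?R"
      obtain W' \<psi> where cs: "c = (W, \<phi>)" "c' = (W', \<psi>)" using c_eq by (cases c')
      obtain F G where FG: "(F, G) \<in> form_pairs E m" "W' = {x \<in> Y. F x \<noteq> 0 \<and> G x \<noteq> 0}"
        "\<psi> = (\<lambda>l. snd l * (G (fst l) / F (fst l)))"
        using atR c' cs(2) by blast
      have WW: "W \<inter> W' = {x \<in> W. F x \<noteq> 0 \<and> G x \<noteq> 0}" using WY c cs(1) FG(2) by auto
      obtain g where g: "regular_on E (W \<inter> W') g"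
        "\<forall>x\<in>W. F x \<noteq> 0 \<longrightarrow> G x \<noteq> 0 \<longrightarrow> (\<forall>l\<in>fibre L x. \<kappa> l * (G x / F x) = g x * \<phi> l)"
        using reg[OF c[unfolded cs(1)] FG(1)] unfolding WW by blast
      have "\<forall>x\<in>W \<inter> W'. \<forall>l\<in>fibre L x. \<psi> (h l) = g x * \<phi> l"
        using g(2) h_fib unfolding WW FG(3) by auto
      then show "case c' of (W', \<psi>) \<Rightarrow>
          \<exists>g. regular_on E (W \<inter> W') g \<and> (\<forall>x\<in>W \<inter> W'. \<forall>l\<in>fibre L x. \<psi> (h l) = g x * \<phi> l)"
        using g(1) cs by auto
    qed
  qed
  moreover have "line_bundle_hom E Y ?R L j"
    unfolding line_bundle_hom_def
  proof (intro conjI ballI allI)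
    fix y assume y: "y \<in> Y"
    show "j ` fibre ?R y \<subseteq> fibre L y" using j_fib[OF y] fibR[OF y] by auto
    show "j (fadd ?R z z') = fadd L (j z) (j z')" if "z \<in> fibre ?R y" "z' \<in> fibre ?R y" for z z'
    proof -
      obtain c c' where z: "z = (y, c)" "z' = (y, c')" using \<open>z \<in> _\<close> \<open>z' \<in> _\<close> fibR[OF y] by auto
      show ?thesis unfolding z Rops fst_conv snd_conv
        by (rule j_eq[OF y Lclosed(1)[OF y]]) (use add[OF y] j_fib[OF y] in auto)
    qed
    show "j (fscale ?R a z) = fscale L a (j z)" if "z \<in> fibre ?R y" for z a
    proof -
      obtain c where z: "z = (y, c)" using \<open>z \<in> _\<close> fibR[OF y] by auto
      show ?thesis unfolding z Rops fst_conv snd_conv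
        by (rule j_eq[OF y Lclosed(2)[OF y]]) (use scale[OF y] j_fib[OF y] in auto)
    qed
  next
    fix c' assume c': "c' \<in> atlas ?R"
    obtain W' \<psi> where c'_eq: "c' = (W', \<psi>)" by (cases c')
    show "case c' of (W', \<psi>) \<Rightarrow> \<forall>(W, \<phi>)\<in>atlas L.
        \<exists>g. regular_on E (W' \<inter> W) g \<and> (\<forall>x\<in>W' \<inter> W. \<forall>z\<in>fibre ?R x. \<phi> (j z) = g x * \<psi> z)"
      unfolding c'_eq case_prod_conv
    proof (rule ballI)
      fix c assume c: "c \<in> atlas L"
      obtain W \<phi> where cs: "c = (W, \<phi>)" "c' = (W', \<psi>)" using c'_eq by (cases c)
      obtain F G where FG: "(F, G) \<in> form_pairs E m" "W' = {x \<in> Y. F x \<noteq> 0 \<and> G x \<noteq> 0}"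
        "\<psi> = (\<lambda>l. snd l * (G (fst l) / F (fst l)))"
        using atR c' cs(2) by blast
      have WW: "W \<inter> W' = {x \<in> W. F x \<noteq> 0 \<and> G x \<noteq> 0}" using WY c cs(1) FG(2) by auto
      obtain g where g: "regular_on E (W \<inter> W') g"
        "\<forall>x\<in>W. F x \<noteq> 0 \<longrightarrow> G x \<noteq> 0 \<longrightarrow> (\<forall>l\<in>fibre L x. \<kappa> l * (G x / F x) = g x * \<phi> l)"
        using reg[OF c[unfolded cs(1)] FG(1)] unfolding WW by blast
      have key: "b * (G x / F x) = g x * \<phi> (j (x, b))" if "x \<in> W \<inter> W'" for x b
      proof -
        have "x \<in> Y" using that FG(2) by auto
        moreover have "x \<in> W" "F x \<noteq> 0" "G x \<noteq> 0" using that unfolding WW by auto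
        ultimately have "\<kappa> (j (x, b)) * (G x / F x) = g x * \<phi> (j (x, b))"
          using g(2) j_fib(1)[of x b] by blast
        then show ?thesis using j_fib(2)[OF \<open>x \<in> Y\<close>, of b] by simp
      qed
      \<comment> \<open>Every value of \<open>\<kappa>\<close> is attained, in particular 1; so
        \<open>g\<close> has no zeros and the inverse map is regular too.\<close>
      have nz: "g x \<noteq> 0" if "x \<in> W \<inter> W'" for x
        using key[OF that, of 1] that unfolding WW by auto
      have "regular_on E (W \<inter> W') (\<lambda>x. inverse (g x))"
        by (rule regular_on_inverse[OF E g(1) _ nz]) (use WY c cs(1) Y in auto)
      moreover have "\<phi> (j z) = inverse (g x) * \<psi> z" if xz: "x \<in> W \<inter> W'" "z \<in> fibre ?R x" for x z
      proof -
        have "x \<in> Y" using xz(1) FG(2) by auto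
        then obtain b where z: "z = (x, b)" using xz(2) fibR by auto
        show ?thesis using key[OF xz(1), of b] nz[OF xz(1)] unfolding z FG(3) by (simp add: field_simps)
      qed
      ultimately show "case c of (W, \<phi>) \<Rightarrow>
          \<exists>g. regular_on E (W' \<inter> W) g \<and> (\<forall>x\<in>W' \<inter> W. \<forall>z\<in>fibre ?R x. \<phi> (j z) = g x * \<psi> z)"
        unfolding cs case_prod_conv Int_commute[of W'] by (intro exI[of _ "\<lambda>x. inverse (g x)"]) auto
    qed
  qed
  moreover have "j (h l) = l" if "l \<in> total L" for l
    using totL[OF that] by (simp add: h_def j_eq)
  moreover have "h (j z) = z" if zR: "z \<in> total ?R" for z
  proof -
    obtain y c where z: "z = (y, c)" "y \<in> Y" using zR unfolding Rops by auto
    show ?thesis using h_fib[OF j_fib(1)[OF z(2)], of c] j_fib(2)[OF z(2), of c] z(1) by simp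
  qed
  ultimately show ?thesis unfolding line_bundle_isomorphic_def by blast
qed


lemma line_bundleD:
  assumes "line_bundle E X L"
  shows line_bundle_trivialisation: "(W, \<phi>) \<in> atlas L \<Longrightarrow> local_trivialisation E X L W \<phi>"
    and line_bundle_transition: "(W, \<phi>) \<in> atlas L \<Longrightarrow> (W', \<phi>') \<in> atlas L \<Longrightarrow>
      \<exists>g. regular_on E (W \<inter> W') g \<and> (\<forall>x\<in>W \<inter> W'. \<forall>l\<in>fibre L x. \<phi>' l = g x * \<phi> l)"
    and line_bundle_chart_subset: "(W, \<phi>) \<in> atlas L \<Longrightarrow> W \<subseteq> X"
    and line_bundle_add_closed: "x \<in> X \<Longrightarrow> l \<in> fibre L x \<Longrightarrow> l' \<in> fibre L x \<Longrightarrow> fadd L l l' \<in> fibre L x"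
    and line_bundle_scale_closed: "x \<in> X \<Longrightarrow> l \<in> fibre L x \<Longrightarrow> fscale L a l \<in> fibre L x"
proof -
  have t: "\<forall>(W, \<phi>)\<in>atlas L. local_trivialisation E X L W \<phi>"
    and u: "\<forall>(W, \<phi>)\<in>atlas L. \<forall>(W', \<phi>')\<in>atlas L.
        \<exists>g. regular_on E (W \<inter> W') g \<and> (\<forall>x\<in>W \<inter> W'. \<forall>l\<in>fibre L x. \<phi>' l = g x * \<phi> l)"
    and v: "(\<Union>(W, \<phi>)\<in>atlas L. W) = X"
    and a: "\<forall>x\<in>X. \<forall>l\<in>fibre L x. \<forall>m\<in>fibre L x. fadd L l m \<in> fibre L x"
    and b: "\<forall>x\<in>X. \<forall>a. \<forall>l\<in>fibre L x. fscale L a l \<in> fibre L x"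
    using assms unfolding line_bundle_def by - (elim conjE, assumption)+
  show "(W, \<phi>) \<in> atlas L \<Longrightarrow> local_trivialisation E X L W \<phi>"
    using t by (auto dest: bspec)
  show "(W, \<phi>) \<in> atlas L \<Longrightarrow> (W', \<phi>') \<in> atlas L \<Longrightarrow>
      \<exists>g. regular_on E (W \<inter> W') g \<and> (\<forall>x\<in>W \<inter> W'. \<forall>l\<in>fibre L x. \<phi>' l = g x * \<phi> l)"
    using bspec[OF u, of "(W, \<phi>)"] by (auto dest: bspec)
  show "(W, \<phi>) \<in> atlas L \<Longrightarrow> W \<subseteq> X"
    using v by auto
  show "x \<in> X \<Longrightarrow> l \<in> fibre L x \<Longrightarrow> l' \<in> fibre L x \<Longrightarrow> fadd L l l' \<in> fibre L x"
    "x \<in> X \<Longrightarrow> l \<in> fibre L x \<Longrightarrow> fscale L a l \<in> fibre L x"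
    using a b by blast+
qed

section \<open>From a line bundle to its cocycle\<close>

context subspace_retraction
begin

lemma chart_at:
  assumes "line_bundle E Y L" "p \<in> Y"
  shows "\<exists>c. \<exists>k q. c \<in> atlas L \<and> q \<in> MF E k \<and> q p \<noteq> 0 \<and> (\<forall>e\<in>E. k e \<ge> 1) \<and> (\<forall>x\<in>Y. q x \<noteq> 0 \<longrightarrow> x \<in> fst c)"
proof -
  have "p \<in> (\<Union>(W, \<phi>)\<in>atlas L. W)" using assms unfolding line_bundle_def by blast
  then obtain W \<phi> where c: "(W, \<phi>) \<in> atlas L" "p \<in> W" by auto
  then have "local_trivialisation E Y L W \<phi>" using line_bundle_trivialisation[OF assms(1)] by blast
  then have "openin (subtopology (zariski E) Y) W" unfolding local_trivialisation_def by blast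
  then obtain U where U: "openin (zariski E) U" "W = U \<inter> Y" unfolding openin_subtopology by blast
  have "p \<in> U" using c(2) U(2) by blast
  obtain d F where F: "F \<in> MF E d" "F p \<noteq> 0" "{x \<in> P1_power E. F x \<noteq> 0} \<subseteq> U"
    by (rule zariski_basis[OF finE U(1) \<open>p \<in> U\<close>])
  \<comment> \<open>Multiplying by a form of multidegree 1 in every coordinate makes all
    \<open>k e\<close> positive.\<close>
  obtain G where G: "G \<in> MF E (\<lambda>_. 1)" "G p \<noteq> 0" using exists_form_nonzero[OF finE] by blast
  show ?thesis
  proof (intro exI conjI)
    show "(W, \<phi>) \<in> atlas L" by fact
    show "(\<lambda>x. F x * G x) \<in> MF E (\<lambda>e. d e + 1)" by (rule MF_mult[OF finE F(1) G(1)])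
    show "F p * G p \<noteq> 0" using F(2) G(2) by simp
    show "\<forall>x\<in>Y. F x * G x \<noteq> 0 \<longrightarrow> x \<in> fst (W, \<phi>)" using F(3) U(2) Y_subset by auto
  qed simp
qed

theorem line_bundle_is_twist:
  assumes L: "line_bundle E Y L"
  shows "\<exists>m. line_bundle_isomorphic E Y L (restrict_bundle (twist_bundle E m) Y)"
proof -
  have "\<forall>p. \<exists>c k q. p \<in> Y \<longrightarrow> c \<in> atlas L \<and> q \<in> MF E k \<and> q p \<noteq> 0 \<and> (\<forall>e\<in>E. k e \<ge> 1) \<and>
      (\<forall>x\<in>Y. q x \<noteq> 0 \<longrightarrow> x \<in> fst c)"
    using chart_at[OF L] by blast
  from choice[OF this] obtain c where "\<forall>p. \<exists>k q. p \<in> Y \<longrightarrow> c p \<in> atlas L \<and> q \<in> MF E k \<and> q p \<noteq> 0 \<and>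
      (\<forall>e\<in>E. k e \<ge> 1) \<and> (\<forall>x\<in>Y. q x \<noteq> 0 \<longrightarrow> x \<in> fst (c p))" by blast
  from choice[OF this] obtain k where "\<forall>p. \<exists>q. p \<in> Y \<longrightarrow> c p \<in> atlas L \<and> q \<in> MF E (k p) \<and> q p \<noteq> 0 \<and>
      (\<forall>e\<in>E. k p e \<ge> 1) \<and> (\<forall>x\<in>Y. q x \<noteq> 0 \<longrightarrow> x \<in> fst (c p))" by blast
  from choice[OF this] obtain q where "\<forall>p. p \<in> Y \<longrightarrow> c p \<in> atlas L \<and> q p \<in> MF E (k p) \<and> q p p \<noteq> 0 \<and>
      (\<forall>e\<in>E. k p e \<ge> 1) \<and> (\<forall>x\<in>Y. q p x \<noteq> 0 \<longrightarrow> x \<in> fst (c p))" by blast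
  then have cp: "c p \<in> atlas L" and q: "q p \<in> MF E (k p)" "q p p \<noteq> 0" and kp: "\<And>e. e \<in> E \<Longrightarrow> k p e \<ge> 1"
    and qW: "\<And>x. x \<in> Y \<Longrightarrow> q p x \<noteq> 0 \<Longrightarrow> x \<in> fst (c p)" if "p \<in> Y" for p
    using that by blast+
  define \<phi> where "\<phi> p = snd (c p)" for p
  have at: "(fst (c p), \<phi> p) \<in> atlas L" if "p \<in> Y" for p using cp[OF that] by (simp add: \<phi>_def)
  have triv: "bij_betw \<psi> (fibre L x) UNIV"
    "\<And>l l'. l \<in> fibre L x \<Longrightarrow> l' \<in> fibre L x \<Longrightarrow> \<psi> (fadd L l l') = \<psi> l + \<psi> l'"
    "\<And>a l. l \<in> fibre L x \<Longrightarrow> \<psi> (fscale L a l) = a * \<psi> l" if "(W, \<psi>) \<in> atlas L" "x \<in> W" for W \<psi> x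
  proof -
    have "local_trivialisation E Y L W \<psi>" by (rule line_bundle_trivialisation[OF L that(1)])
    then show "bij_betw \<psi> (fibre L x) UNIV"
      "\<And>l l'. l \<in> fibre L x \<Longrightarrow> l' \<in> fibre L x \<Longrightarrow> \<psi> (fadd L l l') = \<psi> l + \<psi> l'"
      "\<And>a l. l \<in> fibre L x \<Longrightarrow> \<psi> (fscale L a l) = a * \<psi> l"
      using that(2) unfolding local_trivialisation_def by blast+
  qed
  note scale_closed = line_bundle_scale_closed[OF L] and WY = line_bundle_chart_subset[OF L]
    and trans = line_bundle_transition[OF L]
  have unit_vector: "\<exists>l\<in>fibre L x. \<psi> l = 1" if "(W, \<psi>) \<in> atlas L" "x \<in> W" for W \<psi> x
    using triv(1)[OF that] unfolding bij_betw_def by (metis UNIV_I imageE)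
  \<comment> \<open>The zero vector is available as \<open>fscale L 0 l\<close>. A vector with
    coordinate 0 in one chart equals it by injectivity, hence has coordinate 0 in every
    chart.\<close>
  have nonzero: "\<psi>' l \<noteq> 0" if "(W, \<psi>) \<in> atlas L" "(W', \<psi>') \<in> atlas L" "x \<in> W" "x \<in> W'" "l \<in> fibre L x" "\<psi> l = 1"
    for W \<psi> W' \<psi>' x l
  proof
    assume "\<psi>' l = 0"
    then have "\<psi>' (fscale L 0 l) = \<psi>' l" using triv(3)[OF that(2,4,5), of 0] by simp
    moreover have "fscale L 0 l \<in> fibre L x" using scale_closed that(5) WY[OF that(1)] that(3) by blast
    ultimately have "fscale L 0 l = l" using triv(1)[OF that(2,4)] that(5) unfolding bij_betw_def inj_on_def by blast
    then show False using triv(3)[OF that(1,3,5), of 0] that(6) by simp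
  qed
  have "\<forall>p. \<exists>f. \<forall>p'. p \<in> Y \<and> p' \<in> Y \<longrightarrow> regular_on E (fst (c p) \<inter> fst (c p')) (f p') \<and>
      (\<forall>x\<in>fst (c p) \<inter> fst (c p'). \<forall>l\<in>fibre L x. \<phi> p' l = f p' x * \<phi> p l)"
  proof
    fix p
    have "\<forall>p'. \<exists>f. p \<in> Y \<and> p' \<in> Y \<longrightarrow> regular_on E (fst (c p) \<inter> fst (c p')) f \<and>
      (\<forall>x\<in>fst (c p) \<inter> fst (c p'). \<forall>l\<in>fibre L x. \<phi> p' l = f x * \<phi> p l)"
      using trans[OF at at] by blast
    from choice[OF this] show "\<exists>f. \<forall>p'. p \<in> Y \<and> p' \<in> Y \<longrightarrow> regular_on E (fst (c p) \<inter> fst (c p')) (f p') \<and>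
      (\<forall>x\<in>fst (c p) \<inter> fst (c p'). \<forall>l\<in>fibre L x. \<phi> p' l = f p' x * \<phi> p l)" .
  qed
  from choice[OF this] obtain g where g: "\<And>p p'. p \<in> Y \<Longrightarrow> p' \<in> Y \<Longrightarrow> regular_on E (fst (c p) \<inter> fst (c p')) (g p p')"
    "\<And>p p' x l. p \<in> Y \<Longrightarrow> p' \<in> Y \<Longrightarrow> x \<in> fst (c p) \<Longrightarrow> x \<in> fst (c p') \<Longrightarrow> l \<in> fibre L x \<Longrightarrow>
      \<phi> p' l = g p p' x * \<phi> p l"
    by blast
  interpret regular_cocycle E V \<rho> k q g
  proof
    fix p assume p: "p \<in> Y"
    show "q p \<in> MF E (k p)" "q p p \<noteq> 0" using q[OF p] by blast+
    show "k p e \<ge> 1" if "e \<in> E" for e using kp[OF p that] .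
    fix p' assume p': "p' \<in> Y"
    show "regular_on E {x \<in> Y. q p x \<noteq> 0 \<and> q p' x \<noteq> 0} (g p p')"
      by (rule regular_on_subset[OF g(1)[OF p p']]) (use qW p p' in blast)
    show "g p p' x \<noteq> 0" if x: "x \<in> Y" "q p x \<noteq> 0" "q p' x \<noteq> 0" for x
    proof -
      have W: "x \<in> fst (c p)" "x \<in> fst (c p')" using qW p p' x by blast+
      obtain l where l: "l \<in> fibre L x" "\<phi> p l = 1" using unit_vector[OF at[OF p] W(1)] by blast
      show ?thesis using nonzero[OF at[OF p] at[OF p'] W l] g(2)[OF p p' W l(1)] by auto
    qed
    fix p'' x assume p'': "p'' \<in> Y" and x: "x \<in> Y" "q p x \<noteq> 0" "q p' x \<noteq> 0" "q p'' x \<noteq> 0"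
    have W: "x \<in> fst (c p)" "x \<in> fst (c p')" "x \<in> fst (c p'')" using qW p p' p'' x by blast+
    obtain l where l: "l \<in> fibre L x" "\<phi> p l = 1" using unit_vector[OF at[OF p] W(1)] by blast
    show "g p p'' x = g p p' x * g p' p'' x"
      using g(2)[OF p p' W(1,2) l(1)] g(2)[OF p p'' W(1,3) l(1)] g(2)[OF p' p'' W(2,3) l(1)] l(2) by (simp add: mult.commute)
  qed
  show ?thesis
  proof (rule cocycle_is_twist)
    fix m M H
    assume MH: "\<And>p e. p \<in> Y \<Longrightarrow> e \<in> E \<Longrightarrow> int (M p * k p e) + m e \<ge> 0"
      and H: "\<And>p. p \<in> Y \<Longrightarrow> H p \<in> MF E (\<lambda>e. nat (int (M p * k p e) + m e))"
      and Hnz: "\<And>p y. p \<in> Y \<Longrightarrow> y \<in> Y \<Longrightarrow> q p y \<noteq> 0 \<Longrightarrow> H p y \<noteq> 0"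
      and gH: "\<And>p p' y. p \<in> Y \<Longrightarrow> p' \<in> Y \<Longrightarrow> y \<in> Y \<Longrightarrow> q p y \<noteq> 0 \<Longrightarrow> q p' y \<noteq> 0 \<Longrightarrow>
        g p p' y * (H p' y / q p' y ^ M p') = H p y / q p y ^ M p"
    \<comment> \<open>The coordinate in the chart at the base point of \<open>l\<close>, corrected
      by \<open>H / q ^ M\<close>. By \<open>gH\<close> every other chart around that point gives
      the same value, so these local formulas fit together.\<close>
    define \<kappa> where "\<kappa> l = \<phi> (proj L l) l * (H (proj L l) (proj L l) / q (proj L l) (proj L l) ^ M (proj L l))" for l
    have \<kappa>: "\<kappa> l = \<phi> p l * (H p y / q p y ^ M p)"
      if p: "p \<in> Y" and y: "y \<in> Y" "q p y \<noteq> 0" and l: "l \<in> fibre L y" for p y l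
    proof -
      have pl: "proj L l = y" using l by (simp add: fibre_def)
      have "\<phi> y l = g p y y * \<phi> p l"
        by (rule g(2)[OF p y(1) qW[OF p y] qW[OF y(1) y(1) q(2)[OF y(1)]] l])
      then show ?thesis unfolding \<kappa>_def pl gH[OF p y(1,1) y(2) q(2)[OF y(1)], symmetric] by simp
    qed
    have "line_bundle_isomorphic E Y L (restrict_bundle (twist_bundle E m) Y)"
    proof (rule isomorphic_to_twist[OF finE Y_subset L, where \<kappa> = \<kappa>])
      fix y assume y: "y \<in> Y"
      let ?a = "H y y / q y y ^ M y"
      have a: "?a \<noteq> 0" using Hnz[OF y y] q(2)[OF y] by simp
      note at_y = at[OF y] qW[OF y y q(2)[OF y]]
      have \<kappa>y: "\<kappa> l = \<phi> y l * ?a" if "l \<in> fibre L y" for l using \<kappa>[OF y y q(2)[OF y] that] .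
      have "bij_betw (\<lambda>z. z * ?a) UNIV (UNIV :: complex set)"
        using a by (intro bij_betw_byWitness[where f' = "\<lambda>z. z / ?a"]) auto
      from bij_betw_trans[OF triv(1)[OF at_y] this]
      show "bij_betw \<kappa> (fibre L y) UNIV"
        by (rule iffD1[OF bij_betw_cong, rotated]) (simp add: \<kappa>y)
      fix l assume l: "l \<in> fibre L y"
      show "\<kappa> (fscale L b l) = b * \<kappa> l" for b
        using \<kappa>y[OF scale_closed[OF y l]] \<kappa>y[OF l] triv(3)[OF at_y l] by simp
      fix l' assume l': "l' \<in> fibre L y"
      have "fadd L l l' \<in> fibre L y" by (rule line_bundle_add_closed[OF L y l l'])
      then show "\<kappa> (fadd L l l') = \<kappa> l + \<kappa> l'"
        using \<kappa>y l l' triv(2)[OF at_y l l'] by (simp add: distrib_right add_divide_distrib)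
    next
      fix W \<psi> F G assume W: "(W, \<psi>) \<in> atlas L" and FG: "(F, G) \<in> form_pairs E m"
      let ?W = "{x \<in> W. F x \<noteq> 0 \<and> G x \<noteq> 0}"
      \<comment> \<open>The unit frame of the chart: by linearity, comparing \<open>\<kappa>\<close>
        with \<open>\<psi>\<close> amounts to evaluating \<open>\<kappa>\<close> on
        \<open>s\<close>.\<close>
      define s where "s x = (SOME l. l \<in> fibre L x \<and> \<psi> l = 1)" for x
      have s: "s x \<in> fibre L x" "\<psi> (s x) = 1" if "x \<in> W" for x
        using someI_ex[of "\<lambda>l. l \<in> fibre L x \<and> \<psi> l = 1"] unit_vector[OF W that] unfolding s_def by blast+
      define f where "f x = \<kappa> (s x) * (G x / F x)" for x
      have WP: "?W \<subseteq> P1_power E" using WY[OF W] Y_subset by blast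
      have "regular_on E ?W f"
      proof (rule regular_on_local[OF finE WP])
        fix p assume "p \<in> ?W"
        then have p: "p \<in> Y" using WY[OF W] by blast
        let ?U = "{x \<in> ?W. q p x \<noteq> 0}"
        obtain t where t: "regular_on E (W \<inter> fst (c p)) t"
          "\<forall>x\<in>W \<inter> fst (c p). \<forall>l\<in>fibre L x. \<phi> p l = t x * \<psi> l"
          using trans[OF W at[OF p]] by blast
        have sub: "?U \<subseteq> W \<inter> fst (c p)" using qW[OF p] WY[OF W] by blast
        have UP: "?U \<subseteq> P1_power E" using WP by blast
        \<comment> \<open>\<open>H p / q p ^ M p\<close> has multidegree \<open>m\<close>, so its
          ratio with \<open>F / G\<close> has multidegree 0 and is regular.\<close>
        have Hq: "(H p, \<lambda>x. q p x ^ M p) \<in> form_pairs E m"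
          unfolding form_pairs_def using H[OF p] MF_power[OF finE q(1)[OF p], of "M p"] MH[OF p]
          by (intro CollectI case_prodI exI[of _ "\<lambda>e. nat (int (M p * k p e) + m e)"] exI[of _ "\<lambda>e. M p * k p e"]) auto
        have "regular_on E ?U (\<lambda>x. (H p x * G x) / (F x * q p x ^ M p))"
          by (rule form_pairs_quotient_regular[OF finE Hq FG _ UP]) auto
        from regular_on_mult[OF finE regular_on_subset[OF t(1) sub] this UP]
        have "regular_on E ?U (\<lambda>x. t x * ((H p x * G x) / (F x * q p x ^ M p)))" .
        then have "regular_on E ?U f"
        proof (rule regular_on_cong)
          fix x assume x: "x \<in> ?U"
          then have "x \<in> Y" using WY[OF W] by blast
          then have "\<kappa> (s x) = \<phi> p (s x) * (H p x / q p x ^ M p)"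
            using \<kappa>[OF p, of x "s x"] x s by blast
          moreover have "\<phi> p (s x) = t x" using t(2) sub x s[of x] by auto
          ultimately show "f x = t x * ((H p x * G x) / (F x * q p x ^ M p))"
            by (simp add: f_def ac_simps)
        qed
        then show "\<exists>d r. r \<in> MF E d \<and> r p \<noteq> 0 \<and> regular_on E {x \<in> ?W. r x \<noteq> 0} f"
          using q[OF p] by blast
      qed
      moreover have "\<kappa> l * (G x / F x) = f x * \<psi> l" if x: "x \<in> W" and l: "l \<in> fibre L x" for x l
      proof -
        have y: "x \<in> Y" using x WY[OF W] by blast
        have "\<kappa> l = \<phi> x l * (H x x / q x x ^ M x)" "\<kappa> (s x) = \<phi> x (s x) * (H x x / q x x ^ M x)"
          using \<kappa>[OF y y q(2)[OF y]] l s(1)[OF x] by blast+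
        moreover have "\<phi> x l = \<phi> x (s x) * \<psi> l"
        proof -
          obtain t where t: "\<forall>z\<in>W \<inter> fst (c x). \<forall>l\<in>fibre L z. \<phi> x l = t z * \<psi> l"
            using trans[OF W at[OF y]] by blast
          have xc: "x \<in> W \<inter> fst (c x)" using x qW[OF y y q(2)[OF y]] by blast
          show ?thesis using t xc l s[OF x] by (metis mult.right_neutral)
        qed
        ultimately show ?thesis by (simp add: f_def)
      qed
      ultimately show "\<exists>g. regular_on E ?W g \<and>
          (\<forall>x\<in>W. F x \<noteq> 0 \<longrightarrow> G x \<noteq> 0 \<longrightarrow> (\<forall>l\<in>fibre L x. \<kappa> l * (G x / F x) = g x * \<psi> l))"
        by blast
    qed
    then show ?thesis by blast
  qed
qed

end

theorem proposition3p1: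
  fixes E :: "'e set" and V :: "('e \<Rightarrow> complex) set" and L :: "('e, 'l) line_bundle_data"
  assumes "finite E"
    and "linear_subspace E V"
    and "\<forall>e\<in>E. \<not> V \<subseteq> coord_hyperplane E e"
    and "line_bundle E (matroid_schubert_variety E V) L"
  shows "\<exists>M :: 'e P1_power_bundle.
           line_bundle E (P1_power E) M \<and>
           line_bundle_isomorphic E (matroid_schubert_variety E V)
             L (restrict_bundle M (matroid_schubert_variety E V))"
proof -
  obtain \<rho> where "\<forall>x. (\<lambda>e\<in>E. ev (\<rho> e) x) \<in> V" "\<forall>v\<in>V. \<forall>e\<in>E. ev (\<rho> e) v = v e"
    "\<forall>e x y t. ev (\<rho> e) (\<lambda>e. x e + t * y e) = ev (\<rho> e) x + t * ev (\<rho> e) y" "\<forall>e. \<rho> e \<in> Pol E"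
    using linear_retraction[OF assms(1,2)] by blast
  then interpret subspace_retraction E V \<rho>
    using assms(1-3) by unfold_locales auto
  show ?thesis
    using line_bundle_is_twist[OF assms(4)] line_bundle_twist[OF assms(1)] by blast
qed

end
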